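(* Consider LBMCF1 (with finite demands): an instance consists of a directed graph $G=(V,E)$ with $|V|=n$ and $|E|=m$, an edge capacity function $u:E\to\mathbb R_+$, commodities $(s_i,t_i,d_i)\in V\times V\times\mathbb R^+$, $i=1,\dots,k$, and a length bound $L\in\mathbb Z^+$. Given $\omega\in(0,1)$, a $(1-\omega)$-approximate solution to LBMCF1 may be computed in $O(\omega^{-2}(m+k)\,m\,L\log L)$ time.
   Context: **Notation.** $\mathbb R_+$ denotes the nonnegative reals, $\mathbb R^+$ the positive reals and $\mathbb Z^+$ the positive integers. **Problem.** LBMCF1 (fractional length-bounded maximum multicommodity flow with unit edge-lengths): for each $i$ let $\mathcal P_i(L)$ be the set of paths in $G$ from $s_i$ to $t_i$ with at most $L$ edges. One seeks path flows $x_i(P)\ge 0$, $i=1,\dots,k$, $P\in\mathcal P_i(L)$, such that for every edge $e\in E$ the total flow $\sum_{i=1}^k\sum_{P\in\mathcal P_i(L):\,e\in P}x_i(P)$ is at most $u(e)$, and for every $i$ the amount of flow of commodity $i$, $\sum_{P\in\mathcal P_i(L)}x_i(P)$, is at most $d_i$. The objective is to maximize the total flow $\sum_{i=1}^k\sum_{P\in\mathcal P_i(L)}x_i(P)$; let $f^*$ be the optimal value. A feasible solution is $(1-\omega)$-approximate if its objective value is at least $(1-\omega)f^*$. **Standing assumption (without loss of generality).** The pairs $(s_i,t_i)$ are pairwise distinct. *)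

theory Defs
  imports Complex_Main "Graph_Theory.Arc_Walk"
begin

section \<open>The problem LBMCF1\<close>

text \<open>
  Paths are the \<^const>\<open>pre_digraph.apath\<close>s of the graph library: lists of arcs that visit no
  vertex twice. If \<open>s i = t i\<close>, the only path of commodity \<open>i\<close> is the empty one.
  The commodities are numbered \<open>0, \<dots>, k - 1\<close>. Loops and parallel arcs are allowed.
\<close>

locale lbmcf1 = fin_digraph G
  for G :: "('v, 'e) pre_digraph" (structure) +
  fixes u :: "'e \<Rightarrow> real"
    and k :: nat
    and s :: "nat \<Rightarrow> 'v"
    and t :: "nat \<Rightarrow> 'v"
    and d :: "nat \<Rightarrow> real"
    and L :: nat
  assumes capacity_nonneg: "e \<in> arcs G \<Longrightarrow> 0 \<le> u e"
    and source_in_verts: "i < k \<Longrightarrow> s i \<in> verts G"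
    and sink_in_verts: "i < k \<Longrightarrow> t i \<in> verts G"
    and demand_pos: "i < k \<Longrightarrow> 0 < d i"
    and pairs_distinct: "inj_on (\<lambda>i. (s i, t i)) {..<k}"
    and length_bound_pos: "1 \<le> L"
begin

definition paths :: "nat \<Rightarrow> 'e list set" where
  "paths i = {P. apath (s i) P (t i) \<and> length P \<le> L}"

definition amount :: "(nat \<Rightarrow> 'e list \<Rightarrow> real) \<Rightarrow> nat \<Rightarrow> real" where
  "amount x i = (\<Sum>P\<in>paths i. x i P)"

definition total_flow :: "(nat \<Rightarrow> 'e list \<Rightarrow> real) \<Rightarrow> real" where
  "total_flow x = (\<Sum>i<k. amount x i)"

text \<open>
  A family of path flows is indexed by the pairs \<open>(i, P)\<close> with \<open>i < k\<close> and \<open>P \<in> paths i\<close> only;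
  as a total function, it is extended by \<open>0\<close>.
\<close>

definition feasible :: "(nat \<Rightarrow> 'e list \<Rightarrow> real) \<Rightarrow> bool" where
  "feasible x \<longleftrightarrow>
     (\<forall>i<k. \<forall>P\<in>paths i. 0 \<le> x i P) \<and>
     (\<forall>i P. \<not> (i < k \<and> P \<in> paths i) \<longrightarrow> x i P = 0) \<and>
     (\<forall>e\<in>arcs G. (\<Sum>i<k. \<Sum>P\<in>{P \<in> paths i. e \<in> set P}. x i P) \<le> u e) \<and>
     (\<forall>i<k. amount x i \<le> d i)"

definition opt :: real where
  "opt = (SUP x\<in>Collect feasible. total_flow x)"

definition approximate_solution :: "real \<Rightarrow> (nat \<Rightarrow> 'e list \<Rightarrow> real) \<Rightarrow> bool" where
  "approximate_solution \<omega> x \<longleftrightarrow> feasible x \<and> (1 - \<omega>) * opt \<le> total_flow x"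

lemma finite_paths: "finite (paths i)"
  unfolding paths_def by (rule finite_subset[OF _ apaths_finite]) auto

lemma feasible_zero: "feasible (\<lambda>_ _. 0)"
  using capacity_nonneg demand_pos by (auto simp: feasible_def amount_def less_imp_le)

lemma bdd_above_total_flow: "bdd_above (total_flow ` Collect feasible)"
proof (rule bdd_aboveI2)
  fix x assume "x \<in> Collect feasible"
  then show "total_flow x \<le> (\<Sum>i<k. d i)"
    unfolding total_flow_def feasible_def by (intro sum_mono) auto
qed

end


section \<open>The machine model\<close>

text \<open>
  Running times are measured on a real RAM, given as a while language. The memory consists of
  arrays of natural numbers and arrays of reals, all of them infinite; cell \<open>0\<close> of an array
  serves as a scalar variable. A program mentions finitely many arrays, so this is a RAM with
  interleaved memory. Natural numbers admit addition and truncated subtraction, reals admit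
  the four field operations. There is no conversion from reals to natural numbers, and the only
  constants are natural numbers.
\<close>

datatype nexp =
    N nat
  | NCell string nexp
  | NPlus nexp nexp
  | NMinus nexp nexp

datatype rexp =
    OfNat nexp
  | RCell string nexp
  | RPlus rexp rexp
  | RMinus rexp rexp
  | RTimes rexp rexp
  | RDiv rexp rexp

datatype bexp =
    NLess nexp nexp
  | RLess rexp rexp
  | Neg bexp
  | Conj bexp bexp

datatype com =
    Skip
  | NAssign string nexp nexp
  | RAssign string nexp rexp
  | Seq com com
  | If bexp com com
  | While bexp com

type_synonym state = "(string \<Rightarrow> nat \<Rightarrow> nat) \<times> (string \<Rightarrow> nat \<Rightarrow> real)"

fun nval :: "nexp \<Rightarrow> state \<Rightarrow> nat" where
  "nval (N n) \<sigma> = n"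
| "nval (NCell a j) \<sigma> = fst \<sigma> a (nval j \<sigma>)"
| "nval (NPlus a b) \<sigma> = nval a \<sigma> + nval b \<sigma>"
| "nval (NMinus a b) \<sigma> = nval a \<sigma> - nval b \<sigma>"

fun rval :: "rexp \<Rightarrow> state \<Rightarrow> real" where
  "rval (OfNat a) \<sigma> = real (nval a \<sigma>)"
| "rval (RCell a j) \<sigma> = snd \<sigma> a (nval j \<sigma>)"
| "rval (RPlus a b) \<sigma> = rval a \<sigma> + rval b \<sigma>"
| "rval (RMinus a b) \<sigma> = rval a \<sigma> - rval b \<sigma>"
| "rval (RTimes a b) \<sigma> = rval a \<sigma> * rval b \<sigma>"
| "rval (RDiv a b) \<sigma> = rval a \<sigma> / rval b \<sigma>"

fun bval :: "bexp \<Rightarrow> state \<Rightarrow> bool" where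
  "bval (NLess a b) \<sigma> \<longleftrightarrow> nval a \<sigma> < nval b \<sigma>"
| "bval (RLess a b) \<sigma> \<longleftrightarrow> rval a \<sigma> < rval b \<sigma>"
| "bval (Neg b) \<sigma> \<longleftrightarrow> \<not> bval b \<sigma>"
| "bval (Conj a b) \<sigma> \<longleftrightarrow> bval a \<sigma> \<and> bval b \<sigma>"

definition store :: "(string \<Rightarrow> nat \<Rightarrow> 'a) \<Rightarrow> string \<Rightarrow> nat \<Rightarrow> 'a \<Rightarrow> string \<Rightarrow> nat \<Rightarrow> 'a" where
  "store M a j v = M(a := (M a)(j := v))"

text \<open>
  \<open>exec c \<sigma> T \<sigma>'\<close>: started in \<open>\<sigma>\<close>, the program \<open>c\<close> halts in \<open>\<sigma>'\<close> after time \<open>T\<close>. Every assignment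
  and every test takes one unit of time; the number of operations in one expression
  is bounded by a constant that depends on the program alone.
\<close>

inductive exec :: "com \<Rightarrow> state \<Rightarrow> nat \<Rightarrow> state \<Rightarrow> bool" where
  Skip: "exec Skip \<sigma> 1 \<sigma>"
| NAssign: "exec (NAssign a j e) \<sigma> 1 (store (fst \<sigma>) a (nval j \<sigma>) (nval e \<sigma>), snd \<sigma>)"
| RAssign: "exec (RAssign a j e) \<sigma> 1 (fst \<sigma>, store (snd \<sigma>) a (nval j \<sigma>) (rval e \<sigma>))"
| Seq: "exec c\<^sub>1 \<sigma> T\<^sub>1 \<sigma>' \<Longrightarrow> exec c\<^sub>2 \<sigma>' T\<^sub>2 \<sigma>'' \<Longrightarrow> exec (Seq c\<^sub>1 c\<^sub>2) \<sigma> (T\<^sub>1 + T\<^sub>2) \<sigma>''"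
| IfTrue: "bval b \<sigma> \<Longrightarrow> exec c\<^sub>1 \<sigma> T \<sigma>' \<Longrightarrow> exec (If b c\<^sub>1 c\<^sub>2) \<sigma> (1 + T) \<sigma>'"
| IfFalse: "\<not> bval b \<sigma> \<Longrightarrow> exec c\<^sub>2 \<sigma> T \<sigma>' \<Longrightarrow> exec (If b c\<^sub>1 c\<^sub>2) \<sigma> (1 + T) \<sigma>'"
| WhileFalse: "\<not> bval b \<sigma> \<Longrightarrow> exec (While b c) \<sigma> 1 \<sigma>"
| WhileTrue: "bval b \<sigma> \<Longrightarrow> exec c \<sigma> T\<^sub>1 \<sigma>' \<Longrightarrow> exec (While b c) \<sigma>' T\<^sub>2 \<sigma>'' \<Longrightarrow>
    exec (While b c) \<sigma> (1 + T\<^sub>1 + T\<^sub>2) \<sigma>''"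

inductive_cases exec_SkipE: "exec Skip \<sigma> T \<sigma>'"
inductive_cases exec_NAssignE: "exec (NAssign a j e) \<sigma> T \<sigma>'"
inductive_cases exec_RAssignE: "exec (RAssign a j e) \<sigma> T \<sigma>'"
inductive_cases exec_SeqE: "exec (Seq c\<^sub>1 c\<^sub>2) \<sigma> T \<sigma>'"
inductive_cases exec_IfE: "exec (If b c\<^sub>1 c\<^sub>2) \<sigma> T \<sigma>'"
inductive_cases exec_WhileE: "exec (While b c) \<sigma> T \<sigma>'"

lemma exec_deterministic:
  assumes "exec c \<sigma> T \<sigma>'" "exec c \<sigma> U \<tau>"
  shows "U = T \<and> \<tau> = \<sigma>'"
  using assms
proof (induction arbitrary: U \<tau> rule: exec.induct)
  case (Seq c\<^sub>1 \<sigma> T\<^sub>1 \<sigma>' c\<^sub>2 T\<^sub>2 \<sigma>'')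
  from Seq.prems obtain U\<^sub>1 U\<^sub>2 \<tau>' where
    U: "U = U\<^sub>1 + U\<^sub>2" "exec c\<^sub>1 \<sigma> U\<^sub>1 \<tau>'" "exec c\<^sub>2 \<tau>' U\<^sub>2 \<tau>"
    by (rule exec_SeqE)
  from Seq.IH(1)[OF U(2)] U(3) have "U\<^sub>1 = T\<^sub>1" "exec c\<^sub>2 \<sigma>' U\<^sub>2 \<tau>" by simp_all
  with Seq.IH(2) U(1) show ?case by simp
next
  case (IfTrue b \<sigma> c\<^sub>1 T \<sigma>' c\<^sub>2)
  from IfTrue.prems obtain U\<^sub>1 where "U = 1 + U\<^sub>1" "exec c\<^sub>1 \<sigma> U\<^sub>1 \<tau>"
    by (rule exec_IfE) (use IfTrue.hyps(1) in simp_all)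
  with IfTrue.IH show ?case by simp
next
  case (IfFalse b \<sigma> c\<^sub>2 T \<sigma>' c\<^sub>1)
  from IfFalse.prems obtain U\<^sub>1 where "U = 1 + U\<^sub>1" "exec c\<^sub>2 \<sigma> U\<^sub>1 \<tau>"
    by (rule exec_IfE) (use IfFalse.hyps(1) in simp_all)
  with IfFalse.IH show ?case by simp
next
  case (WhileFalse b \<sigma> c)
  from WhileFalse.prems show ?case
    by (rule exec_WhileE) (simp_all add: WhileFalse.hyps)
next
  case (WhileTrue b \<sigma> c T\<^sub>1 \<sigma>' T\<^sub>2 \<sigma>'')
  from WhileTrue.prems obtain U\<^sub>1 U\<^sub>2 \<tau>' where
    U: "U = 1 + U\<^sub>1 + U\<^sub>2" "exec c \<sigma> U\<^sub>1 \<tau>'" "exec (While b c) \<tau>' U\<^sub>2 \<tau>"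
    by (rule exec_WhileE) (use WhileTrue.hyps(1) in simp_all)
  from WhileTrue.IH(1)[OF U(2)] U(3) have "U\<^sub>1 = T\<^sub>1" "exec (While b c) \<sigma>' U\<^sub>2 \<tau>" by simp_all
  with WhileTrue.IH(2) U(1) show ?case by simp
qed (auto elim: exec_SkipE exec_NAssignE exec_RAssignE)


section \<open>Input and output of a program for LBMCF1\<close>

text \<open>
  The vertices are the numbers below \<open>card (verts G)\<close>, the arcs the numbers below \<open>card (arcs G)\<close>.
  The graph is given by its list of arcs. All cells that do not hold input are \<open>0\<close>.
\<close>

definition array :: "nat \<Rightarrow> (nat \<Rightarrow> 'a) \<Rightarrow> nat \<Rightarrow> 'a::zero" where
  "array n f j = (if j < n then f j else 0)"

abbreviation scalar :: "'a \<Rightarrow> nat \<Rightarrow> 'a::zero" where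
  "scalar c \<equiv> array 1 (\<lambda>_. c)"

definition input_state ::
  "(nat, nat) pre_digraph \<Rightarrow> (nat \<Rightarrow> real) \<Rightarrow> nat \<Rightarrow> (nat \<Rightarrow> nat) \<Rightarrow> (nat \<Rightarrow> nat) \<Rightarrow>
   (nat \<Rightarrow> real) \<Rightarrow> nat \<Rightarrow> real \<Rightarrow> state" where
  "input_state G u k s t d L \<omega> =
    ((\<lambda>_ _. 0)
       (''n'' := scalar (card (verts G)),
        ''m'' := scalar (card (arcs G)),
        ''k'' := scalar k,
        ''L'' := scalar L,
        ''tail'' := array (card (arcs G)) (tail G),
        ''head'' := array (card (arcs G)) (head G),
        ''s'' := array k s,
        ''t'' := array k t),
     (\<lambda>_ _. 0)
       (''u'' := array (card (arcs G)) u,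
        ''d'' := array k d,
        ''omega'' := scalar \<omega>))"

text \<open>
  The output is a list of \<open>count\<close> entries. Entry \<open>j\<close> sends \<open>flow j\<close> units of commodity \<open>com j\<close> along
  the path stored in the cells \<open>start j, \<dots>, start (j + 1) - 1\<close> of the array \<open>path\<close>.
  The same path may occur in several entries.
\<close>

definition output_path :: "state \<Rightarrow> nat \<Rightarrow> nat list" where
  "output_path \<sigma> j = map (fst \<sigma> ''path'') [fst \<sigma> ''start'' j ..< fst \<sigma> ''start'' (Suc j)]"

definition output_flow :: "state \<Rightarrow> nat \<Rightarrow> nat list \<Rightarrow> real" where
  "output_flow \<sigma> i P =
    (\<Sum>j | j < fst \<sigma> ''count'' 0 \<and> fst \<sigma> ''com'' j = i \<and> output_path \<sigma> j = P. snd \<sigma> ''flow'' j)"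

end

theory Submission
  imports Defs
begin

text \<open>
  The algorithm is the multiplicative weights method of Garg and Konemann with the phases of
  Fleischer. Every arc and every demand is a resource, and its weight is 1 at first. In phase \<open>r\<close> the
  commodities are served in turn, each along paths of weight below \<open>(1 + \<epsilon>) ^ (r + 1)\<close>. The flow sent
  along a path is its bottleneck \<open>c\<close>, which multiplies the weight of a resource of capacity \<open>a\<close> on the
  path by \<open>1 + \<epsilon> * c / a\<close>. After \<open>M\<close> phases all paths have weight at least \<open>(1 + \<epsilon>) ^ M\<close>, no weight
  exceeds \<open>(1 + \<epsilon>) ^ (M + 1)\<close>, and so the flow divided by \<open>M + 1\<close> is feasible. Weak duality bounds the
  growth of the weights by the flow sent relative to any feasible flow, so that the result
  is nearly optimal once \<open>M\<close> is about \<open>\<epsilon>\<^sup>-\<^sup>2 log L\<close>. Every path saturates a resource, which can occur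
  at most \<open>M\<close> times for each, and hence there are at most \<open>(m + k) M\<close> paths and \<open>k M\<close> failed searches.
  A search is a dynamic program over the number of arcs and takes time \<open>O(m L)\<close>.
\<close>

section \<open>Multiplicative weights for packing problems\<close>

text \<open>A potential that starts from the total initial weight would give a logarithm of the
  number of resources. The initial weights are therefore subtracted before weak duality is applied,
  and the start becomes \<open>K\<close> times the value of the flow compared with, where
  \<open>K\<close> bounds the resources of a single column. For paths \<open>K = L + 1\<close>,
  which is the origin of log L.

  The machine can neither round nor take logarithms. So \<epsilon> is the inverse of an integer
  \<open>q\<close> found by counting, and the logarithm is an integer \<open>l\<close> found by
  doubling. Then \<open>M = q * q * l\<close> satisfies \<open>M * \<epsilon>\<^sup>2 = l\<close>
  exactly, and three losses are each at most \<open>M * \<epsilon>\<^sup>2\<close>: the term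
  \<open>ln K\<close>, the second-order error of \<open>ln (1 + \<epsilon>)\<close> over
  \<open>M\<close> phases, and the 1 in the division by \<open>M + 1\<close>.

  The analysis concerns an abstract relation of admissible runs. The program has to be shown to
  follow this relation and to keep its own account of time.\<close>

locale packing =
  fixes cols :: "'p set" and rsc :: "'p \<Rightarrow> 'r set" and R :: "'r set" and cap :: "'r \<Rightarrow> real" and K :: nat
  assumes finite_cols: "finite cols"
    and finite_R: "finite R"
    and rsc_subset: "p \<in> cols \<Longrightarrow> rsc p \<subseteq> R"
    and rsc_nonempty: "p \<in> cols \<Longrightarrow> rsc p \<noteq> {}"
    and card_rsc: "p \<in> cols \<Longrightarrow> card (rsc p) \<le> K"
    and cap_nonneg: "r \<in> R \<Longrightarrow> 0 \<le> cap r"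
begin

definition weight :: "('r \<Rightarrow> real) \<Rightarrow> 'p \<Rightarrow> real" where
  "weight w p = (\<Sum>r\<in>rsc p. w r)"

definition load :: "('p \<Rightarrow> real) \<Rightarrow> 'r \<Rightarrow> real" where
  "load x r = (\<Sum>p | p \<in> cols \<and> r \<in> rsc p. x p)"

text \<open>A resource of capacity zero forces every column through it to zero. Such columns are
  kept away from the algorithm, as they allow no progress and the growth factor divides by the
  capacity.\<close>

definition usable :: "'p \<Rightarrow> bool" where
  "usable p \<longleftrightarrow> p \<in> cols \<and> (\<forall>r\<in>rsc p. 0 < cap r)"

definition bottleneck :: "'p \<Rightarrow> real" where
  "bottleneck p = Min (cap ` rsc p)"

definition packs :: "('p \<Rightarrow> real) \<Rightarrow> bool" where
  "packs x \<longleftrightarrow> (\<forall>p\<in>cols. 0 \<le> x p) \<and> (\<forall>r\<in>R. load x r \<le> cap r)"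

text \<open>All runs that the analysis admits, with the choice of columns left open. The two
  conditions on powers of \<open>1 + \<epsilon>\<close> make \<open>p\<close> lightest among the
  usable columns up to that factor, without computing a minimum. The number \<open>n\<close> of
  steps is recorded for the running time.\<close>

inductive augmented :: "real \<Rightarrow> nat \<Rightarrow> nat \<Rightarrow> ('r \<Rightarrow> real) \<Rightarrow> ('p \<Rightarrow> real) \<Rightarrow> bool"
  for \<epsilon> :: real and M :: nat where
  start: "augmented \<epsilon> M 0 (\<lambda>_. 1) (\<lambda>_. 0)"
| augment: "augmented \<epsilon> M n w x \<Longrightarrow> usable p \<Longrightarrow> j < M \<Longrightarrow>
    (\<And>p'. usable p' \<Longrightarrow> (1 + \<epsilon>) ^ j \<le> weight w p') \<Longrightarrow> weight w p < (1 + \<epsilon>) ^ Suc j \<Longrightarrow>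
    augmented \<epsilon> M (Suc n)
      (\<lambda>r. if r \<in> rsc p then w r * (1 + \<epsilon> * bottleneck p / cap r) else w r)
      (x(p := x p + bottleneck p))"

lemma finite_rsc: "p \<in> cols \<Longrightarrow> finite (rsc p)"
  using finite_R finite_subset rsc_subset by blast

lemma usable_in_cols: "usable p \<Longrightarrow> p \<in> cols"
  by (simp add: usable_def)

lemma bottleneck_le: "usable p \<Longrightarrow> r \<in> rsc p \<Longrightarrow> bottleneck p \<le> cap r"
  unfolding bottleneck_def by (intro Min_le) (auto simp: finite_rsc usable_in_cols)

lemma bottleneck_attained:
  assumes "usable p"
  obtains r where "r \<in> rsc p" "bottleneck p = cap r"
proof -
  have "bottleneck p \<in> cap ` rsc p"
    unfolding bottleneck_def using assms
    by (intro Min_in) (auto simp: finite_rsc usable_in_cols rsc_nonempty)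
  then show ?thesis using that by blast
qed

lemma bottleneck_pos: "usable p \<Longrightarrow> 0 < bottleneck p"
  by (metis bottleneck_attained usable_def)

lemma load_fun_upd:
  assumes "p \<in> cols"
  shows "load (x(p := x p + c)) r = load x r + (if r \<in> rsc p then c else 0)"
proof -
  let ?A = "{q. q \<in> cols \<and> r \<in> rsc q}"
  have fin: "finite ?A" using finite_cols by simp
  have "load (x(p := x p + c)) r = (\<Sum>q\<in>?A. x q + (if q = p then c else 0))"
    unfolding load_def by (intro sum.cong) auto
  also have "\<dots> = load x r + (\<Sum>q\<in>?A. if q = p then c else 0)"
    unfolding load_def by (simp add: sum.distrib)
  also have "(\<Sum>q\<in>?A. if q = p then c else 0) = (if r \<in> rsc p then c else 0)"
    using assms sum.delta[OF fin, of p "\<lambda>_. c"] by simp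
  finally show ?thesis .
qed

lemma sum_fun_upd:
  fixes x :: "'p \<Rightarrow> real"
  assumes "p \<in> cols"
  shows "(\<Sum>q\<in>cols. (x(p := x p + c)) q) = (\<Sum>q\<in>cols. x q) + c"
proof -
  have "(\<Sum>q\<in>cols. (x(p := x p + c)) q) = (\<Sum>q\<in>cols. x q + (if q = p then c else 0))"
    by (intro sum.cong) auto
  also have "\<dots> = (\<Sum>q\<in>cols. x q) + c"
    using assms sum.delta[OF finite_cols, of p "\<lambda>_. c"] by (simp add: sum.distrib)
  finally show ?thesis .
qed

section \<open>Bounds on the weights, the loads and the number of steps\<close>

lemma augmented_ge_1:
  assumes "augmented \<epsilon> M n w x" "0 \<le> \<epsilon>" "r \<in> R"
  shows "1 \<le> w r"
  using assms
proof (induction rule: augmented.induct)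
  case (augment n w x p j)
  have "1 \<le> w r * (1 + \<epsilon> * bottleneck p / cap r)" if "r \<in> rsc p"
  proof -
    have "0 \<le> \<epsilon> * bottleneck p / cap r"
      using augment.prems cap_nonneg bottleneck_pos[OF augment.hyps(2)] by simp
    then show ?thesis using augment mult_mono[of 1 "w r" 1] by simp
  qed
  then show ?case using augment by simp
qed simp

lemma augmented_nonneg:
  assumes "augmented \<epsilon> M n w x"
  shows "0 \<le> x p" "p \<notin> cols \<Longrightarrow> x p = 0"
  using assms
  by (induction rule: augmented.induct)
    (auto simp: less_imp_le[OF bottleneck_pos] usable_in_cols)

lemma weight_ge:
  assumes "augmented \<epsilon> M n w x" "0 \<le> \<epsilon>" "p \<in> cols" "r \<in> rsc p"
  shows "w r \<le> weight w p"
  unfolding weight_def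
proof (intro member_le_sum)
  fix r' assume "r' \<in> rsc p - {r}"
  then have "1 \<le> w r'" using assms augmented_ge_1 rsc_subset by blast
  then show "0 \<le> w r'" by simp
qed (use assms finite_rsc in auto)

lemma weight_mono:
  assumes "p \<in> cols" "\<And>r. r \<in> R \<Longrightarrow> w r \<le> w' r"
  shows "weight w p \<le> weight w' p"
  unfolding weight_def using assms rsc_subset by (intro sum_mono) auto

text \<open>Bernoulli's inequality for exponents in the unit interval. It says that sending the
  fraction \<open>a\<close> of a capacity is worth at least the share \<open>a\<close> of a full
  factor \<open>1 + \<epsilon>\<close>. Both logarithms vanish at \<epsilon> = 0, and their
  derivatives in \<epsilon> are compared.\<close>

lemma powr_le_affine:
  fixes \<epsilon> a :: real
  assumes "0 \<le> \<epsilon>" "0 \<le> a" "a \<le> 1"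
  shows "(1 + \<epsilon>) powr a \<le> 1 + \<epsilon> * a"
proof -
  have "ln (1 + a * 0) - a * ln (1 + 0) \<le> ln (1 + a * \<epsilon>) - a * ln (1 + \<epsilon>)"
  proof (rule DERIV_nonneg_imp_nondecreasing[where f = "\<lambda>x. ln (1 + a * x) - a * ln (1 + x)"])
    fix x :: real assume x: "0 \<le> x" "x \<le> \<epsilon>"
    have "((\<lambda>x. ln (1 + a * x) - a * ln (1 + x)) has_real_derivative a / (1 + a * x) - a / (1 + x)) (at x)"
      using x assms by (auto intro!: derivative_eq_intros simp: add_pos_nonneg)
    moreover have "a / (1 + x) \<le> a / (1 + a * x)"
      using x assms mult_left_le_one_le[of x a] by (intro divide_left_mono) (auto simp: add_pos_nonneg)
    ultimately show "\<exists>y. ((\<lambda>x. ln (1 + a * x) - a * ln (1 + x)) has_real_derivative y) (at x) \<and> 0 \<le> y"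
      by (intro exI conjI) (assumption, simp)
  qed (use assms in simp)
  then have "exp (a * ln (1 + \<epsilon>)) \<le> exp (ln (1 + a * \<epsilon>))" by simp
  then show ?thesis using assms by (simp add: powr_def add_pos_nonneg mult.commute)
qed

text \<open>By \<open>powr_le_affine\<close>, the relative load never exceeds the logarithm of the
  weight to base \<open>1 + \<epsilon>\<close>, so an upper bound on the weight bounds the load. A
  resource of capacity zero has no relative load and is treated apart; usable columns avoid
  it.\<close>

lemma augmented_load:
  assumes "augmented \<epsilon> M n w x" "0 < \<epsilon>" "r \<in> R"
  shows "0 < cap r \<Longrightarrow> (1 + \<epsilon>) powr (load x r / cap r) \<le> w r"
    and "w r \<le> (1 + \<epsilon>) ^ Suc M"
    and "cap r = 0 \<Longrightarrow> load x r = 0"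
proof -
  have "(0 < cap r \<longrightarrow> (1 + \<epsilon>) powr (load x r / cap r) \<le> w r) \<and> w r \<le> (1 + \<epsilon>) ^ Suc M \<and>
    (cap r = 0 \<longrightarrow> load x r = 0)"
    using assms
  proof (induction rule: augmented.induct)
    case start
    then show ?case using one_le_power[of "1 + \<epsilon>" "Suc M"] by (simp add: load_def)
  next
    case (augment n w x p j)
    note IH = augment.IH[OF augment.prems]
    show ?case
    proof (cases "r \<in> rsc p")
      case False
      then show ?thesis using IH augment.hyps(2) by (simp add: load_fun_upd usable_in_cols del: fun_upd_apply)
    next
      case True
      let ?a = "bottleneck p / cap r"
      have c: "0 < cap r" using True augment.hyps(2) by (simp add: usable_def)
      have a: "0 \<le> ?a" "?a \<le> 1"
        using c bottleneck_le[OF augment.hyps(2) True] bottleneck_pos[OF augment.hyps(2)] by auto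
      have w: "1 \<le> w r" using augmented_ge_1[OF augment.hyps(1)] augment.prems by simp
      have "(1 + \<epsilon>) powr (load (x(p := x p + bottleneck p)) r / cap r)
          = (1 + \<epsilon>) powr (load x r / cap r) * (1 + \<epsilon>) powr ?a"
        using True augment.hyps(2)
        by (simp add: load_fun_upd usable_in_cols add_divide_distrib powr_add del: fun_upd_apply)
      also have "\<dots> \<le> w r * (1 + \<epsilon> * ?a)"
        using IH c a w augment.prems powr_le_affine[of \<epsilon> ?a] by (intro mult_mono) auto
      finally have 1: "(1 + \<epsilon>) powr (load (x(p := x p + bottleneck p)) r / cap r)
          \<le> w r * (1 + \<epsilon> * ?a)" .
      \<comment> \<open>A resource that grows lies on the chosen column, whose weight before the
        step is below \<open>(1 + \<epsilon>) ^ Suc j\<close> with \<open>Suc j \<le> M\<close>. The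
        growth factor is at most \<open>1 + \<epsilon>\<close>, hence the exponent
        \<open>Suc M\<close>.\<close>
      have "w r \<le> weight w p"
        using weight_ge[OF augment.hyps(1)] augment.prems True augment.hyps(2) usable_in_cols by simp
      also have "\<dots> \<le> (1 + \<epsilon>) ^ Suc j" using augment.hyps(5) by simp
      also have "\<dots> \<le> (1 + \<epsilon>) ^ M" using augment.hyps(3) augment.prems by (intro power_increasing) auto
      finally have "w r \<le> (1 + \<epsilon>) ^ M" .
      moreover have "0 \<le> \<epsilon> * ?a" "\<epsilon> * ?a \<le> \<epsilon> * 1"
        using a augment.prems by (intro mult_nonneg_nonneg mult_left_mono; simp)+
      ultimately have "w r * (1 + \<epsilon> * ?a) \<le> (1 + \<epsilon>) ^ M * (1 + \<epsilon>)"
        using augment.prems by (intro mult_mono) auto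
      then show ?thesis using 1 True c by (simp add: mult.commute del: fun_upd_apply)
    qed
  qed
  then show "0 < cap r \<Longrightarrow> (1 + \<epsilon>) powr (load x r / cap r) \<le> w r"
    and "w r \<le> (1 + \<epsilon>) ^ Suc M"
    and "cap r = 0 \<Longrightarrow> load x r = 0" by auto
qed

lemma augmented_packs:
  assumes "augmented \<epsilon> M n w x" "0 < \<epsilon>"
  shows "packs (\<lambda>p. x p / real (Suc M))"
  unfolding packs_def
proof (intro conjI ballI)
  show "0 \<le> x p / real (Suc M)" for p using augmented_nonneg[OF assms(1)] by simp
  fix r assume r: "r \<in> R"
  have "load x r \<le> real (Suc M) * cap r"
  proof (cases "cap r = 0")
    case True
    then show ?thesis using augmented_load[OF assms r] by simp
  next
    case False
    then have c: "0 < cap r" using cap_nonneg[OF r] by simp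
    have "(1 + \<epsilon>) powr (load x r / cap r) \<le> (1 + \<epsilon>) powr real (Suc M)"
      using order_trans[OF augmented_load(1,2)[OF assms r]] c assms(2)
      by (simp add: powr_realpow del: of_nat_Suc power_Suc)
    then have "load x r / cap r \<le> real (Suc M)" using assms(2) by (subst (asm) powr_le_cancel_iff) auto
    then show ?thesis using c by (simp add: field_simps)
  qed
  then show "load (\<lambda>p. x p / real (Suc M)) r \<le> cap r"
    unfolding load_def by (simp add: sum_divide_distrib[symmetric] field_simps del: of_nat_Suc)
qed

text \<open>Each step is charged to a resource attaining the bottleneck. The weight of this resource
  grows by exactly \<open>1 + \<epsilon>\<close>, so the number of charges is at most the logarithm
  of its weight.\<close>

lemma augmented_count:
  assumes "augmented \<epsilon> M n w x" "0 < \<epsilon>"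
  shows "n \<le> card R * M"
proof -
  \<comment> \<open>\<open>N r\<close> is the number of charges to \<open>r\<close>. The bound
    \<open>N r \<le> M\<close> has to be carried along, since weights may exceed
    \<open>(1 + \<epsilon>) ^ M\<close> and would only give \<open>Suc M\<close>.\<close>
  have "\<exists>N :: 'r \<Rightarrow> nat. n = sum N R \<and> (\<forall>r\<in>R. (1 + \<epsilon>) ^ N r \<le> w r \<and> N r \<le> M)"
    using assms
  proof (induction rule: augmented.induct)
    case start
    show ?case by (intro exI[of _ "\<lambda>_. 0"]) simp
  next
    case (augment n w x p j)
    then obtain N :: "'r \<Rightarrow> nat" where N: "n = sum N R" "\<And>r. r \<in> R \<Longrightarrow> (1 + \<epsilon>) ^ N r \<le> w r \<and> N r \<le> M"
      by auto
    obtain r0 where r0: "r0 \<in> rsc p" "bottleneck p = cap r0" using bottleneck_attained augment.hyps(2) .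
    have r0R: "r0 \<in> R" using r0(1) rsc_subset usable_in_cols[OF augment.hyps(2)] by blast
    have cap0: "0 < cap r0" using r0 augment.hyps(2) usable_def by blast
    have "(1 + \<epsilon>) ^ N r0 \<le> w r0" using N r0R by simp
    also have "\<dots> \<le> weight w p"
      using weight_ge[OF augment.hyps(1)] augment.prems r0(1) augment.hyps(2) usable_in_cols by simp
    also have "\<dots> < (1 + \<epsilon>) ^ Suc j" using augment.hyps(5) .
    \<comment> \<open>The weight before the step is compared with the column, so
      \<open>N r0 \<le> j\<close>, and \<open>j < M\<close> leaves room for one more charge.\<close>
    finally have "N r0 < Suc j" using augment.prems by (subst (asm) power_strict_increasing_iff) auto
    then have lt: "N r0 < M" using augment.hyps(3) by simp
    have wn: "0 \<le> w r" if "r \<in> R" for r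
      using augmented_ge_1[OF augment.hyps(1) _ that] augment.prems by simp
    show ?case
    proof (intro exI[of _ "N(r0 := Suc (N r0))"] conjI ballI)
      show "Suc n = sum (N(r0 := Suc (N r0))) R"
        unfolding N(1) using finite_R r0R by (simp add: sum.remove[of R r0])
      fix r assume r: "r \<in> R"
      show "(N(r0 := Suc (N r0))) r \<le> M" using lt N(2)[OF r] by simp
      have f: "1 \<le> 1 + \<epsilon> * bottleneck p / cap r"
        using augment.prems cap_nonneg[OF r] bottleneck_pos[OF augment.hyps(2)] by simp
      have g: "w r \<le> (if r \<in> rsc p then w r * (1 + \<epsilon> * bottleneck p / cap r) else w r)"
        using mult_left_mono[OF f wn[OF r]] by simp
      have h: "(1 + \<epsilon>) ^ Suc (N r0) \<le> w r0 * (1 + \<epsilon> * bottleneck p / cap r0)"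
        using N(2)[OF r0R] cap0 r0(2) augment.prems by (simp add: mult.commute mult_right_mono)
      show "(1 + \<epsilon>) ^ (N(r0 := Suc (N r0))) r \<le>
        (if r \<in> rsc p then w r * (1 + \<epsilon> * bottleneck p / cap r) else w r)"
        using N(2)[OF r] g h r0(1) by (cases "r = r0") auto
    qed
  qed
  then obtain N :: "'r \<Rightarrow> nat" where N: "n = sum N R" "\<forall>r\<in>R. N r \<le> M" by auto
  then show ?thesis using sum_bounded_above[of R N M] by simp
qed

section \<open>Weak duality, growth of the potential and the approximation ratio\<close>

lemma weak_duality:
  assumes "packs z" "\<And>r. r \<in> R \<Longrightarrow> 0 \<le> v r"
  shows "(\<Sum>p\<in>cols. z p * weight v p) \<le> (\<Sum>r\<in>R. cap r * v r)"
proof -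
  have "(\<Sum>p\<in>cols. z p * weight v p) = (\<Sum>p\<in>cols. \<Sum>r\<in>R. if r \<in> rsc p then z p * v r else 0)"
  proof (intro sum.cong refl)
    fix p assume p: "p \<in> cols"
    have "(\<Sum>r\<in>R. if r \<in> rsc p then z p * v r else 0) = (\<Sum>r\<in>rsc p. z p * v r)"
      by (rule sum.mono_neutral_cong_right) (use finite_R rsc_subset[OF p] in auto)
    then show "z p * weight v p = (\<Sum>r\<in>R. if r \<in> rsc p then z p * v r else 0)"
      by (simp add: weight_def sum_distrib_left)
  qed
  also have "\<dots> = (\<Sum>r\<in>R. \<Sum>p\<in>cols. if r \<in> rsc p then z p * v r else 0)"
    by (rule sum.swap)
  also have "\<dots> = (\<Sum>r\<in>R. load z r * v r)"
  proof (intro sum.cong refl)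
    fix r
    have "(\<Sum>p\<in>cols. if r \<in> rsc p then z p * v r else 0) = (\<Sum>p | p \<in> cols \<and> r \<in> rsc p. z p * v r)"
      by (rule sum.mono_neutral_cong_right) (use finite_cols in auto)
    then show "(\<Sum>p\<in>cols. if r \<in> rsc p then z p * v r else 0) = load z r * v r"
      by (simp add: load_def sum_distrib_right)
  qed
  also have "\<dots> \<le> (\<Sum>r\<in>R. cap r * v r)"
    using assms by (intro sum_mono mult_right_mono) (auto simp: packs_def)
  finally show ?thesis .
qed

lemma packs_unusable:
  assumes "packs z" "p \<in> cols" "\<not> usable p"
  shows "z p = 0"
proof -
  obtain r where r: "r \<in> rsc p" "\<not> 0 < cap r" using assms by (auto simp: usable_def)
  have rR: "r \<in> R" using r rsc_subset assms by blast
  have "z p \<le> load z r"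
    unfolding load_def
  proof (rule member_le_sum)
    show "p \<in> {p \<in> cols. r \<in> rsc p}" using assms r by simp
    show "0 \<le> z q" if "q \<in> {p \<in> cols. r \<in> rsc p} - {p}" for q
      using assms(1) that by (simp add: packs_def)
    show "finite {p \<in> cols. r \<in> rsc p}" using finite_cols by simp
  qed
  also have "\<dots> \<le> cap r" using assms(1) rR by (simp add: packs_def)
  finally show ?thesis using assms(1,2) r(2) by (simp add: packs_def order.antisym)
qed

text \<open>Weak duality is applied to \<open>w r - 1\<close> instead of \<open>w r\<close>. The
  units removed amount to at most \<open>K\<close> per column, and the remaining dual value starts
  at 0 rather than at the sum of all capacities.\<close>

lemma threshold_le:
  assumes z: "packs z" and w: "augmented \<epsilon> M n w x" "0 \<le> \<epsilon>"
    and ge: "\<And>p. usable p \<Longrightarrow> \<theta> \<le> weight w p"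
  shows "(\<Sum>p\<in>cols. z p) * \<theta> \<le> real K * (\<Sum>p\<in>cols. z p) + (\<Sum>r\<in>R. cap r * (w r - 1))"
proof -
  have "(\<Sum>p\<in>cols. z p) * \<theta> \<le> (\<Sum>p\<in>cols. z p * weight w p)"
    unfolding sum_distrib_right
  proof (intro sum_mono)
    fix p assume "p \<in> cols"
    then show "z p * \<theta> \<le> z p * weight w p"
      using z ge[of p] packs_unusable[OF z] by (cases "usable p") (auto simp: packs_def intro: mult_left_mono)
  qed
  also have "\<dots> \<le> (\<Sum>p\<in>cols. z p * (K + weight (\<lambda>r. w r - 1) p))"
  proof (intro sum_mono mult_left_mono)
    fix p assume p: "p \<in> cols"
    then show "0 \<le> z p" using z by (simp add: packs_def)
    show "weight w p \<le> K + weight (\<lambda>r. w r - 1) p"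
      using card_rsc[OF p] by (simp add: weight_def sum_subtractf)
  qed
  also have "\<dots> = K * (\<Sum>p\<in>cols. z p) + (\<Sum>p\<in>cols. z p * weight (\<lambda>r. w r - 1) p)"
    by (simp add: distrib_left sum.distrib sum_distrib_left mult.commute)
  also have "(\<Sum>p\<in>cols. z p * weight (\<lambda>r. w r - 1) p) \<le> (\<Sum>r\<in>R. cap r * (w r - 1))"
    using weak_duality[OF z, of "\<lambda>r. w r - 1"] augmented_ge_1[OF w] by simp
  finally show ?thesis by simp
qed

text \<open>A step adds \<open>\<epsilon> * c * weight w p\<close> to the left side, where
  \<open>c\<close> is the bottleneck. The weight of \<open>p\<close> is within
  \<open>1 + \<epsilon>\<close> of the threshold, which \<open>threshold_le\<close> bounds by the
  left side divided by \<beta>. So a step multiplies the left side by at most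
  \<open>exp (\<epsilon> * (1 + \<epsilon>) * c / \<beta>)\<close>.\<close>

lemma augmented_potential:
  fixes \<beta> :: real
  assumes w: "augmented \<epsilon> M n w x" and eps: "0 < \<epsilon>"
    and z: "packs z" and \<beta>: "\<beta> = (\<Sum>p\<in>cols. z p)" "0 < \<beta>"
  shows "K * \<beta> + (\<Sum>r\<in>R. cap r * (w r - 1)) \<le> K * \<beta> * exp (\<epsilon> * (1 + \<epsilon>) * (\<Sum>p\<in>cols. x p) / \<beta>)"
  using w
proof (induction rule: augmented.induct)
  case start
  then show ?case by simp
next
  case (augment n w x p j)
  let ?c = "bottleneck p"
  let ?w' = "\<lambda>r. if r \<in> rsc p then w r * (1 + \<epsilon> * ?c / cap r) else w r"
  let ?Z = "K * \<beta> + (\<Sum>r\<in>R. cap r * (w r - 1))"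
  have p: "p \<in> cols" using augment.hyps(2) usable_in_cols by blast
  have c: "0 < ?c" using augment.hyps(2) bottleneck_pos by blast
  have "(\<Sum>r\<in>R. cap r * (?w' r - 1)) = (\<Sum>r\<in>R. cap r * (w r - 1) + (if r \<in> rsc p then \<epsilon> * ?c * w r else 0))"
  proof (intro sum.cong refl)
    fix r assume "r \<in> R"
    show "cap r * (?w' r - 1) = cap r * (w r - 1) + (if r \<in> rsc p then \<epsilon> * ?c * w r else 0)"
    proof (cases "r \<in> rsc p")
      case True
      then have "0 < cap r" using augment.hyps(2) by (simp add: usable_def)
      then show ?thesis using True by (simp add: field_simps)
    qed simp
  qed
  also have "\<dots> = (\<Sum>r\<in>R. cap r * (w r - 1)) + (\<Sum>r\<in>R. if r \<in> rsc p then \<epsilon> * ?c * w r else 0)"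
    by (simp add: sum.distrib)
  also have "(\<Sum>r\<in>R. if r \<in> rsc p then \<epsilon> * ?c * w r else 0) = (\<Sum>r\<in>rsc p. \<epsilon> * ?c * w r)"
    by (rule sum.mono_neutral_cong_right) (use finite_R rsc_subset[OF p] in auto)
  also have "\<dots> = \<epsilon> * ?c * weight w p" by (simp add: weight_def sum_distrib_left)
  finally have 1: "K * \<beta> + (\<Sum>r\<in>R. cap r * (?w' r - 1)) = ?Z + \<epsilon> * ?c * weight w p" by simp
  have "weight w p \<le> (1 + \<epsilon>) * (1 + \<epsilon>) ^ j" using augment.hyps(5) by simp
  also have "(1 + \<epsilon>) ^ j \<le> ?Z / \<beta>"
    using threshold_le[OF z augment.hyps(1) _ augment.hyps(4)] eps \<beta> by (simp add: field_simps)
  finally have 2: "weight w p \<le> (1 + \<epsilon>) * (?Z / \<beta>)" using eps by simp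
  have Z: "0 \<le> ?Z"
    using \<beta> augmented_ge_1[OF augment.hyps(1)] cap_nonneg eps
    by (intro add_nonneg_nonneg sum_nonneg mult_nonneg_nonneg) auto
  have "?Z + \<epsilon> * ?c * weight w p \<le> ?Z + \<epsilon> * ?c * ((1 + \<epsilon>) * (?Z / \<beta>))"
    using 2 eps c by (intro add_left_mono mult_left_mono) auto
  also have "\<dots> = ?Z * (1 + \<epsilon> * (1 + \<epsilon>) * ?c / \<beta>)" using \<beta> by (simp add: field_simps)
  also have "\<dots> \<le> ?Z * exp (\<epsilon> * (1 + \<epsilon>) * ?c / \<beta>)" using Z by (intro mult_left_mono exp_ge_add_one_self) auto
  also have "\<dots> \<le> K * \<beta> * exp (\<epsilon> * (1 + \<epsilon>) * (\<Sum>p\<in>cols. x p) / \<beta>) * exp (\<epsilon> * (1 + \<epsilon>) * ?c / \<beta>)"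
    using augment.IH by (intro mult_right_mono) auto
  also have "\<dots> = K * \<beta> * exp (\<epsilon> * (1 + \<epsilon>) * (\<Sum>q\<in>cols. (x(p := x p + ?c)) q) / \<beta>)"
    unfolding sum_fun_upd[OF p] by (simp add: exp_add[symmetric] add_divide_distrib distrib_left)
  finally show ?case unfolding 1 .
qed

text \<open>Taking logarithms, with
  \<open>\<epsilon> - \<epsilon>\<^sup>2 \<le> ln (1 + \<epsilon>)\<close> and
  \<open>ln K \<le> M * \<epsilon>\<^sup>2\<close>, yields \<open>M * (1 - 2 * \<epsilon>) * \<beta>
  \<le> (1 + \<epsilon>) * f\<close>. The slack between \<open>2 * \<epsilon>\<close> and
  \<open>4 * \<epsilon> \<le> \<omega>\<close> pays for the factor \<open>1 + \<epsilon>\<close> and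
  for dividing by \<open>M + 1\<close>.\<close>

lemma approximation_ratio:
  fixes \<beta> f \<omega> :: real and q l M :: nat
  assumes "0 < \<beta>" and f: "0 \<le> f"
    and q: "1 \<le> q" "4 \<le> q * \<omega>" and K: "1 \<le> K" "K \<le> 2 ^ l" and l: "1 \<le> l" and M: "M = q * q * l"
    and \<epsilon>: "\<epsilon> = 1 / real q" and \<omega>: "0 < \<omega>" "\<omega> < 1"
    and bound: "(1 + \<epsilon>) ^ M \<le> K * exp (\<epsilon> * (1 + \<epsilon>) * f / \<beta>)"
  shows "(1 - \<omega>) * \<beta> \<le> f / real (Suc M)"
proof -
  have eps: "0 < \<epsilon>" "\<epsilon> \<le> 1" "4 * \<epsilon> \<le> \<omega>" using q by (auto simp: \<epsilon> field_simps)
  have M1: "real M * \<epsilon>\<^sup>2 = l" using q by (simp add: M \<epsilon> field_simps power2_eq_square)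
  have "real K \<le> 2 ^ l" using of_nat_mono[OF K(2), where 'a = real] by simp
  then have "ln (real K) \<le> ln (2 ^ l)" using K(1) by simp
  also have "\<dots> \<le> real l" using ln_2_less_1 by (simp add: ln_realpow mult_left_le)
  finally have K2: "ln K \<le> M * \<epsilon>\<^sup>2" using M1 by simp
  have "M * (\<epsilon> - \<epsilon>\<^sup>2) \<le> M * ln (1 + \<epsilon>)"
    using eps ln_one_plus_pos_lower_bound[of \<epsilon>] by (intro mult_left_mono) auto
  also have "\<dots> = ln ((1 + \<epsilon>) ^ M)" using eps by (simp add: ln_realpow)
  also have "\<dots> \<le> ln (K * exp (\<epsilon> * (1 + \<epsilon>) * f / \<beta>))"
    using bound eps K by (subst ln_le_cancel_iff) auto
  also have "\<dots> = ln K + \<epsilon> * (1 + \<epsilon>) * f / \<beta>" using K by (subst ln_mult) auto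
  finally have "M * (\<epsilon> - \<epsilon>\<^sup>2) - M * \<epsilon>\<^sup>2 \<le> \<epsilon> * ((1 + \<epsilon>) * f / \<beta>)" using K2 by simp
  then have "\<epsilon> * (M * (1 - 2 * \<epsilon>)) \<le> \<epsilon> * ((1 + \<epsilon>) * f / \<beta>)"
    by (simp add: algebra_simps power2_eq_square)
  then have "M * (1 - 2 * \<epsilon>) \<le> (1 + \<epsilon>) * f / \<beta>"
    by (rule mult_left_le_imp_le) (use eps in simp)
  then have 1: "M * (1 - 2 * \<epsilon>) * \<beta> \<le> (1 + \<epsilon>) * f" using \<open>0 < \<beta>\<close> by (simp add: field_simps)
  have "(1 - \<omega>) * ((M + 1) * (1 + \<epsilon>)) \<le> (1 - 4 * \<epsilon>) * ((M + 1) * (1 + \<epsilon>))"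
    using eps by (intro mult_right_mono) auto
  \<comment> \<open>The 1 that stems from \<open>M + 1\<close> is absorbed by
    \<open>4 * (M * \<epsilon>\<^sup>2)\<close>, as \<open>M * \<epsilon>\<^sup>2 = l\<close> is at
    least 1.\<close>
  also have "\<dots> = M * (1 - 2 * \<epsilon>) - (M * \<epsilon> - 1) - 4 * (M * \<epsilon>\<^sup>2) - 3 * \<epsilon> - 4 * \<epsilon>\<^sup>2"
    by (simp add: algebra_simps power2_eq_square)
  also have "\<dots> \<le> M * (1 - 2 * \<epsilon>)"
  proof -
    have "1 \<le> M * \<epsilon>\<^sup>2" using M1 l by simp
    moreover have "0 \<le> M * \<epsilon>" using eps by simp
    moreover have "0 \<le> \<epsilon>\<^sup>2" by simp
    ultimately show ?thesis using eps by argo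
  qed
  finally have "(1 - \<omega>) * ((M + 1) * (1 + \<epsilon>)) * \<beta> \<le> M * (1 - 2 * \<epsilon>) * \<beta>"
    using \<open>0 < \<beta>\<close> by (intro mult_right_mono) auto
  then have "(1 + \<epsilon>) * ((1 - \<omega>) * (M + 1) * \<beta>) \<le> (1 + \<epsilon>) * f" using 1 by (simp add: mult_ac)
  then have "(1 - \<omega>) * (M + 1) * \<beta> \<le> f" using eps by simp
  then show ?thesis by (simp add: field_simps)
qed

lemma augmented_approximates:
  assumes w: "augmented \<epsilon> M n w x" and z: "packs z"
    and ge: "\<And>p. usable p \<Longrightarrow> (1 + \<epsilon>) ^ M \<le> weight w p"
    and q: "1 \<le> q" "4 \<le> q * \<omega>" and K: "1 \<le> K" "K \<le> 2 ^ l" and l: "1 \<le> l" and M: "M = q * q * l"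
    and \<epsilon>: "\<epsilon> = 1 / real q" and \<omega>: "0 < \<omega>" "\<omega> < 1"
  shows "(1 - \<omega>) * (\<Sum>p\<in>cols. z p) \<le> (\<Sum>p\<in>cols. x p / real (Suc M))"
proof (cases "0 < (\<Sum>p\<in>cols. z p)")
  case True
  let ?\<beta> = "\<Sum>p\<in>cols. z p"
  let ?f = "\<Sum>p\<in>cols. x p"
  have eps: "0 < \<epsilon>" using q \<epsilon> by simp
  \<comment> \<open>The right side of \<open>threshold_le\<close>, taken at the final threshold, is
    the potential that \<open>augmented_potential\<close> bounds.\<close>
  have "?\<beta> * (1 + \<epsilon>) ^ M \<le> K * ?\<beta> * exp (\<epsilon> * (1 + \<epsilon>) * ?f / ?\<beta>)"
    using threshold_le[OF z w less_imp_le[OF eps] ge] augmented_potential[OF w eps z refl True] by simp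
  then have "?\<beta> * (1 + \<epsilon>) ^ M \<le> ?\<beta> * (K * exp (\<epsilon> * (1 + \<epsilon>) * ?f / ?\<beta>))" by (simp add: mult_ac)
  then have "(1 + \<epsilon>) ^ M \<le> K * exp (\<epsilon> * (1 + \<epsilon>) * ?f / ?\<beta>)" using True by simp
  from approximation_ratio[OF True _ q K l M \<epsilon> \<omega> this] show ?thesis
    using augmented_nonneg[OF w] by (simp add: sum_divide_distrib[symmetric] sum_nonneg)
next
  case False
  then have "(1 - \<omega>) * (\<Sum>p\<in>cols. z p) \<le> 0" using \<omega> by (simp add: mult_nonneg_nonpos)
  also have "0 \<le> (\<Sum>p\<in>cols. x p / real (Suc M))"
    using augmented_nonneg[OF w] by (simp add: sum_nonneg)
  finally show ?thesis .
qed

end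

section \<open>Reasoning about programs\<close>

definition runs :: "com \<Rightarrow> state \<Rightarrow> nat \<Rightarrow> (state \<Rightarrow> bool) \<Rightarrow> bool" where
  "runs c \<sigma> T Q \<longleftrightarrow> (\<exists>T' \<sigma>'. exec c \<sigma> T' \<sigma>' \<and> T' \<le> T \<and> Q \<sigma>')"

primrec nwrites :: "com \<Rightarrow> string set" where
  "nwrites Skip = {}"
| "nwrites (NAssign a j e) = {a}"
| "nwrites (RAssign a j e) = {}"
| "nwrites (Seq c\<^sub>1 c\<^sub>2) = nwrites c\<^sub>1 \<union> nwrites c\<^sub>2"
| "nwrites (If b c\<^sub>1 c\<^sub>2) = nwrites c\<^sub>1 \<union> nwrites c\<^sub>2"
| "nwrites (While b c) = nwrites c"

primrec rwrites :: "com \<Rightarrow> string set" where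
  "rwrites Skip = {}"
| "rwrites (NAssign a j e) = {}"
| "rwrites (RAssign a j e) = {a}"
| "rwrites (Seq c\<^sub>1 c\<^sub>2) = rwrites c\<^sub>1 \<union> rwrites c\<^sub>2"
| "rwrites (If b c\<^sub>1 c\<^sub>2) = rwrites c\<^sub>1 \<union> rwrites c\<^sub>2"
| "rwrites (While b c) = rwrites c"

text \<open>The frame condition of the proof rules, obtained from syntactic write sets. Naturals and
  reals are tracked separately because a name denotes one array of each kind.\<close>

definition agrees :: "string set \<Rightarrow> string set \<Rightarrow> state \<Rightarrow> state \<Rightarrow> bool" where
  "agrees A B \<sigma> \<tau> \<longleftrightarrow> (\<forall>a. a \<notin> A \<longrightarrow> fst \<tau> a = fst \<sigma> a) \<and> (\<forall>a. a \<notin> B \<longrightarrow> snd \<tau> a = snd \<sigma> a)"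

lemma agreesD:
  assumes "agrees A B \<sigma> \<tau>"
  shows "a \<notin> A \<Longrightarrow> fst \<tau> a = fst \<sigma> a" "b \<notin> B \<Longrightarrow> snd \<tau> b = snd \<sigma> b"
  using assms by (auto simp: agrees_def)

lemma agrees_refl: "agrees A B \<sigma> \<sigma>"
  by (simp add: agrees_def)

lemma agrees_trans: "agrees A B \<sigma> \<tau> \<Longrightarrow> agrees A B \<tau> \<rho> \<Longrightarrow> agrees A B \<sigma> \<rho>"
  by (simp add: agrees_def)

lemma exec_agrees:
  assumes "exec c \<sigma> T \<tau>"
  shows "agrees (nwrites c) (rwrites c) \<sigma> \<tau>"
  using assms by (induction rule: exec.induct) (auto simp: agrees_def store_def)

section \<open>Loop-free programs, executed symbolically\<close>

primrec loop_free :: "com \<Rightarrow> bool" where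
  "loop_free Skip \<longleftrightarrow> True"
| "loop_free (NAssign a j e) \<longleftrightarrow> True"
| "loop_free (RAssign a j e) \<longleftrightarrow> True"
| "loop_free (Seq c\<^sub>1 c\<^sub>2) \<longleftrightarrow> loop_free c\<^sub>1 \<and> loop_free c\<^sub>2"
| "loop_free (If b c\<^sub>1 c\<^sub>2) \<longleftrightarrow> loop_free c\<^sub>1 \<and> loop_free c\<^sub>2"
| "loop_free (While b c) \<longleftrightarrow> False"

text \<open>A function in place of the relation \<open>exec\<close> lets the simplifier run
  straight-line code. The value at \<open>While\<close> is a placeholder that
  \<open>loop_free\<close> excludes.\<close>

primrec sem :: "com \<Rightarrow> state \<Rightarrow> state" where
  "sem Skip \<sigma> = \<sigma>"
| "sem (NAssign a j e) \<sigma> = (store (fst \<sigma>) a (nval j \<sigma>) (nval e \<sigma>), snd \<sigma>)"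
| "sem (RAssign a j e) \<sigma> = (fst \<sigma>, store (snd \<sigma>) a (nval j \<sigma>) (rval e \<sigma>))"
| "sem (Seq c\<^sub>1 c\<^sub>2) \<sigma> = sem c\<^sub>2 (sem c\<^sub>1 \<sigma>)"
| "sem (If b c\<^sub>1 c\<^sub>2) \<sigma> = (if bval b \<sigma> then sem c\<^sub>1 \<sigma> else sem c\<^sub>2 \<sigma>)"
| "sem (While b c) \<sigma> = undefined"

primrec cost :: "com \<Rightarrow> nat" where
  "cost Skip = 1"
| "cost (NAssign a j e) = 1"
| "cost (RAssign a j e) = 1"
| "cost (Seq c\<^sub>1 c\<^sub>2) = cost c\<^sub>1 + cost c\<^sub>2"
| "cost (If b c\<^sub>1 c\<^sub>2) = 1 + cost c\<^sub>1 + cost c\<^sub>2"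
| "cost (While b c) = 0"

lemma exec_loop_free: "loop_free c \<Longrightarrow> \<exists>T. exec c \<sigma> T (sem c \<sigma>) \<and> T \<le> cost c"
proof (induction c arbitrary: \<sigma>)
  case (Seq c1 c2)
  then obtain T1 T2 where "exec c1 \<sigma> T1 (sem c1 \<sigma>)" "T1 \<le> cost c1"
    "exec c2 (sem c1 \<sigma>) T2 (sem c2 (sem c1 \<sigma>))" "T2 \<le> cost c2"
    by (metis loop_free.simps(4))
  then show ?case by (intro exI[of _ "T1 + T2"]) (auto intro: exec.Seq)
next
  case (If b c1 c2)
  then obtain T1 T2 where "exec c1 \<sigma> T1 (sem c1 \<sigma>)" "T1 \<le> cost c1"
    "exec c2 \<sigma> T2 (sem c2 \<sigma>)" "T2 \<le> cost c2"
    by (metis loop_free.simps(5))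
  then show ?case
    by (intro exI[of _ "1 + (if bval b \<sigma> then T1 else T2)"])
      (auto intro: exec.IfTrue[of _ _ _ T1, simplified] exec.IfFalse[of _ _ _ T2, simplified])
qed (auto intro: exec.intros)

lemma runs_loop_free: "loop_free c \<Longrightarrow> cost c \<le> T \<Longrightarrow> Q (sem c \<sigma>) \<Longrightarrow> runs c \<sigma> T Q"
  unfolding runs_def using exec_loop_free[of c \<sigma>] by (meson order_trans)

section \<open>Proof rules with time bounds and frame conditions\<close>

lemma runs_mono:
  assumes "runs c \<sigma> T Q" "T \<le> T'" "\<And>\<tau>. Q \<tau> \<Longrightarrow> agrees (nwrites c) (rwrites c) \<sigma> \<tau> \<Longrightarrow> Q' \<tau>"
  shows "runs c \<sigma> T' Q'"
  using assms unfolding runs_def by (meson exec_agrees order_trans)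

lemma runs_Seq:
  assumes "runs c\<^sub>1 \<sigma> T\<^sub>1 Q\<^sub>1"
    and "\<And>\<tau>. Q\<^sub>1 \<tau> \<Longrightarrow> agrees (nwrites c\<^sub>1) (rwrites c\<^sub>1) \<sigma> \<tau> \<Longrightarrow> runs c\<^sub>2 \<tau> T\<^sub>2 Q"
    and "T\<^sub>1 + T\<^sub>2 \<le> T"
  shows "runs (Seq c\<^sub>1 c\<^sub>2) \<sigma> T Q"
proof -
  obtain U \<tau> where U: "exec c\<^sub>1 \<sigma> U \<tau>" "U \<le> T\<^sub>1" "Q\<^sub>1 \<tau>" using assms(1) by (auto simp: runs_def)
  obtain U' \<rho> where "exec c\<^sub>2 \<tau> U' \<rho>" "U' \<le> T\<^sub>2" "Q \<rho>"
    using assms(2)[OF U(3) exec_agrees[OF U(1)]] by (auto simp: runs_def)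
  then show ?thesis unfolding runs_def using U assms(3)
    by (intro exI[of _ "U + U'"] exI[of _ \<rho>]) (auto intro: exec.Seq)
qed

lemma runs_If:
  assumes "bval b \<sigma> \<Longrightarrow> runs c\<^sub>1 \<sigma> T Q" "\<not> bval b \<sigma> \<Longrightarrow> runs c\<^sub>2 \<sigma> T Q"
  shows "runs (If b c\<^sub>1 c\<^sub>2) \<sigma> (Suc T) Q"
proof (cases "bval b \<sigma>")
  case True
  then obtain U \<tau> where "exec c\<^sub>1 \<sigma> U \<tau>" "U \<le> T" "Q \<tau>" using assms(1) by (auto simp: runs_def)
  then show ?thesis using exec.IfTrue[OF True] unfolding runs_def by fastforce
next
  case False
  then obtain U \<tau> where "exec c\<^sub>2 \<sigma> U \<tau>" "U \<le> T" "Q \<tau>" using assms(2) by (auto simp: runs_def)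
  then show ?thesis using exec.IfFalse[OF False] unfolding runs_def by fastforce
qed

text \<open>Termination and running time come from the same measure: at most \<Phi> iterations, each
  of cost \<open>B\<close> plus one test, and a last test. The \<open>agrees\<close> premises refer
  to the state on entry of the loop, so \<open>I\<close> need not mention arrays that the loop
  leaves alone.\<close>

lemma runs_While:
  assumes "I \<sigma>"
    and step: "\<And>\<tau>. I \<tau> \<Longrightarrow> agrees (nwrites c) (rwrites c) \<sigma> \<tau> \<Longrightarrow> bval b \<tau> \<Longrightarrow>
      runs c \<tau> B (\<lambda>\<tau>'. I \<tau>' \<and> \<Phi> \<tau>' < \<Phi> \<tau>)"
    and exit: "\<And>\<tau>. I \<tau> \<Longrightarrow> agrees (nwrites c) (rwrites c) \<sigma> \<tau> \<Longrightarrow> \<not> bval b \<tau> \<Longrightarrow> Q \<tau>"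
    and T: "\<Phi> \<sigma> * (B + 1) + 1 \<le> T"
  shows "runs (While b c) \<sigma> T Q"
proof -
  have "\<exists>T' \<sigma>'. exec (While b c) \<tau> T' \<sigma>' \<and> T' \<le> (\<Phi> \<tau> :: nat) * (B + 1) + 1 \<and> Q \<sigma>'"
    if "I \<tau>" "agrees (nwrites c) (rwrites c) \<sigma> \<tau>" for \<tau>
    using that
  proof (induction "\<Phi> \<tau>" arbitrary: \<tau> rule: less_induct)
    case less
    show ?case
    proof (cases "bval b \<tau>")
      case False
      then show ?thesis using exit less.prems exec.WhileFalse[OF False] by fastforce
    next
      case True
      obtain U \<rho> where U: "exec c \<tau> U \<rho>" "U \<le> B" "I \<rho>" "\<Phi> \<rho> < \<Phi> \<tau>"
        using step[OF less.prems True] by (auto simp: runs_def)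
      obtain U' \<rho>' where U': "exec (While b c) \<rho> U' \<rho>'" "U' \<le> \<Phi> \<rho> * (B + 1) + 1" "Q \<rho>'"
        using less.hyps[OF U(4,3) agrees_trans[OF less.prems(2) exec_agrees[OF U(1)]]] by blast
      have "Suc (\<Phi> \<rho>) * (B + 1) \<le> \<Phi> \<tau> * (B + 1)" using U(4) by (intro mult_right_mono) auto
      then have "1 + U + U' \<le> \<Phi> \<tau> * (B + 1) + 1" using U(2) U'(2) by simp
      then show ?thesis using exec.WhileTrue[OF True U(1) U'(1)] U'(3) by blast
    qed
  qed
  from this[OF assms(1) agrees_refl] show ?thesis
    unfolding runs_def using T by (meson order_trans)
qed

section \<open>The program\<close>

abbreviation nvar :: "string \<Rightarrow> nexp" where "nvar a \<equiv> NCell a (N 0)"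
abbreviation rvar :: "string \<Rightarrow> rexp" where "rvar a \<equiv> RCell a (N 0)"
abbreviation nset :: "string \<Rightarrow> nexp \<Rightarrow> com" where "nset a \<equiv> NAssign a (N 0)"
abbreviation rset :: "string \<Rightarrow> rexp \<Rightarrow> com" where "rset a \<equiv> RAssign a (N 0)"
abbreviation incr :: "string \<Rightarrow> com" where "incr a \<equiv> nset a (NPlus (nvar a) (N 1))"
notation Seq (infixr ";;" 60)

text \<open>
  Cell \<open>j * n + v\<close> of the array \<open>D\<close> holds the least weight of a walk of exactly \<open>j\<close> arcs from \<open>v\<close> to
  the sink, the weight \<open>y i\<close> of the demand included, or the threshold \<open>theta\<close> if this is smaller; the variable \<open>row\<close> holds the product \<open>j * n\<close>.
  Only cells of end vertices of arcs and of the source are reset, as \<open>n\<close> may exceed the time bound.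
\<close>

definition reset_body :: com where
  "reset_body =
    RAssign ''D'' (NPlus (nvar ''row'') (NCell ''tail'' (nvar ''e''))) (rvar ''theta'') ;;
    RAssign ''D'' (NPlus (nvar ''row'') (NCell ''head'' (nvar ''e''))) (rvar ''theta'') ;;
    incr ''e''"

definition reset_row :: com where
  "reset_row =
    (RAssign ''D'' (NPlus (nvar ''row'') (NCell ''s'' (nvar ''i''))) (rvar ''theta'') ;;
     nset ''e'' (N 0)) ;;
    While (NLess (nvar ''e'') (nvar ''m'')) reset_body"

text \<open>Arcs of capacity zero are skipped, so that only usable columns are found. An entry that
  is never improved stays at the threshold, and its cell of \<open>par\<close> may hold a stale
  value; tracing only visits entries below the threshold.\<close>

definition relax_body :: com where
  "relax_body =
    If (Conj (RLess (OfNat (N 0)) (RCell ''u'' (nvar ''e'')))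
          (RLess (RPlus (RCell ''l'' (nvar ''e''))
                    (RCell ''D'' (NPlus (nvar ''prev'') (NCell ''head'' (nvar ''e'')))))
             (RCell ''D'' (NPlus (nvar ''row'') (NCell ''tail'' (nvar ''e''))))))
      (RAssign ''D'' (NPlus (nvar ''row'') (NCell ''tail'' (nvar ''e'')))
         (RPlus (RCell ''l'' (nvar ''e''))
            (RCell ''D'' (NPlus (nvar ''prev'') (NCell ''head'' (nvar ''e''))))) ;;
       NAssign ''par'' (NPlus (nvar ''row'') (NCell ''tail'' (nvar ''e''))) (nvar ''e''))
      Skip ;;
    incr ''e''"

definition relax_row :: com where
  "relax_row = nset ''e'' (N 0) ;; While (NLess (nvar ''e'') (nvar ''m'')) relax_body"

abbreviation found :: bexp where
  "found \<equiv> RLess (RCell ''D'' (NPlus (nvar ''row'') (NCell ''s'' (nvar ''i'')))) (rvar ''theta'')"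

text \<open>Naturals cannot be multiplied on this machine, so the address of the row is maintained
  by adding \<open>n\<close>. Tracing goes back by subtracting it.\<close>

definition search_body :: com where
  "search_body =
    (nset ''prev'' (nvar ''row'') ;; nset ''row'' (NPlus (nvar ''row'') (nvar ''n'')) ;;
     incr ''j'') ;;
    reset_row ;;
    relax_row"

definition search :: com where
  "search =
    (nset ''row'' (N 0) ;; nset ''j'' (N 0)) ;;
    reset_row ;;
    RAssign ''D'' (NPlus (nvar ''row'') (NCell ''t'' (nvar ''i''))) (RCell ''y'' (nvar ''i'')) ;;
    While (Conj (NLess (nvar ''j'') (nvar ''L'')) (Neg found)) search_body"

definition trace_body :: com where
  "trace_body =
    nset ''e'' (NCell ''par'' (NPlus (nvar ''row'') (nvar ''v''))) ;;
    NAssign ''path'' (nvar ''p'') (nvar ''e'') ;;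
    incr ''p'' ;;
    nset ''v'' (NCell ''head'' (nvar ''e'')) ;;
    nset ''row'' (NMinus (nvar ''row'') (nvar ''n'')) ;;
    nset ''j'' (NMinus (nvar ''j'') (N 1)) ;;
    If (RLess (RCell ''u'' (nvar ''e'')) (rvar ''c'')) (rset ''c'' (RCell ''u'' (nvar ''e''))) Skip"

definition trace_path :: com where
  "trace_path =
    (nset ''p'' (NCell ''start'' (nvar ''count'')) ;;
     nset ''v'' (NCell ''s'' (nvar ''i'')) ;;
     rset ''c'' (RCell ''d'' (nvar ''i''))) ;;
    While (NLess (N 0) (nvar ''j'')) trace_body"

abbreviation growth :: "rexp \<Rightarrow> rexp" where
  "growth b \<equiv> RPlus (OfNat (N 1)) (RDiv (RTimes (rvar ''eps'') (rvar ''c'')) b)"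

definition reweight_body :: com where
  "reweight_body =
    nset ''e'' (NCell ''path'' (nvar ''j'')) ;;
    RAssign ''l'' (nvar ''e'')
      (RTimes (RCell ''l'' (nvar ''e'')) (growth (RCell ''u'' (nvar ''e'')))) ;;
    incr ''j''"

definition reweight :: com where
  "reweight =
    nset ''j'' (NCell ''start'' (nvar ''count'')) ;;
    While (NLess (nvar ''j'') (nvar ''p'')) reweight_body"

text \<open>The flow is written already divided by \<open>M + 1\<close>, so the output is complete
  as soon as the main loop stops. The first path starts at 0 because cells without input are
  0.\<close>

definition emit :: com where
  "emit =
    RAssign ''y'' (nvar ''i'')
      (RTimes (RCell ''y'' (nvar ''i'')) (growth (RCell ''d'' (nvar ''i'')))) ;;
    NAssign ''com'' (nvar ''count'') (nvar ''i'') ;;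
    RAssign ''flow'' (nvar ''count'') (RDiv (rvar ''c'') (RPlus (rvar ''M'') (OfNat (N 1)))) ;;
    incr ''count'' ;;
    NAssign ''start'' (nvar ''count'') (nvar ''p'')"

definition augment_path :: com where
  "augment_path = trace_path ;; reweight ;; emit"

text \<open>Phases, commodities and augmentations share one loop, so that a single measure bounds
  the number of searches. After a success the same commodity is searched again; only a failure moves
  on to the next.\<close>

definition main_body :: com where
  "main_body =
    If (NLess (nvar ''i'') (nvar ''k''))
      (search ;; If found augment_path (incr ''i''))
      (nset ''i'' (N 0) ;;
       rset ''r'' (RPlus (rvar ''r'') (OfNat (N 1))) ;;
       rset ''theta'' (RTimes (rvar ''theta'') (RPlus (OfNat (N 1)) (rvar ''eps''))))"

text \<open>Counting stands in for rounding \<open>4 / \<omega>\<close> up. It costs a number of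
  steps linear in \<open>1 / \<omega>\<close>, well within the bound.\<close>

definition choose_q :: com where
  "choose_q =
    rset ''q'' (OfNat (N 1)) ;;
    While (RLess (RTimes (rvar ''q'') (rvar ''omega'')) (OfNat (N 4)))
      (rset ''q'' (RPlus (rvar ''q'') (OfNat (N 1))))"

text \<open>Since \<open>L\<close> is at least 1, \<open>lg\<close> becomes the binary logarithm of
  \<open>L + 1\<close> rounded up. A path uses at most \<open>L + 1\<close> resources, its demand
  included.\<close>

definition choose_lg :: com where
  "choose_lg =
    (rset ''lg'' (OfNat (N 1)) ;; rset ''pw'' (OfNat (N 2))) ;;
    While (RLess (rvar ''pw'') (OfNat (NPlus (nvar ''L'') (N 1))))
      (rset ''lg'' (RPlus (rvar ''lg'') (OfNat (N 1))) ;; rset ''pw'' (RPlus (rvar ''pw'') (rvar ''pw'')))"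

definition fill_one :: "string \<Rightarrow> string \<Rightarrow> com" where
  "fill_one a b =
    nset ''e'' (N 0) ;;
    While (NLess (nvar ''e'') (nvar b)) (RAssign a (nvar ''e'') (OfNat (N 1)) ;; incr ''e'')"

definition set_parameters :: com where
  "set_parameters =
    rset ''eps'' (RDiv (OfNat (N 1)) (rvar ''q'')) ;;
    rset ''M'' (RTimes (RTimes (rvar ''q'') (rvar ''q'')) (rvar ''lg'')) ;;
    rset ''theta'' (RPlus (OfNat (N 1)) (rvar ''eps''))"

definition solve :: com where
  "solve = choose_q ;; choose_lg ;; fill_one ''l'' ''m'' ;; fill_one ''y'' ''k'' ;; set_parameters ;;
    While (RLess (rvar ''r'') (rvar ''M'')) main_body"

lemmas program_defs = reset_body_def reset_row_def relax_body_def relax_row_def search_body_def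
  search_def trace_body_def trace_path_def reweight_body_def reweight_def emit_def augment_path_def
  main_body_def

lemma writes:
  "nwrites reset_body = {''e''}" "rwrites reset_body = {''D''}"
  "nwrites reset_row = {''e''}" "rwrites reset_row = {''D''}"
  "nwrites relax_body = {''e'', ''par''}" "rwrites relax_body = {''D''}"
  "nwrites relax_row = {''e'', ''par''}" "rwrites relax_row = {''D''}"
  "nwrites search_body = {''e'', ''par'', ''prev'', ''row'', ''j''}" "rwrites search_body = {''D''}"
  "nwrites search = {''e'', ''par'', ''prev'', ''row'', ''j''}" "rwrites search = {''D''}"
  "nwrites trace_body = {''e'', ''path'', ''p'', ''v'', ''row'', ''j''}" "rwrites trace_body = {''c''}"
  "nwrites trace_path = {''e'', ''path'', ''p'', ''v'', ''row'', ''j''}" "rwrites trace_path = {''c''}"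
  "nwrites reweight_body = {''e'', ''j''}" "rwrites reweight_body = {''l''}"
  "nwrites reweight = {''e'', ''j''}" "rwrites reweight = {''l''}"
  "nwrites emit = {''com'', ''count'', ''start''}" "rwrites emit = {''y'', ''flow''}"
  "nwrites augment_path = {''e'', ''path'', ''p'', ''v'', ''row'', ''j'', ''com'', ''count'', ''start''}"
  "rwrites augment_path = {''c'', ''l'', ''y'', ''flow''}"
  "nwrites main_body = {''e'', ''par'', ''prev'', ''row'', ''j'', ''path'', ''p'', ''v'', ''com'', ''count'', ''start'', ''i''}"
  "rwrites main_body = {''D'', ''c'', ''l'', ''y'', ''flow'', ''r'', ''theta''}"
  unfolding program_defs by auto

section \<open>Search for a light path\<close>

locale numbered_lbmcf1 = lbmcf1 G u k s t d L
  for G :: "(nat, nat) pre_digraph" (structure) and u k s t d L +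
  fixes n m :: nat and \<omega> :: real
  assumes verts_eq: "verts G = {..<n}" and arcs_eq: "arcs G = {..<m}"
begin

definition holds_input :: "state \<Rightarrow> bool" where
  "holds_input \<sigma> \<longleftrightarrow>
    fst \<sigma> ''n'' 0 = n \<and> fst \<sigma> ''m'' 0 = m \<and> fst \<sigma> ''k'' 0 = k \<and> fst \<sigma> ''L'' 0 = L \<and>
    (\<forall>e<m. fst \<sigma> ''tail'' e = tail G e \<and> fst \<sigma> ''head'' e = head G e \<and> snd \<sigma> ''u'' e = u e) \<and>
    (\<forall>i<k. fst \<sigma> ''s'' i = s i \<and> fst \<sigma> ''t'' i = t i \<and> snd \<sigma> ''d'' i = d i) \<and>
    snd \<sigma> ''omega'' 0 = \<omega>"

lemma holds_inputD:
  assumes "holds_input \<sigma>"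
  shows "fst \<sigma> ''n'' 0 = n" "fst \<sigma> ''m'' 0 = m" "fst \<sigma> ''k'' 0 = k" "fst \<sigma> ''L'' 0 = L"
    "e < m \<Longrightarrow> fst \<sigma> ''tail'' e = tail G e" "e < m \<Longrightarrow> fst \<sigma> ''head'' e = head G e"
    "e < m \<Longrightarrow> snd \<sigma> ''u'' e = u e"
    "i < k \<Longrightarrow> fst \<sigma> ''s'' i = s i" "i < k \<Longrightarrow> fst \<sigma> ''t'' i = t i" "i < k \<Longrightarrow> snd \<sigma> ''d'' i = d i"
    "snd \<sigma> ''omega'' 0 = \<omega>"
  using assms by (simp_all add: holds_input_def)

lemma holds_input_agrees:
  assumes "holds_input \<sigma>" "agrees A B \<sigma> \<tau>"
    and "A \<inter> {''n'', ''m'', ''k'', ''L'', ''tail'', ''head'', ''s'', ''t''} = {}"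
    and "B \<inter> {''u'', ''d'', ''omega''} = {}"
  shows "holds_input \<tau>"
proof -
  have "fst \<tau> a = fst \<sigma> a" if "a \<in> {''n'', ''m'', ''k'', ''L'', ''tail'', ''head'', ''s'', ''t''}" for a
    using that assms(2,3) by (auto simp: agrees_def)
  moreover have "snd \<tau> a = snd \<sigma> a" if "a \<in> {''u'', ''d'', ''omega''}" for a
    using that assms(2,4) by (auto simp: agrees_def)
  ultimately show ?thesis using assms(1) by (simp add: holds_input_def)
qed

lemma tail_less: "e < m \<Longrightarrow> tail G e < n" and head_less: "e < m \<Longrightarrow> head G e < n"
  using tail_in_verts[of e] head_in_verts[of e] by (simp_all add: verts_eq arcs_eq)

text \<open>The vertices at which a search reads the table. The set contains the heads of all arcs,
  so the recursion stays inside, and it has at most \<open>2 * m + 1\<close> elements however large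
  \<open>n\<close> is.\<close>

definition touched :: "nat \<Rightarrow> nat set" where
  "touched i = insert (s i) (tail G ` {..<m} \<union> head G ` {..<m})"

lemma touched_less: "i < k \<Longrightarrow> v \<in> touched i \<Longrightarrow> v < n"
  using source_in_verts[of i] by (auto simp: touched_def verts_eq tail_less head_less)

section \<open>Filling one row of the table\<close>

lemma runs_reset_row:
  assumes "holds_input \<sigma>" "fst \<sigma> ''i'' 0 = i" "i < k"
    and row: "fst \<sigma> ''row'' 0 = row" and \<theta>: "snd \<sigma> ''theta'' 0 = \<theta>"
  shows "runs reset_row \<sigma> (4 * m + 3)
    (\<lambda>\<tau>. (\<forall>v\<in>touched i. snd \<tau> ''D'' (row + v) = \<theta>) \<and> (\<forall>x<row. snd \<tau> ''D'' x = snd \<sigma> ''D'' x))"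
  unfolding reset_row_def
proof (rule runs_Seq)
  show "runs (RAssign ''D'' (NPlus (nvar ''row'') (NCell ''s'' (nvar ''i''))) (rvar ''theta'') ;;
     nset ''e'' (N 0)) \<sigma> 2 (\<lambda>\<tau>. fst \<tau> ''e'' 0 = 0 \<and> snd \<tau> ''D'' (row + s i) = \<theta> \<and>
       (\<forall>x<row. snd \<tau> ''D'' x = snd \<sigma> ''D'' x))" (is "runs ?c _ _ _")
    by (rule runs_loop_free) (use assms in \<open>auto simp: store_def holds_inputD\<close>)
  fix \<tau>1
  assume 1: "fst \<tau>1 ''e'' 0 = 0 \<and> snd \<tau>1 ''D'' (row + s i) = \<theta> \<and> (\<forall>x<row. snd \<tau>1 ''D'' x = snd \<sigma> ''D'' x)"
    and "agrees (nwrites ?c) (rwrites ?c) \<sigma> \<tau>1"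
  then have a1: "agrees {''e''} {''D''} \<sigma> \<tau>1" by simp
  let ?I = "\<lambda>\<tau>. fst \<tau> ''e'' 0 \<le> m \<and> snd \<tau> ''D'' (row + s i) = \<theta> \<and>
    (\<forall>e<fst \<tau> ''e'' 0. snd \<tau> ''D'' (row + tail G e) = \<theta> \<and> snd \<tau> ''D'' (row + head G e) = \<theta>) \<and>
    (\<forall>x<row. snd \<tau> ''D'' x = snd \<sigma> ''D'' x)"
  let ?Q = "\<lambda>\<tau>. (\<forall>v\<in>touched i. snd \<tau> ''D'' (row + v) = \<theta>) \<and> (\<forall>x<row. snd \<tau> ''D'' x = snd \<sigma> ''D'' x)"
  show "runs (While (NLess (nvar ''e'') (nvar ''m'')) reset_body) \<tau>1 (4 * m + 1) ?Q"
  proof (rule runs_While[where I = ?I and \<Phi> = "\<lambda>\<tau>. m - fst \<tau> ''e'' 0" and B = 3])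
    show "?I \<tau>1" using 1 by simp
    fix \<tau> assume I: "?I \<tau>" and ag: "agrees (nwrites reset_body) (rwrites reset_body) \<tau>1 \<tau>"
    have a2: "agrees {''e''} {''D''} \<sigma> \<tau>" using agrees_trans[OF a1 ag[unfolded writes]] .
    note vals = holds_inputD[OF assms(1)] agreesD[OF a2] row \<theta>
    {
      assume b: "bval (NLess (nvar ''e'') (nvar ''m'')) \<tau>"
      show "runs reset_body \<tau> 3 (\<lambda>\<tau>'. ?I \<tau>' \<and> m - fst \<tau>' ''e'' 0 < m - fst \<tau> ''e'' 0)"
        by (rule runs_loop_free) (use b I in \<open>auto simp: reset_body_def store_def vals less_Suc_eq\<close>)
    next
      assume b: "\<not> bval (NLess (nvar ''e'') (nvar ''m'')) \<tau>"
      then have "fst \<tau> ''e'' 0 = m" using I by (simp add: vals)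
      then show "?Q \<tau>" using I by (auto simp: touched_def)
    }
  qed (use 1 in simp)
qed simp

text \<open>The two clauses per vertex make the new entry the minimum of \<theta> and all
  candidates, and name an arc attaining it. Heads are below \<open>n\<close>, so the entries that
  are read belong to the previous row and are not overwritten meanwhile.\<close>

lemma runs_relax_row:
  assumes "holds_input \<sigma>" "fst \<sigma> ''i'' 0 = i" "i < k"
    and row: "fst \<sigma> ''row'' 0 = prev + n" and prev: "fst \<sigma> ''prev'' 0 = prev"
    and D: "\<forall>v\<in>touched i. snd \<sigma> ''D'' (prev + n + v) = \<theta>"
  shows "runs relax_row \<sigma> (6 * m + 2)
    (\<lambda>\<tau>. (\<forall>x<prev + n. snd \<tau> ''D'' x = snd \<sigma> ''D'' x \<and> fst \<tau> ''par'' x = fst \<sigma> ''par'' x) \<and>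
      (\<forall>v\<in>touched i.
         (snd \<tau> ''D'' (prev + n + v) = \<theta> \<or>
          (let e = fst \<tau> ''par'' (prev + n + v) in e < m \<and> 0 < u e \<and> tail G e = v \<and>
            snd \<tau> ''D'' (prev + n + v) = snd \<sigma> ''l'' e + snd \<sigma> ''D'' (prev + head G e))) \<and>
         (\<forall>e<m. 0 < u e \<and> tail G e = v \<longrightarrow>
            snd \<tau> ''D'' (prev + n + v) \<le> snd \<sigma> ''l'' e + snd \<sigma> ''D'' (prev + head G e))))"
    (is "runs _ _ _ ?Q")
  unfolding relax_row_def
proof (rule runs_Seq)
  let ?I = "\<lambda>\<tau>. fst \<tau> ''e'' 0 \<le> m \<and>
    (\<forall>x<prev + n. snd \<tau> ''D'' x = snd \<sigma> ''D'' x \<and> fst \<tau> ''par'' x = fst \<sigma> ''par'' x) \<and>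
      (\<forall>v\<in>touched i.
         (snd \<tau> ''D'' (prev + n + v) = \<theta> \<or>
          (let e = fst \<tau> ''par'' (prev + n + v) in e < m \<and> 0 < u e \<and> tail G e = v \<and>
            snd \<tau> ''D'' (prev + n + v) = snd \<sigma> ''l'' e + snd \<sigma> ''D'' (prev + head G e))) \<and>
         (\<forall>e<fst \<tau> ''e'' 0. 0 < u e \<and> tail G e = v \<longrightarrow>
            snd \<tau> ''D'' (prev + n + v) \<le> snd \<sigma> ''l'' e + snd \<sigma> ''D'' (prev + head G e)))"
  show "runs (nset ''e'' (N 0)) \<sigma> 1 ?I" (is "runs ?c _ _ _")
    by (rule runs_loop_free) (use D in \<open>auto simp: store_def\<close>)
  fix \<tau>1
  assume 1: "?I \<tau>1" and "agrees (nwrites ?c) (rwrites ?c) \<sigma> \<tau>1"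
  then have a1: "agrees {''e'', ''par''} {''D''} \<sigma> \<tau>1" by (simp add: agrees_def)
  show "runs (While (NLess (nvar ''e'') (nvar ''m'')) relax_body) \<tau>1 (6 * m + 1) ?Q"
  proof (rule runs_While[where I = ?I and \<Phi> = "\<lambda>\<tau>. m - fst \<tau> ''e'' 0" and B = 5])
    show "?I \<tau>1" using 1 .
    fix \<tau> assume I: "?I \<tau>" and ag: "agrees (nwrites relax_body) (rwrites relax_body) \<tau>1 \<tau>"
    have a2: "agrees {''e'', ''par''} {''D''} \<sigma> \<tau>" using agrees_trans[OF a1 ag[unfolded writes]] .
    note vals = holds_inputD[OF assms(1)] agreesD[OF a2] row prev
    {
      assume b: "bval (NLess (nvar ''e'') (nvar ''m'')) \<tau>"
      define e where "e = fst \<tau> ''e'' 0"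
      have em: "e < m" using b by (simp add: vals e_def)
      have hd: "head G e < n" using em by (rule head_less)
      have Dh: "snd \<tau> ''D'' (prev + head G e) = snd \<sigma> ''D'' (prev + head G e)"
        using I hd by simp
      have tt: "tail G e \<in> touched i" using em by (auto simp: touched_def)
      let ?new = "snd \<sigma> ''l'' e + snd \<sigma> ''D'' (prev + head G e)"
      define upd where "upd \<longleftrightarrow> 0 < u e \<and> ?new < snd \<tau> ''D'' (prev + n + tail G e)"
      let ?\<tau>' = "sem relax_body \<tau>"
      have e': "fst ?\<tau>' ''e'' 0 = Suc e"
        by (auto simp: relax_body_def store_def e_def)
      have D': "snd ?\<tau>' ''D'' x = (if upd \<and> x = prev + n + tail G e then ?new else snd \<tau> ''D'' x)" for x
        using em Dh by (auto simp: relax_body_def store_def vals e_def[symmetric] upd_def)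
      have P': "fst ?\<tau>' ''par'' x = (if upd \<and> x = prev + n + tail G e then e else fst \<tau> ''par'' x)" for x
        using em Dh by (auto simp: relax_body_def store_def vals e_def[symmetric] upd_def)
      have I': "?I ?\<tau>'"
      proof (intro conjI allI impI ballI)
        show "fst ?\<tau>' ''e'' 0 \<le> m" using em e' by simp
        fix x assume x: "x < prev + n"
        then show "snd ?\<tau>' ''D'' x = snd \<sigma> ''D'' x" "fst ?\<tau>' ''par'' x = fst \<sigma> ''par'' x"
          using I by (simp_all add: D' P')
      next
        fix v assume v: "v \<in> touched i"
        show "snd ?\<tau>' ''D'' (prev + n + v) = \<theta> \<or>
          (let e = fst ?\<tau>' ''par'' (prev + n + v) in e < m \<and> 0 < u e \<and> tail G e = v \<and>
            snd ?\<tau>' ''D'' (prev + n + v) = snd \<sigma> ''l'' e + snd \<sigma> ''D'' (prev + head G e))"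
        proof (cases "upd \<and> v = tail G e")
          case True
          then show ?thesis using em by (simp add: D' P' upd_def)
        next
          case False
          then show ?thesis using I v by (auto simp: D' P')
        qed
        fix e' assume "e' < fst ?\<tau>' ''e'' 0" and ue: "0 < u e' \<and> tail G e' = v"
        then consider "e' < e" | "e' = e" using e' by linarith
        then show "snd ?\<tau>' ''D'' (prev + n + v) \<le> snd \<sigma> ''l'' e' + snd \<sigma> ''D'' (prev + head G e')"
        proof cases
          case 1
          then have "snd \<tau> ''D'' (prev + n + v) \<le> snd \<sigma> ''l'' e' + snd \<sigma> ''D'' (prev + head G e')"
            using I v ue by (simp add: e_def)
          then show ?thesis by (auto simp: D' upd_def)
        next
          case 2
          then show ?thesis using ue by (auto simp: D' upd_def)
        qed
      qed
      show "runs relax_body \<tau> 5 (\<lambda>\<tau>'. ?I \<tau>' \<and> m - fst \<tau>' ''e'' 0 < m - fst \<tau> ''e'' 0)"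
      proof (rule runs_loop_free)
        show "?I ?\<tau>' \<and> m - fst ?\<tau>' ''e'' 0 < m - fst \<tau> ''e'' 0"
          by (rule conjI[OF I']) (use e' em in \<open>simp add: e_def\<close>)
      qed (simp_all add: relax_body_def)
    next
      assume b: "\<not> bval (NLess (nvar ''e'') (nvar ''m'')) \<tau>"
      then have "fst \<tau> ''e'' 0 = m" using I by (simp add: vals)
      then show "?Q \<tau>" using I by simp
    }
  qed (use 1 in simp)
qed simp

text \<open>Correctness of row \<open>j\<close> in two halves of different shape. Soundness is
  local, leading by one arc into the previous row, because tracing follows it in this form; it is
  claimed only below the threshold. Completeness concerns all walks with exactly \<open>j\<close>
  arcs, since the recursion does not distinguish walks from paths.\<close>

definition level :: "state \<Rightarrow> nat \<Rightarrow> bool" where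
  "level \<sigma> j \<longleftrightarrow> (let i = fst \<sigma> ''i'' 0; \<theta> = snd \<sigma> ''theta'' 0; y = snd \<sigma> ''y'' i;
      l = snd \<sigma> ''l''; D = snd \<sigma> ''D''; par = fst \<sigma> ''par'' in
    \<forall>v\<in>touched i.
      (D (j * n + v) < \<theta> \<longrightarrow>
        (case j of 0 \<Rightarrow> v = t i \<and> D (j * n + v) = y
         | Suc j' \<Rightarrow> par (j * n + v) < m \<and> 0 < u (par (j * n + v)) \<and> tail G (par (j * n + v)) = v \<and>
             D (j * n + v) = l (par (j * n + v)) + D (j' * n + head G (par (j * n + v))))) \<and>
      (\<forall>P. awalk v P (t i) \<and> length P = j \<and> (\<forall>e\<in>set P. 0 < u e) \<longrightarrow>
        D (j * n + v) \<le> y + sum_list (map l P)))"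

lemma level_complete:
  assumes "level \<sigma> (length P)" "v \<in> touched (fst \<sigma> ''i'' 0)" "awalk v P (t (fst \<sigma> ''i'' 0))"
    and "\<forall>e\<in>set P. 0 < u e"
  shows "snd \<sigma> ''D'' (length P * n + v) \<le> snd \<sigma> ''y'' (fst \<sigma> ''i'' 0) + sum_list (map (snd \<sigma> ''l'') P)"
  using assms unfolding level_def Let_def by blast

text \<open>Row \<open>j\<close> and the row it refers to occupy cells below
  \<open>(j + 1) * n\<close>, so filling later rows does no harm.\<close>

lemma level_cong:
  assumes "level \<sigma> j" "fst \<sigma> ''i'' 0 < k" "agrees A B \<sigma> \<tau>"
    and "''i'' \<notin> A" "B \<inter> {''theta'', ''y'', ''l''} = {}"
    and same: "\<And>x. x < (j + 1) * n \<Longrightarrow> snd \<tau> ''D'' x = snd \<sigma> ''D'' x \<and> fst \<tau> ''par'' x = fst \<sigma> ''par'' x"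
  shows "level \<tau> j"
proof -
  have eq: "fst \<tau> ''i'' = fst \<sigma> ''i''" "snd \<tau> ''theta'' = snd \<sigma> ''theta''"
    "snd \<tau> ''y'' = snd \<sigma> ''y''" "snd \<tau> ''l'' = snd \<sigma> ''l''"
    using assms(3-5) by (auto simp: agrees_def)
  have D: "snd \<tau> ''D'' (j * n + v) = snd \<sigma> ''D'' (j * n + v)"
    "fst \<tau> ''par'' (j * n + v) = fst \<sigma> ''par'' (j * n + v)" if "v \<in> touched (fst \<sigma> ''i'' 0)" for v
    using same[of "j * n + v"] touched_less[OF assms(2) that] by simp_all
  have D': "snd \<tau> ''D'' (j' * n + head G e) = snd \<sigma> ''D'' (j' * n + head G e)"
    if "j = Suc j'" "e < m" for j' e
    using same[of "j' * n + head G e"] head_less[OF that(2)] that(1) by simp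
  show ?thesis
  proof (cases j)
    case 0
    then show ?thesis using assms(1) D unfolding level_def eq Let_def by simp
  next
    case (Suc j')
    then show ?thesis
      using assms(1) unfolding level_def eq Let_def
      by (simp add: D[unfolded Suc] D'[OF Suc] del: mult_Suc)
  qed
qed

text \<open>Soundness of the new row is the attaining arc of \<open>runs_relax_row\<close>. For
  completeness, the first arc is split off a walk and the previous row is used at its head. The
  older rows survive by \<open>level_cong\<close>.\<close>

lemma runs_search_body:
  assumes "holds_input \<sigma>" "fst \<sigma> ''i'' 0 < k" "fst \<sigma> ''row'' 0 = fst \<sigma> ''j'' 0 * n"
    and lev: "\<forall>j\<le>fst \<sigma> ''j'' 0. level \<sigma> j"
  shows "runs search_body \<sigma> (10 * m + 8)
    (\<lambda>\<tau>. fst \<tau> ''j'' 0 = Suc (fst \<sigma> ''j'' 0) \<and> fst \<tau> ''row'' 0 = fst \<tau> ''j'' 0 * n \<and>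
      (\<forall>j\<le>fst \<tau> ''j'' 0. level \<tau> j) \<and>
      (\<forall>x<fst \<tau> ''j'' 0 * n. snd \<tau> ''D'' x = snd \<sigma> ''D'' x))"
    (is "runs _ _ _ ?Q")
proof -
  define i where "i = fst \<sigma> ''i'' 0"
  define j where "j = fst \<sigma> ''j'' 0"
  define \<theta> where "\<theta> = snd \<sigma> ''theta'' 0"
  let ?c = "nset ''prev'' (nvar ''row'') ;; nset ''row'' (NPlus (nvar ''row'') (nvar ''n'')) ;; incr ''j''"
  let ?Q1 = "\<lambda>\<tau>. fst \<tau> ''prev'' 0 = j * n \<and> fst \<tau> ''row'' 0 = j * n + n \<and> fst \<tau> ''j'' 0 = Suc j"
  have c: "runs ?c \<sigma> 3 ?Q1"
    by (rule runs_loop_free) (use assms in \<open>auto simp: store_def holds_inputD j_def\<close>)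
  show ?thesis
    unfolding search_body_def
  proof (rule runs_Seq[OF c])
    fix \<tau>1 assume 1: "?Q1 \<tau>1" and ag1: "agrees (nwrites ?c) (rwrites ?c) \<sigma> \<tau>1"
    have a1: "agrees {''prev'', ''row'', ''j''} {} \<sigma> \<tau>1" using ag1 by (simp add: insert_commute)
    have hi1: "holds_input \<tau>1" using holds_input_agrees[OF assms(1) a1] by simp
    have i1: "fst \<tau>1 ''i'' 0 = i" using agreesD[OF a1] by (simp add: i_def)
    have th1: "snd \<tau>1 ''theta'' 0 = \<theta>" using agreesD[OF a1] by (simp add: \<theta>_def)
    have row1: "fst \<tau>1 ''row'' 0 = j * n + n" using 1 by simp
    have ik: "i < k" using assms(2) i_def by simp
    show "runs (reset_row ;; relax_row) \<tau>1 (10 * m + 5) ?Q"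
    proof (rule runs_Seq[OF runs_reset_row[OF hi1 i1 ik row1 th1]])
      fix \<tau>2
      assume 2: "(\<forall>v\<in>touched i. snd \<tau>2 ''D'' (j * n + n + v) = \<theta>) \<and>
          (\<forall>x<j * n + n. snd \<tau>2 ''D'' x = snd \<tau>1 ''D'' x)"
        and ag2: "agrees (nwrites reset_row) (rwrites reset_row) \<tau>1 \<tau>2"
      have a2: "agrees {''e''} {''D''} \<tau>1 \<tau>2" using ag2 by (simp add: writes)
      have hi2: "holds_input \<tau>2" using holds_input_agrees[OF hi1 a2] by simp
      have i2: "fst \<tau>2 ''i'' 0 = i" using agreesD[OF a2] i1 by simp
      have row2: "fst \<tau>2 ''row'' 0 = j * n + n" "fst \<tau>2 ''prev'' 0 = j * n"
        using agreesD[OF a2] 1 by simp_all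
      show "runs relax_row \<tau>2 (6 * m + 2) ?Q"
      proof (rule runs_mono[OF runs_relax_row[OF hi2 i2 ik row2 conjunct1[OF 2]] order_refl])
        let ?new = "\<lambda>e. snd \<tau>2 ''l'' e + snd \<tau>2 ''D'' (j * n + head G e)"
        fix \<tau> assume
          3: "(\<forall>x<j * n + n. snd \<tau> ''D'' x = snd \<tau>2 ''D'' x \<and> fst \<tau> ''par'' x = fst \<tau>2 ''par'' x) \<and>
            (\<forall>v\<in>touched i.
              (snd \<tau> ''D'' (j * n + n + v) = \<theta> \<or>
               (let e = fst \<tau> ''par'' (j * n + n + v) in e < m \<and> 0 < u e \<and> tail G e = v \<and>
                 snd \<tau> ''D'' (j * n + n + v) = ?new e)) \<and>
              (\<forall>e<m. 0 < u e \<and> tail G e = v \<longrightarrow> snd \<tau> ''D'' (j * n + n + v) \<le> ?new e))"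
          and ag3: "agrees (nwrites relax_row) (rwrites relax_row) \<tau>2 \<tau>"
        have a3: "agrees {''e'', ''par''} {''D''} \<tau>2 \<tau>" using ag3 by (simp add: writes)
        let ?A = "{''e'', ''par'', ''prev'', ''row'', ''j''}"
        have a: "agrees ?A {''D''} \<sigma> \<tau>"
          using a1 a2 a3 by (simp add: agrees_def)
        have par2: "fst \<tau>2 ''par'' = fst \<sigma> ''par''" using agreesD[OF a1] agreesD[OF a2] by simp
        have D2: "snd \<tau>2 ''D'' x = snd \<sigma> ''D'' x" if "x < j * n + n" for x
          using 2 that agreesD[OF a1] by simp
        have same: "snd \<tau> ''D'' x = snd \<sigma> ''D'' x" "fst \<tau> ''par'' x = fst \<sigma> ''par'' x" if "x < j * n + n" for x
          using 3 D2 that par2 by simp_all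
        have j3: "fst \<tau> ''j'' 0 = Suc j" "fst \<tau> ''row'' 0 = j * n + n"
          using agreesD[OF a3] agreesD[OF a2] 1 by simp_all
        have old: "level \<tau> j'" if "j' \<le> j" for j'
        proof (rule level_cong[OF _ _ a])
          show "level \<sigma> j'" using lev that j_def by simp
          fix x assume "x < (j' + 1) * n"
          also have "\<dots> \<le> (j + 1) * n" using that by (intro mult_right_mono) auto
          finally show "snd \<tau> ''D'' x = snd \<sigma> ''D'' x \<and> fst \<tau> ''par'' x = fst \<sigma> ''par'' x"
            using same by simp
        qed (use assms(2) in simp_all)
        have l: "snd \<tau>2 ''l'' = snd \<sigma> ''l''" using agreesD[OF a1] agreesD[OF a2] by simp
        have eqs: "fst \<tau> ''i'' 0 = i" "snd \<tau> ''theta'' 0 = \<theta>" "snd \<tau> ''l'' = snd \<sigma> ''l''"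
          using agreesD[OF a] by (simp_all add: i_def \<theta>_def)
        have Dh: "snd \<tau>2 ''D'' (j * n + head G e) = snd \<tau> ''D'' (j * n + head G e)" if "e < m" for e
          using 3 head_less[OF that] by simp
        have idx: "Suc j * n + v = j * n + n + v" for v by simp
        have new: "level \<tau> (Suc j)"
          unfolding level_def eqs Let_def idx nat.case
        proof (intro ballI conjI impI allI)
          fix v assume v: "v \<in> touched i"
          let ?e = "fst \<tau> ''par'' (j * n + n + v)"
          { assume "snd \<tau> ''D'' (j * n + n + v) < \<theta>"
            then have "?e < m \<and> 0 < u ?e \<and> tail G ?e = v \<and> snd \<tau> ''D'' (j * n + n + v) = ?new ?e"
              using 3 v by (auto simp: Let_def)
            then show "?e < m" "0 < u ?e" "tail G ?e = v"
              "snd \<tau> ''D'' (j * n + n + v) = snd \<sigma> ''l'' ?e + snd \<tau> ''D'' (j * n + head G ?e)"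
              by (auto simp: l Dh) }
          fix P assume P: "awalk v P (t i) \<and> length P = Suc j \<and> (\<forall>e\<in>set P. 0 < u e)"
          then obtain e P' where eP: "P = e # P'" "length P' = j" by (cases P) auto
          with P have e: "e < m" "0 < u e" "tail G e = v" "awalk (head G e) P' (t i)" "\<forall>e\<in>set P'. 0 < u e"
            by (auto simp: awalk_Cons_iff arcs_eq)
          have "snd \<tau> ''D'' (j * n + n + v) \<le> snd \<sigma> ''l'' e + snd \<tau> ''D'' (j * n + head G e)"
            using 3 v e by (auto simp: l Dh)
          also have "snd \<tau> ''D'' (j * n + head G e) \<le> snd \<tau> ''y'' i + sum_list (map (snd \<sigma> ''l'') P')"
            using old[of j] e eP(2) by (auto simp: level_def Let_def eqs touched_def)
          finally show "snd \<tau> ''D'' (j * n + n + v) \<le> snd \<tau> ''y'' i + sum_list (map (snd \<sigma> ''l'') P)"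
            by (simp add: eP(1))
        qed
        show "?Q \<tau>" using j3 old new same by (auto simp: le_Suc_eq j_def)
      qed
    qed simp
  qed simp
qed

text \<open>Two facts about stopping are recorded for later. No earlier row had the source below the
  threshold, which will make the traced walk simple; and a search without success has filled all
  rows up to \<open>L\<close>, which makes the failure conclusive.\<close>

lemma runs_search:
  assumes "holds_input \<sigma>" "fst \<sigma> ''i'' 0 < k"
  shows "runs search \<sigma> (L * (10 * m + 9) + 4 * m + 7)
    (\<lambda>\<tau>. fst \<tau> ''row'' 0 = fst \<tau> ''j'' 0 * n \<and> fst \<tau> ''j'' 0 \<le> L \<and> (\<forall>j\<le>fst \<tau> ''j'' 0. level \<tau> j) \<and>
      (\<forall>j<fst \<tau> ''j'' 0. snd \<tau> ''theta'' 0 \<le> snd \<tau> ''D'' (j * n + s (fst \<sigma> ''i'' 0))) \<and>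
      (fst \<tau> ''j'' 0 = L \<or> bval found \<tau>))"
  unfolding search_def
proof (rule runs_Seq)
  define i where "i = fst \<sigma> ''i'' 0"
  define \<theta> where "\<theta> = snd \<sigma> ''theta'' 0"
  have ik: "i < k" using assms i_def by simp
  let ?c = "nset ''row'' (N 0) ;; nset ''j'' (N 0)"
  let ?W = "While (Conj (NLess (nvar ''j'') (nvar ''L'')) (Neg found)) search_body"
  let ?Q1 = "\<lambda>\<tau>. fst \<tau> ''row'' 0 = 0 \<and> fst \<tau> ''j'' 0 = 0"
  let ?Q = "\<lambda>\<tau>. fst \<tau> ''row'' 0 = fst \<tau> ''j'' 0 * n \<and> fst \<tau> ''j'' 0 \<le> L \<and> (\<forall>j\<le>fst \<tau> ''j'' 0. level \<tau> j) \<and>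
      (\<forall>j<fst \<tau> ''j'' 0. snd \<tau> ''theta'' 0 \<le> snd \<tau> ''D'' (j * n + s (fst \<sigma> ''i'' 0))) \<and>
      (fst \<tau> ''j'' 0 = L \<or> bval found \<tau>)"
  show "runs ?c \<sigma> 2 ?Q1"
    by (rule runs_loop_free) (simp_all add: store_def)
  fix \<tau>1 assume 1: "?Q1 \<tau>1" and ag1: "agrees (nwrites ?c) (rwrites ?c) \<sigma> \<tau>1"
  have a1: "agrees {''row'', ''j''} {} \<sigma> \<tau>1" using ag1 by (simp add: insert_commute)
  have hi1: "holds_input \<tau>1" using holds_input_agrees[OF assms(1) a1] by simp
  have i1: "fst \<tau>1 ''i'' 0 = i" "snd \<tau>1 ''theta'' 0 = \<theta>" using agreesD[OF a1] by (simp_all add: i_def \<theta>_def)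
  show "runs (reset_row ;; RAssign ''D'' (NPlus (nvar ''row'') (NCell ''t'' (nvar ''i''))) (RCell ''y'' (nvar ''i'')) ;; ?W)
    \<tau>1 (L * (10 * m + 9) + 4 * m + 5) ?Q"
  proof (rule runs_Seq[OF runs_reset_row[OF hi1 i1(1) ik conjunct1[OF 1] i1(2)]])
    fix \<tau>2
    assume 2: "(\<forall>v\<in>touched i. snd \<tau>2 ''D'' (0 + v) = \<theta>) \<and> (\<forall>x<0. snd \<tau>2 ''D'' x = snd \<tau>1 ''D'' x)"
      and ag2: "agrees (nwrites reset_row) (rwrites reset_row) \<tau>1 \<tau>2"
    have a2: "agrees {''e'', ''row'', ''j''} {''D''} \<sigma> \<tau>2" using ag2 a1 by (simp add: writes agrees_def)
    let ?d = "RAssign ''D'' (NPlus (nvar ''row'') (NCell ''t'' (nvar ''i''))) (RCell ''y'' (nvar ''i''))"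
    let ?Q2 = "\<lambda>\<tau>. (\<forall>v\<in>touched i. snd \<tau> ''D'' v = (if v = t i then snd \<sigma> ''y'' i else \<theta>))"
    have row2: "fst \<tau>2 ''row'' 0 = 0" "fst \<tau>2 ''j'' 0 = 0" using ag2 1 by (simp_all add: writes agrees_def)
    have d: "runs ?d \<tau>2 1 ?Q2"
      by (rule runs_loop_free)
        (use 2 row2 ik holds_inputD[OF assms(1)] in \<open>auto simp: store_def agreesD[OF a2] i_def\<close>)
    show "runs (?d ;; ?W) \<tau>2 (L * (10 * m + 9) + 2) ?Q"
    proof (rule runs_Seq[OF d])
      fix \<tau>3 assume 3: "?Q2 \<tau>3" and ag3: "agrees (nwrites ?d) (rwrites ?d) \<tau>2 \<tau>3"
      have a3: "agrees {''e'', ''row'', ''j''} {''D''} \<sigma> \<tau>3" using ag3 a2 by (simp add: agrees_def)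
      have row3: "fst \<tau>3 ''row'' 0 = 0" "fst \<tau>3 ''j'' 0 = 0" using ag3 row2 by (simp_all add: agrees_def)
      have lev0: "level \<tau>3 0"
        using 3 agreesD[OF a3]
        by (auto simp: level_def Let_def i_def \<theta>_def awalk_Nil_iff)
      let ?I = "\<lambda>\<tau>. fst \<tau> ''row'' 0 = fst \<tau> ''j'' 0 * n \<and> fst \<tau> ''j'' 0 \<le> L \<and> (\<forall>j\<le>fst \<tau> ''j'' 0. level \<tau> j) \<and>
        (\<forall>j<fst \<tau> ''j'' 0. \<theta> \<le> snd \<tau> ''D'' (j * n + s i))"
      show "runs ?W \<tau>3 (L * (10 * m + 9) + 1) ?Q"
      proof (rule runs_While[where I = ?I and \<Phi> = "\<lambda>\<tau>. L - fst \<tau> ''j'' 0" and B = "10 * m + 8"])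
        show "?I \<tau>3" using row3 lev0 by simp
        fix \<tau> assume I: "?I \<tau>" and ag: "agrees (nwrites search_body) (rwrites search_body) \<tau>3 \<tau>"
        have a: "agrees {''e'', ''par'', ''prev'', ''row'', ''j''} {''D''} \<sigma> \<tau>"
          using ag a3 by (simp add: writes agrees_def)
        have hi: "holds_input \<tau>" using holds_input_agrees[OF assms(1) a] by simp
        have i: "fst \<tau> ''i'' 0 = i" "snd \<tau> ''theta'' 0 = \<theta>" using agreesD[OF a] by (simp_all add: i_def \<theta>_def)
        have si: "fst \<tau> ''s'' i = s i" using holds_inputD[OF hi] ik by simp
        {
          assume b: "bval (Conj (NLess (nvar ''j'') (nvar ''L'')) (Neg found)) \<tau>"
          then have b: "fst \<tau> ''j'' 0 < L" "\<theta> \<le> snd \<tau> ''D'' (fst \<tau> ''j'' 0 * n + s i)"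
            using holds_inputD[OF hi] i si I by simp_all
          show "runs search_body \<tau> (10 * m + 8) (\<lambda>\<tau>'. ?I \<tau>' \<and> L - fst \<tau>' ''j'' 0 < L - fst \<tau> ''j'' 0)"
          proof (rule runs_mono[OF runs_search_body[OF hi] order_refl])
            fix \<tau>'
            assume 4: "fst \<tau>' ''j'' 0 = Suc (fst \<tau> ''j'' 0) \<and> fst \<tau>' ''row'' 0 = fst \<tau>' ''j'' 0 * n \<and>
              (\<forall>j\<le>fst \<tau>' ''j'' 0. level \<tau>' j) \<and>
              (\<forall>x<fst \<tau>' ''j'' 0 * n. snd \<tau>' ''D'' x = snd \<tau> ''D'' x)"
            have "snd \<tau>' ''D'' (j * n + s i) = snd \<tau> ''D'' (j * n + s i)" if "j \<le> fst \<tau> ''j'' 0" for j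
            proof -
              have "j * n + s i < Suc j * n" using touched_less[OF ik] by (simp add: touched_def)
              also have "\<dots> \<le> fst \<tau>' ''j'' 0 * n" using 4 that by (intro mult_right_mono) auto
              finally show ?thesis using 4 by blast
            qed
            then show "?I \<tau>' \<and> L - fst \<tau>' ''j'' 0 < L - fst \<tau> ''j'' 0"
              using 4 b I by (auto simp: less_Suc_eq)
          qed (use i ik I in simp_all)
        next
          assume b: "\<not> bval (Conj (NLess (nvar ''j'') (nvar ''L'')) (Neg found)) \<tau>"
          then have "fst \<tau> ''j'' 0 = L \<or> bval found \<tau>" using I holds_inputD[OF hi] by auto
          then show "?Q \<tau>" using I i by (simp add: i_def)
        }
      qed (use row3 in simp)
    qed simp
  qed simp
qed simp

section \<open>Reading the path off the table\<close>

fun trace :: "(nat \<Rightarrow> nat) \<Rightarrow> nat \<Rightarrow> nat \<Rightarrow> nat list" where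
  "trace par 0 v = []"
| "trace par (Suc j) v = par (Suc j * n + v) # trace par j (head G (par (Suc j * n + v)))"

lemma length_trace [simp]: "length (trace par j v) = j"
  by (induction j arbitrary: v) auto

text \<open>Soundness in \<open>level\<close> is conditional on an entry below the threshold. As arc
  weights are nonnegative, entries do not increase along the trace, so the condition passes from
  each row to the one before.\<close>

lemma trace_walk:
  assumes i: "fst \<sigma> ''i'' 0 < k" and l: "\<And>e. e < m \<Longrightarrow> 0 \<le> snd \<sigma> ''l'' e"
    and "\<forall>j'\<le>j. level \<sigma> j'" "v \<in> touched (fst \<sigma> ''i'' 0)"
    and "snd \<sigma> ''D'' (j * n + v) < snd \<sigma> ''theta'' 0"
  shows "awalk v (trace (fst \<sigma> ''par'') j v) (t (fst \<sigma> ''i'' 0))"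
    and "\<forall>e\<in>set (trace (fst \<sigma> ''par'') j v). 0 < u e"
    and "snd \<sigma> ''y'' (fst \<sigma> ''i'' 0) + sum_list (map (snd \<sigma> ''l'') (trace (fst \<sigma> ''par'') j v))
      = snd \<sigma> ''D'' (j * n + v)"
proof -
  have "awalk v (trace (fst \<sigma> ''par'') j v) (t (fst \<sigma> ''i'' 0)) \<and>
    (\<forall>e\<in>set (trace (fst \<sigma> ''par'') j v). 0 < u e) \<and>
    snd \<sigma> ''y'' (fst \<sigma> ''i'' 0) + sum_list (map (snd \<sigma> ''l'') (trace (fst \<sigma> ''par'') j v))
      = snd \<sigma> ''D'' (j * n + v)"
    using assms(3-)
  proof (induction j arbitrary: v)
    case 0
    then show ?case using sink_in_verts[OF i] by (simp add: level_def Let_def awalk_Nil_iff)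
  next
    case (Suc j)
    let ?e = "fst \<sigma> ''par'' (Suc j * n + v)"
    have "level \<sigma> (Suc j)" using Suc.prems by simp
    then have e: "?e < m" "0 < u ?e" "tail G ?e = v"
      "snd \<sigma> ''D'' (Suc j * n + v) = snd \<sigma> ''l'' ?e + snd \<sigma> ''D'' (j * n + head G ?e)"
      unfolding level_def Let_def nat.case using Suc.prems(2,3) by blast+
    have "head G ?e \<in> touched (fst \<sigma> ''i'' 0)" using e(1) by (simp add: touched_def)
    moreover have "snd \<sigma> ''D'' (j * n + head G ?e) < snd \<sigma> ''theta'' 0"
      using Suc.prems(3) l[OF e(1)] unfolding e(4) by simp
    ultimately have "awalk (head G ?e) (trace (fst \<sigma> ''par'') j (head G ?e)) (t (fst \<sigma> ''i'' 0)) \<and>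
      (\<forall>e\<in>set (trace (fst \<sigma> ''par'') j (head G ?e)). 0 < u e) \<and>
      snd \<sigma> ''y'' (fst \<sigma> ''i'' 0) + sum_list (map (snd \<sigma> ''l'') (trace (fst \<sigma> ''par'') j (head G ?e)))
        = snd \<sigma> ''D'' (j * n + head G ?e)"
      using Suc.IH Suc.prems(1) by simp
    then show ?case using e by (simp add: awalk_Cons_iff arcs_eq del: mult_Suc)
  qed
  then show "awalk v (trace (fst \<sigma> ''par'') j v) (t (fst \<sigma> ''i'' 0))"
    and "\<forall>e\<in>set (trace (fst \<sigma> ''par'') j v). 0 < u e"
    and "snd \<sigma> ''y'' (fst \<sigma> ''i'' 0) + sum_list (map (snd \<sigma> ''l'') (trace (fst \<sigma> ''par'') j v))
      = snd \<sigma> ''D'' (j * n + v)" by auto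
qed

text \<open>
  The search stops at the least number of arcs that allows for a walk below the threshold.
  Cutting a cycle out of this walk would yield one with fewer arcs, so it is a path.
\<close>

lemma trace_apath:
  assumes i: "fst \<sigma> ''i'' 0 < k" and l: "\<And>e. e < m \<Longrightarrow> 0 \<le> snd \<sigma> ''l'' e"
    and lev: "\<forall>j'\<le>j. level \<sigma> j'"
    and least: "\<forall>j'<j. snd \<sigma> ''theta'' 0 \<le> snd \<sigma> ''D'' (j' * n + s (fst \<sigma> ''i'' 0))"
    and below: "snd \<sigma> ''D'' (j * n + s (fst \<sigma> ''i'' 0)) < snd \<sigma> ''theta'' 0"
  shows "apath (s (fst \<sigma> ''i'' 0)) (trace (fst \<sigma> ''par'') j (s (fst \<sigma> ''i'' 0))) (t (fst \<sigma> ''i'' 0))"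
proof -
  let ?s = "s (fst \<sigma> ''i'' 0)" and ?t = "t (fst \<sigma> ''i'' 0)" and ?y = "snd \<sigma> ''y'' (fst \<sigma> ''i'' 0)"
  let ?P = "trace (fst \<sigma> ''par'') j ?s" and ?l = "\<lambda>P. sum_list (map (snd \<sigma> ''l'') P)"
  have s: "?s \<in> touched (fst \<sigma> ''i'' 0)" by (simp add: touched_def)
  note P = trace_walk[OF i l lev s below]
  have "distinct (awalk_verts ?s ?P)"
  proof (rule ccontr)
    assume "\<not> distinct (awalk_verts ?s ?P)"
    from awalk_not_distinct_decomp[OF P(1) this] obtain q r w x where
      qrw: "?P = q @ r @ w" "0 < length r" "awalk ?s q x" "awalk x r x" "awalk x w ?t" by blast
    have "length (q @ r @ w) = j"
      using length_trace[of "fst \<sigma> ''par''" j ?s] unfolding qrw(1) .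
    then have lt: "length (q @ w) < j" using qrw(2) unfolding length_append by linarith
    then have "level \<sigma> (length (q @ w))" using lev by simp
    moreover have "\<forall>e\<in>set (q @ w). 0 < u e" using P(2) unfolding qrw(1) by auto
    ultimately have "snd \<sigma> ''D'' (length (q @ w) * n + ?s) \<le> ?y + ?l (q @ w)"
      using level_complete s awalk_appendI[OF qrw(3,5)] by blast
    also have "\<dots> \<le> ?y + ?l ?P"
    proof -
      have "set r \<subseteq> {..<m}" using qrw(4) by (auto simp: awalk_def arcs_eq)
      then have "0 \<le> ?l r" using l by (intro sum_list_nonneg) auto
      then show ?thesis unfolding qrw(1) by simp
    qed
    also have "\<dots> < snd \<sigma> ''theta'' 0" using P(3) below by simp
    finally show False using least lt by (meson not_le)
  qed
  then show ?thesis using P(1) by (simp add: apath_def)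
qed

text \<open>A failed search certifies a lower bound: the row numbered \<open>length P\<close> is
  complete for \<open>P\<close>, and its entry at the source did not drop below the
  threshold.\<close>

lemma search_complete:
  assumes i: "fst \<sigma> ''i'' 0 = i"
    and lev: "\<forall>j\<le>L. level \<sigma> j"
    and least: "\<forall>j\<le>L. snd \<sigma> ''theta'' 0 \<le> snd \<sigma> ''D'' (j * n + s i)"
    and P: "P \<in> paths i" "\<forall>e\<in>set P. 0 < u e"
  shows "snd \<sigma> ''theta'' 0 \<le> snd \<sigma> ''y'' i + sum_list (map (snd \<sigma> ''l'') P)"
proof -
  have len: "length P \<le> L" and w: "awalk (s i) P (t i)" using P(1) by (auto simp: paths_def apath_def)
  have "snd \<sigma> ''theta'' 0 \<le> snd \<sigma> ''D'' (length P * n + s i)" using least len by blast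
  also have "\<dots> \<le> snd \<sigma> ''y'' i + sum_list (map (snd \<sigma> ''l'') P)"
    using level_complete[of \<sigma> P] lev len w P(2) i by (simp add: touched_def)
  finally show ?thesis .
qed

section \<open>Augmentation\<close>

lemma runs_trace_path:
  assumes "holds_input \<sigma>" and i: "fst \<sigma> ''i'' 0 = i" "i < k" and j: "fst \<sigma> ''j'' 0 = j"
    and row: "fst \<sigma> ''row'' 0 = j * n"
    and p: "fst \<sigma> ''start'' (fst \<sigma> ''count'' 0) = p"
    and P: "P = trace (fst \<sigma> ''par'') j (s i)" "set P \<subseteq> {..<m}"
  shows "runs trace_path \<sigma> (10 * j + 4)
    (\<lambda>\<tau>. fst \<tau> ''p'' 0 = p + j \<and> map (fst \<tau> ''path'') [p..<p + j] = P \<and>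
      (\<forall>x<p. fst \<tau> ''path'' x = fst \<sigma> ''path'' x) \<and>
      snd \<tau> ''c'' 0 = Min (insert (d i) (u ` set P)))" (is "runs _ _ _ ?Q")
  unfolding trace_path_def
proof (rule runs_Seq)
  let ?c = "nset ''p'' (NCell ''start'' (nvar ''count'')) ;;
     nset ''v'' (NCell ''s'' (nvar ''i'')) ;; rset ''c'' (RCell ''d'' (nvar ''i''))"
  \<comment> \<open>Written prefix and remaining trace together always give \<open>P\<close>. The
    minimum starts from the demand, which is a resource of the path as well.\<close>
  let ?I = "\<lambda>\<tau>. let j' = fst \<tau> ''j'' 0; p' = fst \<tau> ''p'' 0; Q = map (fst \<tau> ''path'') [p..<p'] in
    p \<le> p' \<and> p' + j' = p + j \<and> fst \<tau> ''row'' 0 = j' * n \<and>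
    Q @ trace (fst \<sigma> ''par'') j' (fst \<tau> ''v'' 0) = P \<and>
    (\<forall>x<p. fst \<tau> ''path'' x = fst \<sigma> ''path'' x) \<and> snd \<tau> ''c'' 0 = Min (insert (d i) (u ` set Q))"
  show "runs ?c \<sigma> 3 ?I"
    by (rule runs_loop_free) (use assms in \<open>auto simp: store_def holds_inputD\<close>)
  fix \<tau>1 assume 1: "?I \<tau>1" and ag1: "agrees (nwrites ?c) (rwrites ?c) \<sigma> \<tau>1"
  have j1: "fst \<tau>1 ''j'' 0 = j" using ag1 j by (simp add: agrees_def)
  show "runs (While (NLess (N 0) (nvar ''j'')) trace_body) \<tau>1 (10 * j + 1) ?Q"
  proof (rule runs_While[where I = ?I and \<Phi> = "\<lambda>\<tau>. fst \<tau> ''j'' 0" and B = 9])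
    show "?I \<tau>1" using 1 .
    fix \<tau> assume I: "?I \<tau>" and ag: "agrees (nwrites trace_body) (rwrites trace_body) \<tau>1 \<tau>"
    have a: "agrees {''e'', ''path'', ''p'', ''v'', ''row'', ''j''} {''c''} \<sigma> \<tau>"
      using ag ag1 by (simp add: writes agrees_def)
    define p' where "p' = fst \<tau> ''p'' 0"
    define Q where "Q = map (fst \<tau> ''path'') [p..<p']"
    {
      assume "bval (NLess (N 0) (nvar ''j'')) \<tau>"
      then obtain j' where j': "fst \<tau> ''j'' 0 = Suc j'" using gr0_implies_Suc by auto
      define e where "e = fst \<sigma> ''par'' (Suc j' * n + fst \<tau> ''v'' 0)"
      have I': "p \<le> p'" "p' + Suc j' = p + j" "fst \<tau> ''row'' 0 = Suc j' * n"
        "Q @ e # trace (fst \<sigma> ''par'') j' (head G e) = P"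
        "\<forall>x<p. fst \<tau> ''path'' x = fst \<sigma> ''path'' x" "snd \<tau> ''c'' 0 = Min (insert (d i) (u ` set Q))"
        using I unfolding Let_def p'_def[symmetric] Q_def[symmetric] j' trace.simps e_def[symmetric] by blast+
      have em: "e < m" using I'(4) P(2) by auto
      let ?\<tau>' = "sem trace_body \<tau>"
      have n: "fst \<tau> ''n'' 0 = n" using holds_inputD[OF assms(1)] by (simp add: agreesD[OF a])
      have par: "fst \<tau> ''par'' = fst \<sigma> ''par''" by (simp add: agreesD[OF a])
      have e\<tau>: "fst \<tau> ''par'' (fst \<tau> ''row'' 0 + fst \<tau> ''v'' 0) = e" by (simp add: par I'(3) e_def)
      have h: "fst \<tau> ''head'' e = head G e" "snd \<tau> ''u'' e = u e"
        using holds_inputD[OF assms(1)] em by (simp_all add: agreesD[OF a])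
      have rown: "fst \<tau> ''row'' 0 - n = j' * n" using I'(3) by simp
      have vals: "fst ?\<tau>' ''j'' 0 = j'" "fst ?\<tau>' ''p'' 0 = Suc p'" "fst ?\<tau>' ''row'' 0 = j' * n"
        "fst ?\<tau>' ''v'' 0 = head G e" "fst ?\<tau>' ''path'' = (fst \<tau> ''path'')(p' := e)"
        "snd ?\<tau>' ''c'' 0 = min (u e) (snd \<tau> ''c'' 0)"
        using rown by (auto simp: trace_body_def store_def e\<tau> h p'_def n j' min_def)
      have Q': "map (fst ?\<tau>' ''path'') [p..<Suc p'] = Q @ [e]"
        using I'(1) by (simp add: vals Q_def)
      have I2: "?I ?\<tau>'"
        unfolding Let_def vals(1,2,3,4) Q'
      proof (intro conjI)
        show "p \<le> Suc p'" "Suc p' + j' = p + j" using I' by simp_all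
        show "(Q @ [e]) @ trace (fst \<sigma> ''par'') j' (head G e) = P" using I'(4) by simp
        show "\<forall>x<p. fst ?\<tau>' ''path'' x = fst \<sigma> ''path'' x" using I'(1,5) by (simp add: vals)
        show "snd ?\<tau>' ''c'' 0 = Min (insert (d i) (u ` set (Q @ [e])))"
          using I'(6) by (simp add: vals(6) insert_commute[of "d i"])
      qed simp
      show "runs trace_body \<tau> 9 (\<lambda>\<tau>'. ?I \<tau>' \<and> fst \<tau>' ''j'' 0 < fst \<tau> ''j'' 0)"
      proof (rule runs_loop_free)
        show "?I ?\<tau>' \<and> fst ?\<tau>' ''j'' 0 < fst \<tau> ''j'' 0"
          by (rule conjI[OF I2]) (simp add: vals(1) j')
      qed (simp_all add: trace_body_def)
    next
      assume "\<not> bval (NLess (N 0) (nvar ''j'')) \<tau>"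
      then show "?Q \<tau>" using I by (auto simp: Let_def)
    }
  qed (simp add: j1)
qed simp

text \<open>Each arc of the path must be scaled just once. As \<open>P\<close> is distinct, the
  weight at a position is still the old one when the loop arrives there.\<close>

lemma runs_reweight:
  assumes "holds_input \<sigma>" and p: "fst \<sigma> ''start'' (fst \<sigma> ''count'' 0) = p" "fst \<sigma> ''p'' 0 = p + j"
    and P: "map (fst \<sigma> ''path'') [p..<p + j] = P" "set P \<subseteq> {..<m}" "distinct P"
  shows "runs reweight \<sigma> (4 * j + 2)
    (\<lambda>\<tau>. \<forall>e. snd \<tau> ''l'' e = (if e \<in> set P
      then snd \<sigma> ''l'' e * (1 + snd \<sigma> ''eps'' 0 * snd \<sigma> ''c'' 0 / u e) else snd \<sigma> ''l'' e))"
    (is "runs _ _ _ ?Q")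
  unfolding reweight_def
proof (rule runs_Seq)
  let ?c = "nset ''j'' (NCell ''start'' (nvar ''count''))"
  let ?new = "\<lambda>e. snd \<sigma> ''l'' e * (1 + snd \<sigma> ''eps'' 0 * snd \<sigma> ''c'' 0 / u e)"
  let ?I = "\<lambda>\<tau>. p \<le> fst \<tau> ''j'' 0 \<and> fst \<tau> ''j'' 0 \<le> p + j \<and>
    (\<forall>e. snd \<tau> ''l'' e = (if e \<in> set (take (fst \<tau> ''j'' 0 - p) P) then ?new e else snd \<sigma> ''l'' e))"
  show "runs ?c \<sigma> 1 ?I"
    by (rule runs_loop_free) (use p in \<open>auto simp: store_def\<close>)
  fix \<tau>1 assume 1: "?I \<tau>1" and ag1: "agrees (nwrites ?c) (rwrites ?c) \<sigma> \<tau>1"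
  have lenP: "length P = j" using P(1) by auto
  show "runs (While (NLess (nvar ''j'') (nvar ''p'')) reweight_body) \<tau>1 (4 * j + 1) ?Q"
  proof (rule runs_While[where I = ?I and \<Phi> = "\<lambda>\<tau>. p + j - fst \<tau> ''j'' 0" and B = 3])
    show "?I \<tau>1" using 1 .
    fix \<tau> assume I: "?I \<tau>" and ag: "agrees (nwrites reweight_body) (rwrites reweight_body) \<tau>1 \<tau>"
    have a: "agrees {''e'', ''j''} {''l''} \<sigma> \<tau>"
      using ag ag1 by (simp add: writes agrees_def)
    define x where "x = fst \<tau> ''j'' 0 - p"
    have x: "fst \<tau> ''j'' 0 = p + x" "x \<le> j" using I by (auto simp: x_def)
    have pj: "fst \<tau> ''p'' 0 = p + j" using p(2) by (simp add: agreesD[OF a])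
    {
      assume b: "bval (NLess (nvar ''j'') (nvar ''p'')) \<tau>"
      then have xj: "x < j" using x pj by simp
      have e: "fst \<sigma> ''path'' (p + x) = P ! x" using P(1) xj by auto
      have em: "P ! x < m" using P(2) xj lenP nth_mem[of x P] by (auto simp del: nth_mem)
      have notin: "P ! x \<notin> set (take x P)"
        using P(3) xj lenP by (simp add: take_Suc_conv_app_nth distinct_conv_nth in_set_conv_nth)
      have tk: "set (take (Suc x) P) = insert (P ! x) (set (take x P))"
        using xj lenP by (simp add: take_Suc_conv_app_nth)
      have l: "snd \<tau> ''l'' e = (if e \<in> set (take x P) then ?new e else snd \<sigma> ''l'' e)" for e
        using I x(1) by simp
      show "runs reweight_body \<tau> 3 (\<lambda>\<tau>'. ?I \<tau>' \<and> p + j - fst \<tau>' ''j'' 0 < p + j - fst \<tau> ''j'' 0)"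
        by (rule runs_loop_free)
          (use xj notin em holds_inputD(7)[OF assms(1), of "P ! x"] in
            \<open>auto simp: reweight_body_def store_def x(1) agreesD[OF a] e Suc_diff_le tk l\<close>)
    next
      assume b: "\<not> bval (NLess (nvar ''j'') (nvar ''p'')) \<tau>"
      then have "x = j" using x pj by simp
      then show "?Q \<tau>" using I x(1) lenP by simp
    }
  qed (use conjunct1[OF 1] in simp)
qed simp

lemma runs_augment_path:
  assumes hi: "holds_input \<sigma>" and i: "fst \<sigma> ''i'' 0 = i" "i < k" and j: "fst \<sigma> ''j'' 0 = j"
    and row: "fst \<sigma> ''row'' 0 = j * n"
    and p: "fst \<sigma> ''start'' (fst \<sigma> ''count'' 0) = p"
    and P: "P = trace (fst \<sigma> ''par'') j (s i)" "set P \<subseteq> {..<m}" "distinct P"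
    and c: "c = Min (insert (d i) (u ` set P))"
  shows "runs augment_path \<sigma> (14 * j + 11)
    (\<lambda>\<tau>. fst \<tau> ''count'' 0 = Suc (fst \<sigma> ''count'' 0) \<and>
      fst \<tau> ''com'' = (fst \<sigma> ''com'')(fst \<sigma> ''count'' 0 := i) \<and>
      fst \<tau> ''start'' = (fst \<sigma> ''start'')(Suc (fst \<sigma> ''count'' 0) := p + j) \<and>
      snd \<tau> ''flow'' = (snd \<sigma> ''flow'')(fst \<sigma> ''count'' 0 := c / (snd \<sigma> ''M'' 0 + 1)) \<and>
      map (fst \<tau> ''path'') [p..<p + j] = P \<and> (\<forall>x<p. fst \<tau> ''path'' x = fst \<sigma> ''path'' x) \<and>
      snd \<tau> ''y'' = (snd \<sigma> ''y'')(i := snd \<sigma> ''y'' i * (1 + snd \<sigma> ''eps'' 0 * c / d i)) \<and>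
      (\<forall>e. snd \<tau> ''l'' e = (if e \<in> set P
        then snd \<sigma> ''l'' e * (1 + snd \<sigma> ''eps'' 0 * c / u e) else snd \<sigma> ''l'' e)))"
    (is "runs _ _ _ ?Q")
  unfolding augment_path_def
proof (rule runs_Seq[OF runs_trace_path[OF hi i j row p P(1,2)]])
  fix \<tau>1
  assume 1: "fst \<tau>1 ''p'' 0 = p + j \<and> map (fst \<tau>1 ''path'') [p..<p + j] = P \<and>
      (\<forall>x<p. fst \<tau>1 ''path'' x = fst \<sigma> ''path'' x) \<and> snd \<tau>1 ''c'' 0 = Min (insert (d i) (u ` set P))"
    and ag1: "agrees (nwrites trace_path) (rwrites trace_path) \<sigma> \<tau>1"
  note a1 = ag1[unfolded writes]
  have hi1: "holds_input \<tau>1" using holds_input_agrees[OF hi a1] by simp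
  have st: "fst \<tau>1 ''start'' (fst \<tau>1 ''count'' 0) = p" using p by (simp add: agreesD[OF a1])
  show "runs (reweight ;; emit) \<tau>1 (4 * j + 7) ?Q"
  proof (rule runs_Seq[OF runs_reweight[OF hi1 st, of j P]])
    fix \<tau>2
    assume 2: "\<forall>e. snd \<tau>2 ''l'' e = (if e \<in> set P
        then snd \<tau>1 ''l'' e * (1 + snd \<tau>1 ''eps'' 0 * snd \<tau>1 ''c'' 0 / u e) else snd \<tau>1 ''l'' e)"
      and ag2: "agrees (nwrites reweight) (rwrites reweight) \<tau>1 \<tau>2"
    note a2 = ag2[unfolded writes]
    show "runs emit \<tau>2 5 ?Q"
    proof (rule runs_loop_free)
      show "?Q (sem emit \<tau>2)"
        using 1 2 holds_inputD(10)[OF hi i(2)] p i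
        by (simp add: emit_def store_def agreesD[OF a2] agreesD[OF a1] c)
    qed (simp_all add: emit_def)
  qed (use 1 P in simp_all)
qed simp

end

section \<open>The main loop\<close>

text \<open>Tracing overwrites \<open>path\<close> from cell \<open>p\<close> on. All earlier
  entries end at or below \<open>p\<close>, so they keep their paths and the output gains exactly
  one summand.\<close>

lemma output_append:
  assumes count: "fst \<tau> ''count'' 0 = Suc (fst \<sigma> ''count'' 0)"
    and com: "fst \<tau> ''com'' = (fst \<sigma> ''com'')(fst \<sigma> ''count'' 0 := i)"
    and start: "fst \<tau> ''start'' = (fst \<sigma> ''start'')(Suc (fst \<sigma> ''count'' 0) := p + len)"
    and flow: "snd \<tau> ''flow'' = (snd \<sigma> ''flow'')(fst \<sigma> ''count'' 0 := f)"
    and p: "p = fst \<sigma> ''start'' (fst \<sigma> ''count'' 0)"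
    and path: "map (fst \<tau> ''path'') [p..<p + len] = P" "\<forall>x<p. fst \<tau> ''path'' x = fst \<sigma> ''path'' x"
    and below: "\<forall>j<fst \<sigma> ''count'' 0. fst \<sigma> ''start'' (Suc j) \<le> fst \<sigma> ''start'' (fst \<sigma> ''count'' 0)"
  shows "\<forall>j<fst \<tau> ''count'' 0. fst \<tau> ''start'' (Suc j) \<le> fst \<tau> ''start'' (fst \<tau> ''count'' 0)"
    and "output_flow \<tau> i' P' = output_flow \<sigma> i' P' + (if i' = i \<and> P' = P then f else 0)"
proof -
  let ?c = "fst \<sigma> ''count'' 0"
  show "\<forall>j<fst \<tau> ''count'' 0. fst \<tau> ''start'' (Suc j) \<le> fst \<tau> ''start'' (fst \<tau> ''count'' 0)"
    using below by (auto simp: count start p less_Suc_eq trans_le_add1)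
  have old: "output_path \<tau> j = output_path \<sigma> j" if "j < ?c" for j
  proof -
    have "fst \<tau> ''start'' j = fst \<sigma> ''start'' j" "fst \<tau> ''start'' (Suc j) = fst \<sigma> ''start'' (Suc j)"
      using that by (simp_all add: start)
    then show ?thesis
      unfolding output_path_def using path(2) below that p by (auto intro!: map_cong dest: less_le_trans)
  qed
  have new: "output_path \<tau> ?c = P"
    using path(1) by (simp add: output_path_def start p)
  have set_eq: "{j. j < fst \<tau> ''count'' 0 \<and> fst \<tau> ''com'' j = i' \<and> output_path \<tau> j = P'} =
    {j. j < ?c \<and> fst \<sigma> ''com'' j = i' \<and> output_path \<sigma> j = P'} \<union>
    (if i' = i \<and> P' = P then {?c} else {})"
    using old new by (auto simp: count com less_Suc_eq)
  have "output_flow \<tau> i' P' =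
    (\<Sum>j\<in>{j. j < ?c \<and> fst \<sigma> ''com'' j = i' \<and> output_path \<sigma> j = P'}. snd \<tau> ''flow'' j) +
    (\<Sum>j\<in>(if i' = i \<and> P' = P then {?c} else {}). snd \<tau> ''flow'' j)"
    unfolding output_flow_def set_eq by (intro sum.union_disjoint) auto
  also have "(\<Sum>j\<in>{j. j < ?c \<and> fst \<sigma> ''com'' j = i' \<and> output_path \<sigma> j = P'}. snd \<tau> ''flow'' j)
    = output_flow \<sigma> i' P'"
    unfolding output_flow_def by (intro sum.cong) (auto simp: flow)
  finally show "output_flow \<tau> i' P' = output_flow \<sigma> i' P' + (if i' = i \<and> P' = P then f else 0)"
    by (simp add: flow)
qed

section \<open>The flow problem as a packing problem\<close>

context numbered_lbmcf1
begin

text \<open>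
  The demand of a commodity is the capacity of one more resource \<open>Inr i\<close>, which all of its paths use.
\<close>

definition columns :: "(nat \<times> nat list) set" where
  "columns = Sigma {..<k} paths"

definition resources :: "(nat + nat) set" where
  "resources = Inl ` {..<m} \<union> Inr ` {..<k}"

definition used :: "nat \<times> nat list \<Rightarrow> (nat + nat) set" where
  "used p = insert (Inr (fst p)) (Inl ` set (snd p))"

definition capacity :: "nat + nat \<Rightarrow> real" where
  "capacity = case_sum u d"

lemma capacity_simps [simp]: "capacity (Inl e) = u e" "capacity (Inr i) = d i"
  by (simp_all add: capacity_def)

lemma paths_arcs: "P \<in> paths i \<Longrightarrow> set P \<subseteq> {..<m}"
  by (auto simp: paths_def apath_def awalk_def arcs_eq)

lemma paths_distinct: "P \<in> paths i \<Longrightarrow> distinct P"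
  unfolding paths_def apath_def by (auto intro: distinct_verts_imp_distinct)

text \<open>\<open>Suc L\<close> counts at most \<open>L\<close> arcs and one demand. It is the
  value of \<open>K\<close> whose logarithm \<open>lg\<close> bounds.\<close>

sublocale packing columns used resources capacity "Suc L"
proof
  show "finite columns" by (simp add: columns_def finite_paths)
  show "finite resources" by (simp add: resources_def)
  fix p assume p: "p \<in> columns"
  then show "used p \<subseteq> resources"
    using paths_arcs by (force simp: columns_def used_def resources_def)
  show "used p \<noteq> {}" by (simp add: used_def)
  have "card (used p) \<le> Suc (card (Inl ` set (snd p) :: (nat + nat) set))"
    unfolding used_def by (rule card_insert_le_m1) auto
  also have "card (Inl ` set (snd p) :: (nat + nat) set) \<le> length (snd p)"
    by (meson card_image_le card_length finite_set order_trans)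
  also have "length (snd p) \<le> L" using p by (auto simp: columns_def paths_def)
  finally show "card (used p) \<le> Suc L" by simp
next
  fix r assume "r \<in> resources"
  then show "0 \<le> capacity r"
    using capacity_nonneg demand_pos by (auto simp: resources_def capacity_def arcs_eq less_imp_le)
qed

lemma card_resources: "card resources = m + k"
  unfolding resources_def by (subst card_Un_disjoint) (auto simp: card_image)

lemma weight_column:
  assumes "P \<in> paths i"
  shows "weight w (i, P) = w (Inr i) + sum_list (map (\<lambda>e. w (Inl e)) P)"
proof -
  have "weight w (i, P) = w (Inr i) + (\<Sum>r\<in>Inl ` set P. w r)"
    unfolding weight_def used_def by (subst sum.insert) auto
  also have "(\<Sum>r\<in>Inl ` set P. w r) = (\<Sum>e\<in>set P. w (Inl e))"
    by (subst sum.reindex) auto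
  also have "\<dots> = sum_list (map (\<lambda>e. w (Inl e)) P)"
    using paths_distinct[OF assms] by (simp add: sum_list_distinct_conv_sum_set)
  finally show ?thesis .
qed

lemma usable_column: "usable (i, P) \<longleftrightarrow> i < k \<and> P \<in> paths i \<and> (\<forall>e\<in>set P. 0 < u e)"
  unfolding usable_def using demand_pos by (auto simp: columns_def used_def)

lemma bottleneck_column: "bottleneck (i, P) = Min (insert (d i) (u ` set P))"
  unfolding bottleneck_def by (simp add: used_def image_image)

lemma load_arc: "load x (Inl e) = (\<Sum>i<k. \<Sum>P\<in>{P \<in> paths i. e \<in> set P}. x (i, P))"
proof -
  have "{p. p \<in> columns \<and> Inl e \<in> used p} = Sigma {..<k} (\<lambda>i. {P \<in> paths i. e \<in> set P})"
    by (auto simp: columns_def used_def)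
  then show ?thesis unfolding load_def by (simp add: sum.Sigma finite_paths)
qed

lemma load_commodity: "i < k \<Longrightarrow> load x (Inr i) = (\<Sum>P\<in>paths i. x (i, P))"
proof -
  assume "i < k"
  then have "{p. p \<in> columns \<and> Inr i \<in> used p} = Pair i ` paths i"
    by (auto simp: columns_def used_def)
  then show ?thesis unfolding load_def by (simp add: sum.reindex inj_on_def)
qed

lemma sum_columns: "(\<Sum>p\<in>columns. x p) = total_flow (\<lambda>i P. x (i, P))"
  by (simp add: columns_def total_flow_def amount_def sum.Sigma finite_paths)

text \<open>Capacities and demands become the loads of the two kinds of resources. Vanishing off the
  columns is a separate condition because \<open>packs\<close> does not look there.\<close>

lemma feasible_iff_packs:
  "feasible (\<lambda>i P. x (i, P)) \<longleftrightarrow> packs x \<and> (\<forall>p. p \<notin> columns \<longrightarrow> x p = 0)"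
proof -
  have "packs x \<longleftrightarrow> (\<forall>i<k. \<forall>P\<in>paths i. 0 \<le> x (i, P)) \<and>
    (\<forall>e<m. load x (Inl e) \<le> u e) \<and> (\<forall>i<k. load x (Inr i) \<le> d i)"
  proof -
    have "(\<forall>p\<in>columns. 0 \<le> x p) \<longleftrightarrow> (\<forall>i<k. \<forall>P\<in>paths i. 0 \<le> x (i, P))"
      by (auto simp: columns_def)
    moreover have "(\<forall>r\<in>resources. load x r \<le> capacity r) \<longleftrightarrow>
      (\<forall>e<m. load x (Inl e) \<le> u e) \<and> (\<forall>i<k. load x (Inr i) \<le> d i)"
      unfolding resources_def ball_Un by (simp, simp add: Ball_def)
    ultimately show ?thesis unfolding packs_def by blast
  qed
  moreover have "(\<forall>p. p \<notin> columns \<longrightarrow> x p = 0) \<longleftrightarrow> (\<forall>i P. \<not> (i < k \<and> P \<in> paths i) \<longrightarrow> x (i, P) = 0)"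
    by (simp add: columns_def)
  ultimately show ?thesis
    unfolding feasible_def amount_def by (auto simp: load_arc load_commodity arcs_eq)
qed

text \<open>The memory represents some abstract run: \<open>count\<close> is its number of steps, to
  which \<open>augmented_count\<close> applies, and the output is its flow, already scaled. The two
  lower bounds on weights describe the progress of phase \<open>r\<close>: commodities before the
  current one have reached the next power.\<close>

definition invariant :: "real \<Rightarrow> nat \<Rightarrow> state \<Rightarrow> bool" where
  "invariant \<epsilon> M \<sigma> \<longleftrightarrow> holds_input \<sigma> \<and> snd \<sigma> ''eps'' 0 = \<epsilon> \<and> snd \<sigma> ''M'' 0 = real M \<and>
    fst \<sigma> ''i'' 0 \<le> k \<and>
    (\<forall>j<fst \<sigma> ''count'' 0. fst \<sigma> ''start'' (Suc j) \<le> fst \<sigma> ''start'' (fst \<sigma> ''count'' 0)) \<and>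
    (\<exists>r w x. r \<le> M \<and> snd \<sigma> ''r'' 0 = real r \<and> snd \<sigma> ''theta'' 0 = (1 + \<epsilon>) ^ Suc r \<and>
      augmented \<epsilon> M (fst \<sigma> ''count'' 0) w x \<and>
      (\<forall>e<m. snd \<sigma> ''l'' e = w (Inl e)) \<and> (\<forall>i<k. snd \<sigma> ''y'' i = w (Inr i)) \<and>
      (\<forall>i P. output_flow \<sigma> i P = x (i, P) / (real M + 1)) \<and>
      (\<forall>i P. usable (i, P) \<longrightarrow> (1 + \<epsilon>) ^ r \<le> weight w (i, P)) \<and>
      (\<forall>i P. usable (i, P) \<and> i < fst \<sigma> ''i'' 0 \<longrightarrow> (1 + \<epsilon>) ^ Suc r \<le> weight w (i, P)))"

text \<open>The augmentations left, by \<open>augmented_count\<close>, plus the failed searches and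
  phase changes left, \<open>k + 1\<close> per phase. The floor is there because the phase number is
  held in a real variable.\<close>

definition remaining :: "nat \<Rightarrow> state \<Rightarrow> nat" where
  "remaining M \<sigma> = ((m + k) * M - fst \<sigma> ''count'' 0) +
    ((M - nat \<lfloor>snd \<sigma> ''r'' 0\<rfloor>) * (k + 1) - fst \<sigma> ''i'' 0)"

text \<open>An iteration is an augmentation, a failed search or a change of phase, and each lowers
  one summand of the measure while keeping the other. The time is that of a search, an augmentation
  along at most \<open>L\<close> arcs and two tests.\<close>

lemma runs_main_body:
  assumes inv: "invariant \<epsilon> M \<sigma>" and eps: "0 < \<epsilon>" and b: "bval (RLess (rvar ''r'') (rvar ''M'')) \<sigma>"
  shows "runs main_body \<sigma> (10 * m * L + 23 * L + 4 * m + 20)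
    (\<lambda>\<tau>. invariant \<epsilon> M \<tau> \<and> remaining M \<tau> < remaining M \<sigma>)" (is "runs _ _ _ ?Q")
proof -
  define i where "i = fst \<sigma> ''i'' 0"
  define cnt where "cnt = fst \<sigma> ''count'' 0"
  have hi: "holds_input \<sigma>" and \<epsilon>: "snd \<sigma> ''eps'' 0 = \<epsilon>" and M: "snd \<sigma> ''M'' 0 = real M"
    and ik: "i \<le> k" and below: "\<forall>j<cnt. fst \<sigma> ''start'' (Suc j) \<le> fst \<sigma> ''start'' cnt"
    using inv unfolding invariant_def i_def cnt_def by blast+
  obtain r w x where r: "r \<le> M" "snd \<sigma> ''r'' 0 = real r" and \<theta>: "snd \<sigma> ''theta'' 0 = (1 + \<epsilon>) ^ Suc r"
    and aug: "augmented \<epsilon> M cnt w x"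
    and l: "\<And>e. e < m \<Longrightarrow> snd \<sigma> ''l'' e = w (Inl e)" and y: "\<And>i. i < k \<Longrightarrow> snd \<sigma> ''y'' i = w (Inr i)"
    and out: "\<And>i P. output_flow \<sigma> i P = x (i, P) / (real M + 1)"
    and ge: "\<And>i P. usable (i, P) \<Longrightarrow> (1 + \<epsilon>) ^ r \<le> weight w (i, P)"
    and ge_Suc: "\<And>i' P. usable (i', P) \<Longrightarrow> i' < i \<Longrightarrow> (1 + \<epsilon>) ^ Suc r \<le> weight w (i', P)"
    using inv unfolding invariant_def i_def cnt_def by blast
  have rM: "r < M" using b r M by simp
  have lnn: "0 \<le> snd \<sigma> ''l'' e" if "e < m" for e
    using augmented_ge_1[OF aug less_imp_le[OF eps], of "Inl e"] l[OF that] that by (simp add: resources_def)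
  have fl: "nat \<lfloor>snd \<sigma> ''r'' 0\<rfloor> = r" using r by simp
  \<comment> \<open>A change of phase uses up \<open>k + 1\<close> units and returns the
    \<open>k\<close> consumed by \<open>i\<close>, so the measure drops by one.\<close>
  have Mr: "(M - r) * (k + 1) = (M - Suc r) * (k + 1) + (k + 1)"
    unfolding Suc_diff_Suc[OF rM, symmetric] by simp
  have kval: "fst \<sigma> ''k'' 0 = k" using holds_inputD[OF hi] by simp
  show ?thesis
  proof (cases "i < k")
    case False
    then have ik: "i = k" using ik by simp
    let ?c = "nset ''i'' (N 0) ;; rset ''r'' (RPlus (rvar ''r'') (OfNat (N 1))) ;;
       rset ''theta'' (RTimes (rvar ''theta'') (RPlus (OfNat (N 1)) (rvar ''eps'')))"
    define \<tau> where "\<tau> = sem ?c \<sigma>"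
    have a: "agrees {''i''} {''r'', ''theta''} \<sigma> \<tau>"
      by (auto simp: \<tau>_def agrees_def store_def)
    have v: "fst \<tau> ''i'' 0 = 0" "snd \<tau> ''r'' 0 = real (Suc r)" "snd \<tau> ''theta'' 0 = (1 + \<epsilon>) ^ Suc (Suc r)"
      using r \<theta> \<epsilon> by (simp_all add: \<tau>_def store_def)
    have "invariant \<epsilon> M \<tau>"
      unfolding invariant_def
    proof (intro conjI exI)
      show "holds_input \<tau>" by (rule holds_input_agrees[OF hi a]) auto
      show "snd \<tau> ''r'' 0 = real (Suc r)" "snd \<tau> ''theta'' 0 = (1 + \<epsilon>) ^ Suc (Suc r)" by (rule v)+
      show "augmented \<epsilon> M (fst \<tau> ''count'' 0) w x" using aug by (simp add: agreesD[OF a] cnt_def)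
      show "\<forall>i P. output_flow \<tau> i P = x (i, P) / (real M + 1)"
        using out by (simp add: output_flow_def output_path_def agreesD[OF a])
      \<comment> \<open>At \<open>i = k\<close> the bound for the commodities already treated covers
        all of them.\<close>
      show "\<forall>i P. usable (i, P) \<longrightarrow> (1 + \<epsilon>) ^ Suc r \<le> weight w (i, P)"
        using ge_Suc by (simp add: usable_column ik)
    qed (use rM \<epsilon> M l y below in \<open>simp_all add: v agreesD[OF a] cnt_def\<close>)
    moreover have "remaining M \<tau> < remaining M \<sigma>"
    proof -
      have "nat \<lfloor>snd \<tau> ''r'' 0\<rfloor> = Suc r" by (simp only: v floor_of_nat nat_int)
      then show ?thesis using fl Mr by (simp add: remaining_def v(1) agreesD[OF a] i_def[symmetric] ik)
    qed
    ultimately have "?Q \<tau>" by blast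
    then have "runs ?c \<sigma> 3 ?Q" unfolding \<tau>_def by (intro runs_loop_free) (assumption | simp)+
    then show ?thesis
      unfolding main_body_def using False kval
      by (intro runs_mono[OF runs_If[where T = 3]]) (auto simp: i_def)
  next
    case True
    have ik: "fst \<sigma> ''i'' 0 < k" using True i_def by simp
    have "runs (search ;; If found augment_path (incr ''i'')) \<sigma> (10 * m * L + 23 * L + 4 * m + 19) ?Q"
    proof (rule runs_Seq[OF runs_search[OF hi ik]])
      fix \<tau>1
      assume 1: "fst \<tau>1 ''row'' 0 = fst \<tau>1 ''j'' 0 * n \<and> fst \<tau>1 ''j'' 0 \<le> L \<and>
        (\<forall>j\<le>fst \<tau>1 ''j'' 0. level \<tau>1 j) \<and>
        (\<forall>j<fst \<tau>1 ''j'' 0. snd \<tau>1 ''theta'' 0 \<le> snd \<tau>1 ''D'' (j * n + s (fst \<sigma> ''i'' 0))) \<and>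
        (fst \<tau>1 ''j'' 0 = L \<or> bval found \<tau>1)"
        and ag1: "agrees (nwrites search) (rwrites search) \<sigma> \<tau>1"
      note a1 = ag1[unfolded writes]
      have hi1: "holds_input \<tau>1" using holds_input_agrees[OF hi a1] by simp
      define j where "j = fst \<tau>1 ''j'' 0"
      have i1: "fst \<tau>1 ''i'' 0 = i" by (simp add: agreesD[OF a1] i_def)
      have \<theta>1: "snd \<tau>1 ''theta'' 0 = (1 + \<epsilon>) ^ Suc r"
      using \<theta> by (simp add: agreesD[OF a1] del: power_Suc)
      have l1: "snd \<tau>1 ''l'' = snd \<sigma> ''l''" "snd \<tau>1 ''y'' = snd \<sigma> ''y''" by (simp_all add: agreesD[OF a1])
      have row: "fst \<tau>1 ''row'' 0 = j * n" "j \<le> L" and lev: "\<forall>j'\<le>j. level \<tau>1 j'"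
        and least: "\<forall>j'<j. snd \<tau>1 ''theta'' 0 \<le> snd \<tau>1 ''D'' (j' * n + s i)"
        and stop: "j = L \<or> bval found \<tau>1"
        using 1 unfolding j_def i_def by blast+
      have found: "bval found \<tau>1 \<longleftrightarrow> snd \<tau>1 ''D'' (j * n + s i) < snd \<tau>1 ''theta'' 0"
        using holds_inputD(8)[OF hi1 True] by (simp add: row i1)
      show "runs (If found augment_path (incr ''i'')) \<tau>1 (Suc (14 * L + 11)) ?Q"
      proof (rule runs_If)
        assume f: "bval found \<tau>1"
        define P where "P = trace (fst \<tau>1 ''par'') j (s i)"
        have P: "apath (s i) P (t i)" "\<forall>e\<in>set P. 0 < u e"
          "snd \<sigma> ''y'' i + sum_list (map (snd \<sigma> ''l'') P) < (1 + \<epsilon>) ^ Suc r"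
          using trace_apath[of \<tau>1 j] trace_walk[of \<tau>1 j "s i"] f found True lnn lev least
          unfolding i1 l1 P_def[symmetric] \<theta>1 by (auto simp: touched_def)
        have Pp: "P \<in> paths i" using P(1) row(2) by (simp add: paths_def P_def)
        have us: "usable (i, P)" using Pp P(2) True by (simp add: usable_column)
        have lw: "map (snd \<sigma> ''l'') P = map (\<lambda>e. w (Inl e)) P" using paths_arcs[OF Pp] l by (auto intro: map_cong)
        have wP: "weight w (i, P) < (1 + \<epsilon>) ^ Suc r"
          using P(3)[unfolded lw] weight_column[OF Pp, of w] y[OF True] by simp
        define c where "c = bottleneck (i, P)"
        define w' where "w' = (\<lambda>r. if r \<in> used (i, P) then w r * (1 + \<epsilon> * c / capacity r) else w r)"
        define x' where "x' = x((i, P) := x (i, P) + c)"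
        have aug': "augmented \<epsilon> M (Suc cnt) w' x'"
          unfolding w'_def x'_def c_def by (rule augment[OF aug us rM _ wP]) (use ge in force)
        \<comment> \<open>The count after the step is still within the bound, so the truncated
          subtraction in \<open>remaining\<close> really drops.\<close>
        have cnt: "Suc cnt \<le> (m + k) * M" using augmented_count[OF aug' eps] by (simp add: card_resources)
        have c0: "0 < c" using bottleneck_pos[OF us] by (simp add: c_def)
        \<comment> \<open>Weights only grow, so the lower bounds reached within the phase survive
          the augmentation.\<close>
        have w_le: "w r \<le> w' r" if "r \<in> resources" for r
        proof -
          have "0 \<le> w r" using augmented_ge_1[OF aug less_imp_le[OF eps] that] by simp
          moreover have "1 \<le> 1 + \<epsilon> * c / capacity r" using eps c0 cap_nonneg[OF that] by simp
          ultimately have "w r * 1 \<le> w r * (1 + \<epsilon> * c / capacity r)" by (rule mult_left_mono[rotated])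
          then show ?thesis by (simp add: w'_def)
        qed
        have wt: "weight w p \<le> weight w' p" if "usable p" for p
          using weight_mono[OF usable_in_cols[OF that] w_le] .
        have c: "c = Min (insert (d i) (u ` set P))" by (simp add: c_def bottleneck_column)
        show "runs augment_path \<tau>1 (14 * L + 11) ?Q"
        proof (rule runs_mono[OF runs_augment_path[OF hi1 i1 True j_def[symmetric] row(1) refl P_def paths_arcs[OF Pp] paths_distinct[OF Pp] c]])
          show "14 * j + 11 \<le> 14 * L + 11" using row(2) by simp
          fix \<tau>
          let ?p = "fst \<tau>1 ''start'' (fst \<tau>1 ''count'' 0)"
          assume 2: "fst \<tau> ''count'' 0 = Suc (fst \<tau>1 ''count'' 0) \<and>
            fst \<tau> ''com'' = (fst \<tau>1 ''com'')(fst \<tau>1 ''count'' 0 := i) \<and>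
            fst \<tau> ''start'' = (fst \<tau>1 ''start'')(Suc (fst \<tau>1 ''count'' 0) := ?p + j) \<and>
            snd \<tau> ''flow'' = (snd \<tau>1 ''flow'')(fst \<tau>1 ''count'' 0 := c / (snd \<tau>1 ''M'' 0 + 1)) \<and>
            map (fst \<tau> ''path'') [?p..<?p + j] = P \<and> (\<forall>x<?p. fst \<tau> ''path'' x = fst \<tau>1 ''path'' x) \<and>
            snd \<tau> ''y'' = (snd \<tau>1 ''y'')(i := snd \<tau>1 ''y'' i * (1 + snd \<tau>1 ''eps'' 0 * c / d i)) \<and>
            (\<forall>e. snd \<tau> ''l'' e = (if e \<in> set P
              then snd \<tau>1 ''l'' e * (1 + snd \<tau>1 ''eps'' 0 * c / u e) else snd \<tau>1 ''l'' e))"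
            and ag2: "agrees (nwrites augment_path) (rwrites augment_path) \<tau>1 \<tau>"
          note a2 = ag2[unfolded writes]
          have hi2: "holds_input \<tau>" using holds_input_agrees[OF hi1 a2] by simp
          have cnt1: "fst \<tau>1 ''count'' 0 = cnt" by (simp add: agreesD[OF a1] cnt_def)
          have below1: "\<forall>j<fst \<tau>1 ''count'' 0. fst \<tau>1 ''start'' (Suc j) \<le> fst \<tau>1 ''start'' (fst \<tau>1 ''count'' 0)"
            using below unfolding cnt1 by (simp add: agreesD[OF a1])
          have M1: "snd \<tau>1 ''M'' 0 = real M" "snd \<tau>1 ''eps'' 0 = \<epsilon>" using M \<epsilon> by (simp_all add: agreesD[OF a1])
          have out1: "output_flow \<tau>1 i P = x (i, P) / (real M + 1)" for i P
            using out[of i P] by (simp add: output_flow_def output_path_def agreesD[OF a1])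
          note app = output_append[of \<tau> \<tau>1 i ?p j "c / (snd \<tau>1 ''M'' 0 + 1)" P, OF _ _ _ _ refl _ _ below1]
          have i2: "fst \<tau> ''i'' 0 = i" "snd \<tau> ''r'' 0 = real r" "snd \<tau> ''theta'' 0 = (1 + \<epsilon>) ^ Suc r"
            "snd \<tau> ''M'' 0 = real M" "snd \<tau> ''eps'' 0 = \<epsilon>"
            using r(2) \<theta>1 i1 M1 by (simp_all add: agreesD[OF a2] agreesD[OF a1])
          have "invariant \<epsilon> M \<tau>"
            unfolding invariant_def i2
          proof (intro conjI exI)
            show "augmented \<epsilon> M (fst \<tau> ''count'' 0) w' x'" using aug' 2 cnt1 by simp
            show "\<forall>j<fst \<tau> ''count'' 0. fst \<tau> ''start'' (Suc j) \<le> fst \<tau> ''start'' (fst \<tau> ''count'' 0)"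
              by (rule app(1)) (use 2 in simp_all)
            show "\<forall>e<m. snd \<tau> ''l'' e = w' (Inl e)"
              using 2 l l1 M1 by (auto simp: w'_def used_def)
            show "\<forall>i<k. snd \<tau> ''y'' i = w' (Inr i)"
              using 2 y l1 M1 by (auto simp: w'_def used_def)
            show "\<forall>i P. output_flow \<tau> i P = x' (i, P) / (real M + 1)"
            proof (intro allI)
              fix i' P'
              have "output_flow \<tau> i' P' = output_flow \<tau>1 i' P' + (if i' = i \<and> P' = P then c / (snd \<tau>1 ''M'' 0 + 1) else 0)"
                by (rule app(2)) (use 2 in simp_all)
              then show "output_flow \<tau> i' P' = x' (i', P') / (real M + 1)"
                by (simp add: out1 M1 x'_def add_divide_distrib)
            qed
            show "\<forall>i P. usable (i, P) \<longrightarrow> (1 + \<epsilon>) ^ r \<le> weight w' (i, P)"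
              using ge wt order_trans by blast
            show "\<forall>i' P. usable (i', P) \<and> i' < i \<longrightarrow> (1 + \<epsilon>) ^ Suc r \<le> weight w' (i', P)"
              using ge_Suc wt order_trans by blast
          qed (use hi2 r(1) True in simp_all)
          moreover have "remaining M \<tau> < remaining M \<sigma>"
            using cnt 2 r(2) by (simp add: remaining_def i2 cnt1 cnt_def[symmetric] i_def[symmetric])
          ultimately show "?Q \<tau>" by blast
        qed
      next
        assume nf: "\<not> bval found \<tau>1"
        then have jL: "j = L" using stop by blast
        have least': "\<forall>j\<le>L. snd \<tau>1 ''theta'' 0 \<le> snd \<tau>1 ''D'' (j * n + s i)"
          using least nf jL unfolding found by (auto simp: le_less)
        have new: "(1 + \<epsilon>) ^ Suc r \<le> weight w (i, P)" if "usable (i, P)" for P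
        proof -
          have P: "P \<in> paths i" "\<forall>e\<in>set P. 0 < u e" using that by (simp_all add: usable_column)
          have lw: "map (snd \<sigma> ''l'') P = map (\<lambda>e. w (Inl e)) P" using paths_arcs[OF P(1)] l by (auto intro: map_cong)
          show ?thesis
            using search_complete[OF i1 lev[unfolded jL] least' P, unfolded l1 lw] weight_column[OF P(1), of w] y[OF True]
            by (simp add: \<theta>1 del: power_Suc)
        qed
        define \<tau> where "\<tau> = sem (incr ''i'') \<tau>1"
        have a: "agrees {''e'', ''par'', ''prev'', ''row'', ''j'', ''i''} {''D''} \<sigma> \<tau>"
          using a1 by (auto simp: \<tau>_def agrees_def store_def)
        have v: "fst \<tau> ''i'' 0 = Suc i" using i1 by (simp add: \<tau>_def store_def)
        have "invariant \<epsilon> M \<tau>"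
          unfolding invariant_def
        proof (intro conjI exI)
          show "holds_input \<tau>" by (rule holds_input_agrees[OF hi a]) auto
          show "augmented \<epsilon> M (fst \<tau> ''count'' 0) w x" using aug by (simp add: agreesD[OF a] cnt_def)
          show "\<forall>i P. output_flow \<tau> i P = x (i, P) / (real M + 1)"
            using out by (simp add: output_flow_def output_path_def agreesD[OF a])
          show "snd \<tau> ''theta'' 0 = (1 + \<epsilon>) ^ Suc r" using \<theta> by (simp add: agreesD[OF a])
          show "\<forall>i P. usable (i, P) \<longrightarrow> (1 + \<epsilon>) ^ r \<le> weight w (i, P)" using ge by blast
          show "\<forall>i P. usable (i, P) \<and> i < fst \<tau> ''i'' 0 \<longrightarrow> (1 + \<epsilon>) ^ Suc r \<le> weight w (i, P)"
            using ge_Suc new unfolding v less_Suc_eq by blast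
        qed (use r \<epsilon> M l y below True in \<open>simp_all add: v agreesD[OF a] cnt_def\<close>)
        moreover have "remaining M \<tau> < remaining M \<sigma>"
        proof -
          have "(M - r) * (k + 1) - Suc i < (M - r) * (k + 1) - i" using Mr True by linarith
          moreover have "fst \<tau> ''count'' = fst \<sigma> ''count''" "snd \<tau> ''r'' = snd \<sigma> ''r''"
            by (simp_all add: agreesD[OF a])
          ultimately show ?thesis unfolding remaining_def v i_def[symmetric] by (simp only: fl add_strict_left_mono)
        qed
        ultimately have "?Q \<tau>" by blast
        then show "runs (incr ''i'') \<tau>1 (14 * L + 11) ?Q" unfolding \<tau>_def by (intro runs_loop_free) (assumption | simp)+
      qed
    qed (simp add: algebra_simps)
    then show ?thesis
      unfolding main_body_def using True kval
      by (intro runs_mono[OF runs_If[where T = "10 * m * L + 23 * L + 4 * m + 19"]]) (auto simp: i_def)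
  qed
qed

section \<open>Initialisation of the parameters and the weights\<close>

lemma runs_choose_q:
  assumes "holds_input \<sigma>" "0 < \<omega>" "\<omega> < 1"
  shows "runs choose_q \<sigma> (2 * nat \<lceil>4 / \<omega>\<rceil> + 2)
    (\<lambda>\<tau>. \<exists>q. snd \<tau> ''q'' 0 = real q \<and> 1 \<le> q \<and> 4 \<le> real q * \<omega> \<and> q \<le> nat \<lceil>4 / \<omega>\<rceil>)"
    (is "runs _ _ _ ?Q")
  unfolding choose_q_def
proof (rule runs_Seq)
  let ?N = "nat \<lceil>4 / \<omega>\<rceil>"
  \<comment> \<open>The quotient rounded up passes the test, so counting stops there at the
    latest.\<close>
  have N: "4 \<le> real ?N * \<omega>"
  proof -
    have "4 / \<omega> \<le> real ?N" by linarith
    then have "4 / \<omega> * \<omega> \<le> real ?N * \<omega>" using assms(2) by (intro mult_right_mono) auto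
    then show ?thesis using assms(2) by simp
  qed
  then have N1: "1 \<le> ?N" by (cases ?N) auto
  let ?I = "\<lambda>\<tau>. \<exists>q. snd \<tau> ''q'' 0 = real q \<and> 1 \<le> q \<and> q \<le> ?N"
  let ?c = "rset ''q'' (OfNat (N 1))" and ?b = "rset ''q'' (RPlus (rvar ''q'') (OfNat (N 1)))"
  show "runs ?c \<sigma> 1 (\<lambda>\<tau>. snd \<tau> ''q'' 0 = 1)"
    by (rule runs_loop_free) (simp_all add: store_def)
  fix \<tau>1 assume 1: "snd \<tau>1 ''q'' 0 = 1" and ag1: "agrees (nwrites ?c) (rwrites ?c) \<sigma> \<tau>1"
  show "runs (While (RLess (RTimes (rvar ''q'') (rvar ''omega'')) (OfNat (N 4))) ?b) \<tau>1 (2 * ?N + 1) ?Q"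
  proof (rule runs_While[where I = ?I and \<Phi> = "\<lambda>\<tau>. ?N - nat \<lfloor>snd \<tau> ''q'' 0\<rfloor>" and B = 1])
    show "?I \<tau>1" using 1 N1 by (intro exI[of _ 1]) simp
    fix \<tau> assume I: "?I \<tau>" and ag: "agrees (nwrites ?b) (rwrites ?b) \<tau>1 \<tau>"
    have om: "snd \<tau> ''omega'' 0 = \<omega>" using ag ag1 holds_inputD[OF assms(1)] by (simp add: agrees_def)
    obtain q where q: "snd \<tau> ''q'' 0 = real q" "1 \<le> q" "q \<le> ?N" using I by blast
    {
      assume "bval (RLess (RTimes (rvar ''q'') (rvar ''omega'')) (OfNat (N 4))) \<tau>"
      then have "real q * \<omega> < 4" using q om by simp
      then have "real q * \<omega> < real ?N * \<omega>" using N by linarith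
      then have lt: "q < ?N" using assms(2) by simp
      have new: "snd (sem ?b \<tau>) ''q'' 0 = real (Suc q)" using q by (simp add: store_def)
      show "runs ?b \<tau> 1 (\<lambda>\<tau>'. ?I \<tau>' \<and> ?N - nat \<lfloor>snd \<tau>' ''q'' 0\<rfloor> < ?N - nat \<lfloor>snd \<tau> ''q'' 0\<rfloor>)"
      proof (rule runs_loop_free)
        have "?N - Suc q < ?N - q" using lt by linarith
        then show "?I (sem ?b \<tau>) \<and> ?N - nat \<lfloor>snd (sem ?b \<tau>) ''q'' 0\<rfloor> < ?N - nat \<lfloor>snd \<tau> ''q'' 0\<rfloor>"
          unfolding new q(1) floor_of_nat nat_int using lt by (intro conjI exI[of _ "Suc q"]) auto
      qed simp_all
    next
      assume "\<not> bval (RLess (RTimes (rvar ''q'') (rvar ''omega'')) (OfNat (N 4))) \<tau>"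
      then have "4 \<le> real q * \<omega>" using q om by simp
      then show "?Q \<tau>" using q by blast
    }
  qed (use 1 in simp)
qed simp

text \<open>The last disjunct records that the loop did not stop one doubling earlier. It bounds
  \<open>lg\<close> from above by the logarithm of \<open>L\<close>, up to a constant.\<close>

lemma runs_choose_lg:
  assumes "holds_input \<sigma>"
  shows "runs choose_lg \<sigma> (3 * L + 6)
    (\<lambda>\<tau>. \<exists>lg. snd \<tau> ''lg'' 0 = real lg \<and> 1 \<le> lg \<and> Suc L \<le> 2 ^ lg \<and> (lg = 1 \<or> 2 ^ (lg - 1) \<le> L))"
    (is "runs _ _ _ ?Q")
  unfolding choose_lg_def
proof (rule runs_Seq)
  let ?I = "\<lambda>\<tau>. \<exists>lg. snd \<tau> ''lg'' 0 = real lg \<and> snd \<tau> ''pw'' 0 = 2 ^ lg \<and> 1 \<le> lg \<and> (lg = 1 \<or> 2 ^ (lg - 1) \<le> L)"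
  let ?c = "rset ''lg'' (OfNat (N 1)) ;; rset ''pw'' (OfNat (N 2))"
    and ?b = "rset ''lg'' (RPlus (rvar ''lg'') (OfNat (N 1))) ;; rset ''pw'' (RPlus (rvar ''pw'') (rvar ''pw''))"
  show "runs ?c \<sigma> 2 (\<lambda>\<tau>. snd \<tau> ''lg'' 0 = 1 \<and> snd \<tau> ''pw'' 0 = 2)"
    by (rule runs_loop_free) (simp_all add: store_def)
  fix \<tau>1 assume 1: "snd \<tau>1 ''lg'' 0 = 1 \<and> snd \<tau>1 ''pw'' 0 = 2" and ag1: "agrees (nwrites ?c) (rwrites ?c) \<sigma> \<tau>1"
  show "runs (While (RLess (rvar ''pw'') (OfNat (NPlus (nvar ''L'') (N 1)))) ?b) \<tau>1 (3 * L + 4) ?Q"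
  proof (rule runs_While[where I = ?I and \<Phi> = "\<lambda>\<tau>. Suc L - nat \<lfloor>snd \<tau> ''lg'' 0\<rfloor>" and B = 2])
    show "?I \<tau>1" using 1 by (intro exI[of _ 1]) simp
    fix \<tau> assume I: "?I \<tau>" and ag: "agrees (nwrites ?b) (rwrites ?b) \<tau>1 \<tau>"
    have Lv: "fst \<tau> ''L'' 0 = L" using ag ag1 holds_inputD[OF assms(1)] by (simp add: agrees_def)
    obtain lg where lg: "snd \<tau> ''lg'' 0 = real lg" "snd \<tau> ''pw'' 0 = 2 ^ lg" "1 \<le> lg" "lg = 1 \<or> 2 ^ (lg - 1) \<le> L"
      using I by blast
    have cond: "bval (RLess (rvar ''pw'') (OfNat (NPlus (nvar ''L'') (N 1)))) \<tau> \<longleftrightarrow> 2 ^ lg < Suc L"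
    proof -
      have "(2 ^ lg :: real) < real (Suc L) \<longleftrightarrow> real (2 ^ lg) < real (Suc L)" by simp
      also have "\<dots> \<longleftrightarrow> 2 ^ lg < Suc L" unfolding of_nat_less_iff ..
      finally show ?thesis using lg Lv by (simp add: add.commute)
    qed
    {
      assume "bval (RLess (rvar ''pw'') (OfNat (NPlus (nvar ''L'') (N 1)))) \<tau>"
      then have pw: "2 ^ lg < Suc L" unfolding cond .
      moreover have "lg < 2 ^ lg" by (rule less_exp)
      ultimately have lt: "lg < Suc L" by linarith
      have new: "snd (sem ?b \<tau>) ''lg'' 0 = real (Suc lg)" "snd (sem ?b \<tau>) ''pw'' 0 = 2 ^ Suc lg"
        using lg by (simp_all add: store_def)
      show "runs ?b \<tau> 2 (\<lambda>\<tau>'. ?I \<tau>' \<and> Suc L - nat \<lfloor>snd \<tau>' ''lg'' 0\<rfloor> < Suc L - nat \<lfloor>snd \<tau> ''lg'' 0\<rfloor>)"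
      proof (rule runs_loop_free)
        have "Suc L - Suc lg < Suc L - lg" using lt by linarith
        then show "?I (sem ?b \<tau>) \<and> Suc L - nat \<lfloor>snd (sem ?b \<tau>) ''lg'' 0\<rfloor> < Suc L - nat \<lfloor>snd \<tau> ''lg'' 0\<rfloor>"
          unfolding new lg(1) floor_of_nat nat_int using pw by (intro conjI exI[of _ "Suc lg"]) auto
      qed simp_all
    next
      assume "\<not> bval (RLess (rvar ''pw'') (OfNat (NPlus (nvar ''L'') (N 1)))) \<tau>"
      then have "Suc L \<le> 2 ^ lg" unfolding cond by simp
      then show "?Q \<tau>" using lg by blast
    }
  qed (use 1 in simp)
qed simp

lemma runs_fill_one:
  assumes len: "fst \<sigma> b 0 = len" and b: "b \<noteq> ''e''"
  shows "runs (fill_one a b) \<sigma> (3 * len + 2) (\<lambda>\<tau>. \<forall>e<len. snd \<tau> a e = 1)" (is "runs _ _ _ ?Q")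
  unfolding fill_one_def
proof (rule runs_Seq)
  let ?I = "\<lambda>\<tau>. fst \<tau> ''e'' 0 \<le> len \<and> (\<forall>e<fst \<tau> ''e'' 0. snd \<tau> a e = 1)"
  let ?c = "nset ''e'' (N 0)" and ?b = "RAssign a (nvar ''e'') (OfNat (N 1)) ;; incr ''e''"
  show "runs ?c \<sigma> 1 (\<lambda>\<tau>. fst \<tau> ''e'' 0 = 0)"
    by (rule runs_loop_free) (simp_all add: store_def)
  fix \<tau>1 assume 1: "fst \<tau>1 ''e'' 0 = 0" and ag1: "agrees (nwrites ?c) (rwrites ?c) \<sigma> \<tau>1"
  show "runs (While (NLess (nvar ''e'') (nvar b)) ?b) \<tau>1 (3 * len + 1) ?Q"
  proof (rule runs_While[where I = ?I and \<Phi> = "\<lambda>\<tau>. len - fst \<tau> ''e'' 0" and B = 2])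
    show "?I \<tau>1" using 1 by simp
    fix \<tau> assume I: "?I \<tau>" and ag: "agrees (nwrites ?b) (rwrites ?b) \<tau>1 \<tau>"
    have Nv: "fst \<tau> b 0 = len" using ag ag1 len b by (simp add: agrees_def)
    {
      assume lt: "bval (NLess (nvar ''e'') (nvar b)) \<tau>"
      show "runs ?b \<tau> 2 (\<lambda>\<tau>'. ?I \<tau>' \<and> len - fst \<tau>' ''e'' 0 < len - fst \<tau> ''e'' 0)"
        by (rule runs_loop_free) (use I lt Nv in \<open>auto simp: store_def less_Suc_eq\<close>)
    next
      assume "\<not> bval (NLess (nvar ''e'') (nvar b)) \<tau>"
      then show "?Q \<tau>" using I Nv by auto
    }
  qed (simp add: 1)
qed simp

section \<open>Approximation guarantee and total running time\<close>

lemma holds_input_input_state: "holds_input (input_state G u k s t d L \<omega>)"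
  by (simp add: holds_input_def input_state_def array_def verts_eq arcs_eq)

lemma invariant_start:
  assumes "holds_input \<sigma>" "0 < \<epsilon>" "snd \<sigma> ''eps'' 0 = \<epsilon>" "snd \<sigma> ''M'' 0 = real M" "snd \<sigma> ''theta'' 0 = 1 + \<epsilon>"
    and "fst \<sigma> ''i'' 0 = 0" "fst \<sigma> ''count'' 0 = 0" "snd \<sigma> ''r'' 0 = 0"
    and "\<forall>e<m. snd \<sigma> ''l'' e = 1" "\<forall>i<k. snd \<sigma> ''y'' i = 1"
  shows "invariant \<epsilon> M \<sigma>"
  unfolding invariant_def
proof (intro conjI exI)
  show "augmented \<epsilon> M (fst \<sigma> ''count'' 0) (\<lambda>_. 1) (\<lambda>_. 0)" using assms(7) augmented.start by simp
  show "\<forall>i P. output_flow \<sigma> i P = 0 / (real M + 1)" using assms(7) by (simp add: output_flow_def)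
  \<comment> \<open>Every column uses the resource of its demand, which alone contributes weight
    1.\<close>
  show "\<forall>i P. usable (i, P) \<longrightarrow> (1 + \<epsilon>) ^ 0 \<le> weight (\<lambda>_. 1) (i, P)"
    using weight_ge[OF augmented.start[of \<epsilon> M] less_imp_le[OF assms(2)]] usable_in_cols by (force simp: used_def)
qed (use assms in simp_all)

lemma invariant_final:
  assumes inv: "invariant \<epsilon> M \<sigma>" and b: "\<not> bval (RLess (rvar ''r'') (rvar ''M'')) \<sigma>"
    and q: "1 \<le> q" "4 \<le> real q * \<omega>" and lg: "Suc L \<le> 2 ^ lg" "1 \<le> lg" and M: "M = q * q * lg"
    and \<epsilon>: "\<epsilon> = 1 / real q" and \<omega>: "0 < \<omega>" "\<omega> < 1"
  shows "approximate_solution \<omega> (output_flow \<sigma>)"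
proof -
  obtain r w x where r: "r \<le> M" "snd \<sigma> ''r'' 0 = real r"
    and aug: "augmented \<epsilon> M (fst \<sigma> ''count'' 0) w x"
    and out: "\<And>i P. output_flow \<sigma> i P = x (i, P) / (real M + 1)"
    and ge: "\<And>i P. usable (i, P) \<Longrightarrow> (1 + \<epsilon>) ^ r \<le> weight w (i, P)"
    using inv unfolding invariant_def by blast
  have "snd \<sigma> ''M'' 0 = real M" using inv unfolding invariant_def by blast
  then have rM: "r = M" using b r by simp
  have flow: "output_flow \<sigma> = (\<lambda>i P. x (i, P) / real (Suc M))" using out by (auto simp: fun_eq_iff add.commute)
  have eps: "0 < \<epsilon>" using q \<epsilon> by simp
  have feas: "feasible (output_flow \<sigma>)"
    using feasible_iff_packs[of "\<lambda>p. x p / real (Suc M)"] augmented_packs[OF aug eps] augmented_nonneg(2)[OF aug]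
    by (simp add: flow del: of_nat_Suc)
  have "(1 - \<omega>) * total_flow z \<le> total_flow (output_flow \<sigma>)" if "feasible z" for z
  proof -
    have "packs (\<lambda>p. z (fst p) (snd p))" using feasible_iff_packs[of "\<lambda>p. z (fst p) (snd p)"] that by simp
    from augmented_approximates[OF aug this _ q _ lg M \<epsilon> \<omega>]
    have "(1 - \<omega>) * (\<Sum>p\<in>columns. z (fst p) (snd p)) \<le> (\<Sum>p\<in>columns. x p / real (Suc M))"
      using ge unfolding rM by force
    then show ?thesis unfolding sum_columns flow by simp
  qed
  \<comment> \<open>The optimum is a supremum, so the bound is first made uniform in
    \<open>z\<close>, dividing by the positive number \<open>1 - \<omega>\<close>.\<close>
  then have "total_flow z \<le> total_flow (output_flow \<sigma>) / (1 - \<omega>)" if "feasible z" for z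
    using that \<omega> by (simp add: field_simps)
  then have "opt \<le> total_flow (output_flow \<sigma>) / (1 - \<omega>)"
    unfolding opt_def using feasible_zero by (intro cSUP_least) auto
  then show ?thesis using feas \<omega> by (simp add: approximate_solution_def field_simps)
qed

text \<open>\<open>Q\<close> and \<open>lgL\<close> bound the program's own parameters
  \<open>q\<close> and \<open>lg\<close>, so that the number of iterations, at most
  \<open>(m + k) * M + M * (k + 1)\<close>, is expressed through the input.\<close>

lemma runs_solve:
  assumes \<omega>: "0 < \<omega>" "\<omega> < 1"
  defines "Q \<equiv> nat \<lceil>4 / \<omega>\<rceil>" and "lgL \<equiv> nat \<lfloor>2 * log 2 (real (max 2 L))\<rfloor>"
  shows "runs solve (input_state G u k s t d L \<omega>)
    (2 * Q + 3 * L + 3 * m + 3 * k + 16 +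
      ((m + k) * (Q * Q * lgL) + (Q * Q * lgL) * (k + 1)) * (10 * m * L + 23 * L + 4 * m + 21))
    (\<lambda>\<sigma>. approximate_solution \<omega> (output_flow \<sigma>))"
proof -
  let ?\<sigma> = "input_state G u k s t d L \<omega>"
  let ?Q = "\<lambda>\<sigma>. approximate_solution \<omega> (output_flow \<sigma>)"
  let ?B = "10 * m * L + 23 * L + 4 * m + 20"
  let ?W = "While (RLess (rvar ''r'') (rvar ''M'')) main_body"
  let ?T = "((m + k) * (Q * Q * lgL) + (Q * Q * lgL) * (k + 1)) * (?B + 1)"
  note hi = holds_input_input_state
  have zero: "fst ?\<sigma> ''i'' = (\<lambda>_. 0)" "fst ?\<sigma> ''count'' = (\<lambda>_. 0)" "snd ?\<sigma> ''r'' = (\<lambda>_. 0)"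
    by (simp_all add: input_state_def)
  have wr: "nwrites choose_q = {}" "rwrites choose_q = {''q''}"
    "nwrites choose_lg = {}" "rwrites choose_lg = {''lg'', ''pw''}"
    "nwrites (fill_one a b) = {''e''}" "rwrites (fill_one a b) = {a}"
    "nwrites set_parameters = {}" "rwrites set_parameters = {''eps'', ''M'', ''theta''}" for a b
    by (auto simp: choose_q_def choose_lg_def fill_one_def set_parameters_def)
  have "runs solve ?\<sigma> ((2 * Q + 2) + ((3 * L + 6) + ((3 * m + 2) + ((3 * k + 2) + (3 + (?T + 1)))))) ?Q"
    unfolding solve_def
  proof (rule runs_Seq[OF runs_choose_q[OF hi \<omega>, folded Q_def] _ order_refl])
    fix \<tau>1 assume "\<exists>q. snd \<tau>1 ''q'' 0 = real q \<and> 1 \<le> q \<and> 4 \<le> real q * \<omega> \<and> q \<le> Q"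
      and ag1: "agrees (nwrites choose_q) (rwrites choose_q) ?\<sigma> \<tau>1"
    then obtain q where q: "snd \<tau>1 ''q'' 0 = real q" "1 \<le> q" "4 \<le> real q * \<omega>" "q \<le> Q" by blast
    note a1 = ag1[unfolded wr]
    have hi1: "holds_input \<tau>1" using holds_input_agrees[OF hi a1] by simp
    show "runs (choose_lg ;; fill_one ''l'' ''m'' ;; fill_one ''y'' ''k'' ;; set_parameters ;; ?W) \<tau>1
      ((3 * L + 6) + ((3 * m + 2) + ((3 * k + 2) + (3 + (?T + 1))))) ?Q"
    proof (rule runs_Seq[OF runs_choose_lg[OF hi1] _ order_refl])
      fix \<tau>2 assume "\<exists>lg. snd \<tau>2 ''lg'' 0 = real lg \<and> 1 \<le> lg \<and> Suc L \<le> 2 ^ lg \<and> (lg = 1 \<or> 2 ^ (lg - 1) \<le> L)"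
        and ag2: "agrees (nwrites choose_lg) (rwrites choose_lg) \<tau>1 \<tau>2"
      then obtain lg where lg: "snd \<tau>2 ''lg'' 0 = real lg" "1 \<le> lg" "Suc L \<le> 2 ^ lg" "lg = 1 \<or> 2 ^ (lg - 1) \<le> L"
        by blast
      note a2 = ag2[unfolded wr]
      have hi2: "holds_input \<tau>2" using holds_input_agrees[OF hi1 a2] by simp
      define M where "M = q * q * lg"
      define \<epsilon> where "\<epsilon> = 1 / real q"
      have eps: "0 < \<epsilon>" using q(2) by (simp add: \<epsilon>_def)
      \<comment> \<open>Rounding up may exceed the logarithm of \<open>L\<close> by 1. For
        \<open>lg\<close> at least 2 a factor 2 absorbs this, and for \<open>lg = 1\<close> the
        replacement of \<open>L\<close> by \<open>max 2 L\<close> does.\<close>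
      have lg_le: "lg \<le> lgL"
      proof -
        have "real lg \<le> 2 * log 2 (real (max 2 L))"
        proof (cases "lg = 1")
          case True
          have "log 2 2 \<le> log 2 (real (max 2 L))" by (subst log_le_cancel_iff) auto
          then have "1 \<le> log 2 (real (max 2 L))" by simp
          then show ?thesis unfolding True by linarith
        next
          case False
          then have "(2::nat) ^ (lg - 1) \<le> max 2 L" using lg(4) by auto
          then have "real (2 ^ (lg - 1)) \<le> real (max 2 L)" by (rule of_nat_mono)
          then have "log 2 (2 ^ (lg - 1)) \<le> log 2 (real (max 2 L))" by (subst log_le_cancel_iff) auto
          then have "real (lg - 1) \<le> log 2 (real (max 2 L))" by (simp add: log_nat_power)
          moreover have "lg \<le> 2 * (lg - 1)" using False lg(2) by linarith
          ultimately show ?thesis by linarith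
        qed
        then show ?thesis unfolding lgL_def by linarith
      qed
      have M_le: "M \<le> Q * Q * lgL" unfolding M_def using q(4) lg_le by (intro mult_mono) auto
      show "runs (fill_one ''l'' ''m'' ;; fill_one ''y'' ''k'' ;; set_parameters ;; ?W) \<tau>2
        ((3 * m + 2) + ((3 * k + 2) + (3 + (?T + 1)))) ?Q"
      proof (rule runs_Seq[OF runs_fill_one[OF holds_inputD(2)[OF hi2]] _ order_refl])
        fix \<tau>3 assume l: "\<forall>e<m. snd \<tau>3 ''l'' e = 1"
          and ag3: "agrees (nwrites (fill_one ''l'' ''m'')) (rwrites (fill_one ''l'' ''m'')) \<tau>2 \<tau>3"
        note a3 = ag3[unfolded wr]
        have hi3: "holds_input \<tau>3" using holds_input_agrees[OF hi2 a3] by simp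
        show "runs (fill_one ''y'' ''k'' ;; set_parameters ;; ?W) \<tau>3
          ((3 * k + 2) + (3 + (?T + 1))) ?Q"
        proof (rule runs_Seq[OF runs_fill_one[OF holds_inputD(3)[OF hi3]] _ order_refl])
          fix \<tau>4 assume y: "\<forall>i<k. snd \<tau>4 ''y'' i = 1"
            and ag4: "agrees (nwrites (fill_one ''y'' ''k'')) (rwrites (fill_one ''y'' ''k'')) \<tau>3 \<tau>4"
          note a4 = ag4[unfolded wr]
          have hi4: "holds_input \<tau>4" using holds_input_agrees[OF hi3 a4] by simp
          have q4: "snd \<tau>4 ''q'' 0 = real q" "snd \<tau>4 ''lg'' 0 = real lg"
            using q lg by (simp_all add: agreesD[OF a4] agreesD[OF a3] agreesD[OF a2])
          let ?P = "\<lambda>\<tau>. snd \<tau> ''eps'' 0 = \<epsilon> \<and> snd \<tau> ''M'' 0 = real M \<and> snd \<tau> ''theta'' 0 = 1 + \<epsilon>"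
          have par: "runs set_parameters \<tau>4 3 ?P"
            by (rule runs_loop_free) (simp_all add: set_parameters_def store_def q4 \<epsilon>_def M_def)
          show "runs (set_parameters ;; ?W) \<tau>4 (3 + (?T + 1)) ?Q"
          proof (rule runs_Seq[OF par _ order_refl])
            fix \<tau>5 assume P: "?P \<tau>5" and ag5: "agrees (nwrites set_parameters) (rwrites set_parameters) \<tau>4 \<tau>5"
            note a5 = ag5[unfolded wr]
            have hi5: "holds_input \<tau>5" using holds_input_agrees[OF hi4 a5] by simp
            note ags = agreesD[OF a5] agreesD[OF a4] agreesD[OF a3] agreesD[OF a2] agreesD[OF a1]
            have inv: "invariant \<epsilon> M \<tau>5"
              by (rule invariant_start[OF hi5 eps]) (use P l y zero in \<open>simp_all add: ags\<close>)
            show "runs ?W \<tau>5 (?T + 1) ?Q"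
            proof (rule runs_While[where I = "invariant \<epsilon> M" and \<Phi> = "remaining M" and B = ?B])
              show "invariant \<epsilon> M \<tau>5" by (rule inv)
              show "runs main_body \<tau> ?B (\<lambda>\<tau>'. invariant \<epsilon> M \<tau>' \<and> remaining M \<tau>' < remaining M \<tau>)"
                if "invariant \<epsilon> M \<tau>" "bval (RLess (rvar ''r'') (rvar ''M'')) \<tau>" for \<tau>
                by (rule runs_main_body[OF that(1) eps that(2)])
              show "?Q \<tau>" if "invariant \<epsilon> M \<tau>" "\<not> bval (RLess (rvar ''r'') (rvar ''M'')) \<tau>" for \<tau>
                by (rule invariant_final[OF that q(2,3) lg(3,2) M_def \<epsilon>_def \<omega>])
              have "remaining M \<tau>5 \<le> (m + k) * M + M * (k + 1)"
                using zero by (simp add: remaining_def ags)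
              also have "\<dots> \<le> (m + k) * (Q * Q * lgL) + (Q * Q * lgL) * (k + 1)"
                using M_le by (intro add_mono mult_mono) auto
              finally show "remaining M \<tau>5 * (?B + 1) + 1 \<le> ?T + 1"
                by (intro add_right_mono mult_right_mono) auto
            qed
          qed
        qed simp
      qed simp
    qed
  qed
  then show ?thesis by (rule runs_mono) (simp_all add: algebra_simps)
qed

text \<open>With \<open>max 1 m\<close> and \<open>max 2 L\<close> every factor of the bound is at
  least 1. The product then absorbs all lower-order terms, including the initialisation, which takes
  time even if there are no arcs or \<open>L = 1\<close>.\<close>

lemma runs_solve_bound:
  assumes \<omega>: "0 < \<omega>" "\<omega> < 1"
  shows "\<exists>T \<sigma>. exec solve (input_state G u k s t d L \<omega>) T \<sigma> \<and> approximate_solution \<omega> (output_flow \<sigma>) \<and>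
    real T \<le> 6000 * ((1 / \<omega>)\<^sup>2 * real (max 1 m + k) * real (max 1 m) * real L * log 2 (real (max 2 L)))"
proof -
  define Q where "Q = nat \<lceil>4 / \<omega>\<rceil>"
  define lgL where "lgL = nat \<lfloor>2 * log 2 (real (max 2 L))\<rfloor>"
  define X where "X = real (max 1 m + k)"
  define Y where "Y = real (max 1 m)"
  define Z where "Z = log 2 (real (max 2 L))"
  define W where "W = 1 / \<omega>"
  let ?S = "W\<^sup>2 * X * Y * real L * Z"
  have W: "1 \<le> W" using \<omega> by (simp add: W_def)
  have X: "1 \<le> X" "real m + real k \<le> X" "real k + 1 \<le> X" and Y: "1 \<le> Y" "real m \<le> Y" by (auto simp: X_def Y_def)
  have L: "1 \<le> real L" using length_bound_pos by simp
  have "log 2 2 \<le> Z" unfolding Z_def by (subst log_le_cancel_iff) auto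
  then have Z: "1 \<le> Z" by simp
  have Q: "real Q \<le> 5 * W"
  proof -
    have "real Q \<le> 4 / \<omega> + 1" unfolding Q_def using \<omega> by (simp add: of_nat_nat)
    then show ?thesis using W by (simp add: W_def)
  qed
  have lgL: "real lgL \<le> 2 * Z" unfolding lgL_def Z_def[symmetric] using Z by (simp add: of_nat_nat)
  obtain T \<sigma> where ex: "exec solve (input_state G u k s t d L \<omega>) T \<sigma>" "approximate_solution \<omega> (output_flow \<sigma>)"
    and T: "T \<le> 2 * Q + 3 * L + 3 * m + 3 * k + 16 +
      ((m + k) * (Q * Q * lgL) + (Q * Q * lgL) * (k + 1)) * (10 * m * L + 23 * L + 4 * m + 21)"
    using runs_solve[OF \<omega>] unfolding runs_def Q_def[symmetric] lgL_def[symmetric] by blast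
  \<comment> \<open>Setting all but one of the factors to 1 bounds each single factor by the whole
    product.\<close>
  have le_S: "a * b * c * e * f \<le> W\<^sup>2 * X * Y * real L * Z"
    if "0 \<le> a" "0 \<le> b" "0 \<le> c" "0 \<le> e" "0 \<le> f" "a \<le> W\<^sup>2" "b \<le> X" "c \<le> Y" "e \<le> real L" "f \<le> Z" for a b c e f
    using that by (intro mult_mono mult_nonneg_nonneg) auto
  have W2: "1 \<le> W\<^sup>2" "W \<le> W\<^sup>2" using W mult_mono[of 1 W 1 W] by (simp_all add: power2_eq_square)
  have S: "1 \<le> ?S" "W \<le> ?S" "X \<le> ?S" "real L \<le> ?S"
    using le_S[of 1 1 1 1 1] le_S[of W 1 1 1 1] le_S[of 1 X 1 1 1] le_S[of 1 1 1 "real L" 1] W W2 X Y L Z by simp_all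
  \<comment> \<open>Here 50 is \<open>5 * 5 * 2\<close>, and below 58 is
    \<open>10 + 23 + 4 + 21\<close> and 5800 is \<open>2 * 50 * 58\<close>. The 200 that remain up
    to 6000 cover the linear terms.\<close>
  have QQ: "real (Q * Q * lgL) \<le> 50 * (W\<^sup>2 * Z)"
  proof -
    have "real Q * real Q * real lgL \<le> (5 * W) * (5 * W) * (2 * Z)"
      using Q lgL W by (intro mult_mono) auto
    then show ?thesis by (simp add: power2_eq_square mult_ac)
  qed
  have B: "real (10 * m * L + 23 * L + 4 * m + 21) \<le> 58 * (Y * real L)"
  proof -
    have "real m * real L \<le> Y * real L" using Y L by (intro mult_right_mono) auto
    moreover have "1 * real L \<le> Y * real L" using Y L by (intro mult_right_mono) auto
    moreover have "Y * 1 \<le> Y * real L" using Y L by (intro mult_left_mono) auto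
    moreover have "real (10 * m * L + 23 * L + 4 * m + 21) = 10 * (real m * real L) + 23 * real L + 4 * real m + 21"
      by simp
    ultimately show ?thesis using Y by linarith
  qed
  have "real ((m + k) * (Q * Q * lgL) + (Q * Q * lgL) * (k + 1)) = (real m + real k + (real k + 1)) * real (Q * Q * lgL)"
    by (simp add: algebra_simps)
  also have "\<dots> \<le> (2 * X) * (50 * (W\<^sup>2 * Z))"
    using X QQ by (intro mult_mono) auto
  finally have "real ((m + k) * (Q * Q * lgL) + (Q * Q * lgL) * (k + 1)) * real (10 * m * L + 23 * L + 4 * m + 21)
      \<le> ((2 * X) * (50 * (W\<^sup>2 * Z))) * (58 * (Y * real L))"
    using B X Z by (intro mult_mono) auto
  also have "\<dots> = 5800 * ?S" by (simp add: mult_ac)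
  finally have main: "real (((m + k) * (Q * Q * lgL) + (Q * Q * lgL) * (k + 1)) * (10 * m * L + 23 * L + 4 * m + 21)) \<le> 5800 * ?S"
    by (simp only: of_nat_mult)
  have "real T \<le> real (2 * Q + 3 * L + 3 * m + 3 * k + 16 +
      ((m + k) * (Q * Q * lgL) + (Q * Q * lgL) * (k + 1)) * (10 * m * L + 23 * L + 4 * m + 21))"
    using T by (rule of_nat_mono)
  also have "\<dots> \<le> real (2 * Q + 3 * L + 3 * m + 3 * k + 16) + 5800 * ?S"
    unfolding of_nat_add[of "2 * Q + 3 * L + 3 * m + 3 * k + 16"] using main by (rule add_left_mono)
  also have "real (2 * Q + 3 * L + 3 * m + 3 * k + 16) = 2 * real Q + 3 * real L + 3 * real m + 3 * real k + 16"
    by simp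
  also have "\<dots> + 5800 * ?S \<le> 6000 * ?S" using Q S X by linarith
  finally show ?thesis using ex unfolding X_def Y_def Z_def W_def by blast
qed

end

theorem corollary2:
  "\<exists>(prog :: com) (C :: real).
     \<forall>(G :: (nat, nat) pre_digraph) u k s t d L \<omega> n m.
       lbmcf1 G u k s t d L \<and> verts G = {..<n} \<and> arcs G = {..<m} \<and> 0 < \<omega> \<and> \<omega> < 1 \<longrightarrow>
       (\<exists>T \<sigma>. exec prog (input_state G u k s t d L \<omega>) T \<sigma> \<and>
          lbmcf1.approximate_solution G u k s t d L \<omega> (output_flow \<sigma>) \<and>
          real T \<le> C * ((1 / \<omega>)\<^sup>2 * real (max 1 m + k) * real (max 1 m) * real L *
                       log 2 (real (max 2 L))))"
proof (rule exI[of _ solve], rule exI[of _ 6000], intro allI impI)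
  fix G :: "(nat, nat) pre_digraph" and u k s t d L and \<omega> :: real and n m
  assume a: "lbmcf1 G u k s t d L \<and> verts G = {..<n} \<and> arcs G = {..<m} \<and> 0 < \<omega> \<and> \<omega> < 1"
  then interpret lbmcf1 G u k s t d L by blast
  interpret numbered_lbmcf1 G u k s t d L n m \<omega> by unfold_locales (use a in auto)
  show "\<exists>T \<sigma>. exec solve (input_state G u k s t d L \<omega>) T \<sigma> \<and> approximate_solution \<omega> (output_flow \<sigma>) \<and>
    real T \<le> 6000 * ((1 / \<omega>)\<^sup>2 * real (max 1 m + k) * real (max 1 m) * real L * log 2 (real (max 2 L)))"
    using runs_solve_bound a by blast
qed

end
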